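(* (In intensional Martin-Löf type theory with function extensionality, and in particular in homotopy type theory.) Let $\Sigma\equiv(A,\leadsto,\Rightarrow)$ be a generalised 2-polygraph which is terminating, closed under congruence, cancels inverses, has a Winkler-Buchberger structure, and cancels empty closed zig-zags. Then $\Sigma$ has a homotopy basis, i.e. there is a function $$\alpha:\Pi\{x,y:A\},(u,v:x\leftrightsquigarrow^* y).\;(u\Leftrightarrow^* v).$$
   Context: Setting: intensional Martin-Löf type theory with a universe $\mathcal U$, $\Pi$, $\Sigma$, $\uplus$, inductive types and families, identity types written $a=b$, and function extensionality. Types are arbitrary (no h-level assumption), relations are arbitrary type families, and all "properties" below are data. For a type $X$ and a relation $R:X\to X\to\mathcal U$, the reflexive-transitive closure $R^*$ is the inductive family with constructors $\mathsf{nil}:\Pi(x:X).R^*(x,x)$ and $\mathsf{snoc}:\Pi\{x,y,z\}.R^*(x,y)\to R(y,z)\to R^*(x,z)$; the symmetric closure is $R(x,y)\uplus R(y,x)$; the symmetric-reflexive-transitive closure is the reflexive-transitive closure of the symmetric closure. For $\leadsto$ these are written $\leadsto^*$ (sequences), $\leftrightsquigarrow$, $\leftrightsquigarrow^*$ (zig-zags); for $\Rightarrow$ they are $\Rightarrow^*$, $\Leftrightarrow$, $\Leftrightarrow^*$. $\varepsilon_x:\equiv\mathsf{nil}(x)$; $u\cdot v$ is concatenation; $u^{-1}$ is the reversed zig-zag; $\mathsf{length}(u):\mathbb N$ is the number of steps. A generalised 2-polygraph is a triple $(A,\leadsto,\Rightarrow)$ with $A:\mathcal U$, $(\leadsto):A\to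 A\to\mathcal U$, and $(\Rightarrow):\Pi\{x,y:A\}.(x\leftrightsquigarrow^* y)\to(x\leftrightsquigarrow^* y)\to\mathcal U$. A relation $<$ is wellfounded if every element is accessible, where $\mathsf{acc}^<:A\to\mathcal U$ is the inductive family with constructor $\Pi(a:A).(\Pi(x:A).(x<a)\to\mathsf{acc}^<(x))\to\mathsf{acc}^<(a)$; $>$ is Noetherian if its reverse $<$ is wellfounded. - Terminating: equipped with a transitive Noetherian relation $>$ on $A$ and a function $\Pi\{x,y:A\}.(x\leadsto y)\to(x>y)$. - Closed under congruence: for all $u:x\leftrightsquigarrow^* y$, $w,w':y\leftrightsquigarrow^* y'$, $v:y'\leftrightsquigarrow^* z$ and $\alpha:w\Leftrightarrow^* w'$ we have an element of $(u\cdot w\cdot v\Leftrightarrow^* u\cdot w'\cdot v)$. - Cancels inverses: a function $\Pi\{x,y:A\},(u:x\leftrightsquigarrow^* y).(u\cdot u^{-1}\Rightarrow^*\varepsilon_x)$. - Winkler-Buchberger structure: for each local peak $u\equiv s^{-1}\cdot t:y\leftrightsquigarrow^* z$ (with $s:x\leadsto y$, $t:x\leadsto z$), a zig-zag $u':y\leftrightsquigarrow^* z$ such that $x>x_i$ for every object $x_i$ occurring in the inner part of $u'$ (i.e. strictly between its first and last object), together with an element of $(u\Leftrightarrow^* u')$. - Cancels empty closed zig-zags: a function $\Pi\{x:A\},(u:x\leftrightsquigarrow^* x).(\mathsf{length}(u)=0)\to(u\Leftrightarrow^*\varepsilon_x)$. *)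

theory Defs
  imports Main
begin

section \<open>Intensional Martin-Loef type theory\<close>

text \<open>
  Isabelle's own types cannot play the role of types here, since equality in HOL is proof
  irrelevant and every Isabelle type is a set. The statement is therefore about derivability in a
  formal system: Martin-Loef type theory with a cumulative hierarchy of Russell universes,
  judgmental beta and eta for \<open>\<Pi>\<close>, and function extensionality. The system is presented as in the
  first presentation of type theory in the appendix of the HoTT book: a core calculus of universes
  and \<open>\<Pi>\<close>, together with constants that have closed types and closed defining equations.
  Terms are raw terms with de Bruijn indices; the numbers attached to constants are universe levels.

  Neither uniqueness of identity proofs, nor reflection of identity into judgmental equality, nor
  univalence is present, and the only inductive types and families are those occurring in the
  statement together with the empty type; so everything derivable here is derivable in every
  extension, in particular in homotopy type theory.
\<close>

datatype const =
    KEmpty | KEmptyInd nat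
  | KUnit | KStar | KUnitInd nat
  | KNat | KZero | KSucc | KNatInd nat
  | KSum nat | KInl nat | KInr nat | KSumInd nat nat
  | KSigma nat | KPair nat | KSigmaInd nat nat
  | KId nat | KRefl nat | KIdInd nat nat
  | KClos nat | KNil nat | KSnoc nat | KClosInd nat nat
  | KAcc nat | KAccIn nat | KAccInd nat nat
  | KFunext nat

datatype tm = Var nat | Univ nat | Const const | Pi tm tm | Lam tm tm | App tm tm

primrec shift :: "nat \<Rightarrow> nat \<Rightarrow> tm \<Rightarrow> tm" where
  "shift d c (Var k) = Var (if k < c then k else k + d)"
| "shift d c (Univ i) = Univ i"
| "shift d c (Const k) = Const k"
| "shift d c (Pi A B) = Pi (shift d c A) (shift d (Suc c) B)"
| "shift d c (Lam A b) = Lam (shift d c A) (shift d (Suc c) b)"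
| "shift d c (App f a) = App (shift d c f) (shift d c a)"

text \<open>\<open>subst k s t\<close> removes the variable \<open>k\<close> from \<open>t\<close>; the term \<open>s\<close> lives outside the \<open>k\<close>
  innermost binders.\<close>

primrec subst :: "nat \<Rightarrow> tm \<Rightarrow> tm \<Rightarrow> tm" where
  "subst k s (Var n) = (if n < k then Var n else if n = k then shift k 0 s else Var (n - 1))"
| "subst k s (Univ i) = Univ i"
| "subst k s (Const c) = Const c"
| "subst k s (Pi A B) = Pi (subst k s A) (subst (Suc k) s B)"
| "subst k s (Lam A b) = Lam (subst k s A) (subst (Suc k) s b)"
| "subst k s (App f a) = App (subst k s f) (subst k s a)"


subsection \<open>Writing raw terms with named variables\<close>

text \<open>
  To write raw terms legibly, binders of the object language are written with Isabelle variables.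
  An element of \<open>stm\<close> maps a number \<open>n\<close> of enclosing binders to a raw term; a variable introduced
  below \<open>n\<close> binders has, when it is used below \<open>m\<close> binders, the de Bruijn index \<open>m - Suc n\<close>. Hence
  \<open>close\<close> turns a closed expression into the expected de Bruijn term. For instance
  \<open>close (\<Pi> A:U i. A \<rightarrow> A)\<close> is \<open>Pi (Univ i) (Pi (Var 0) (Var 1))\<close>.
\<close>

type_synonym stm = "nat \<Rightarrow> tm"

definition close :: "stm \<Rightarrow> tm" where
  "close t = t 0"

definition bvar :: "nat \<Rightarrow> stm" where
  "bvar n = (\<lambda>m. Var (m - Suc n))"

definition U :: "nat \<Rightarrow> stm" where
  "U i = (\<lambda>n. Univ i)"

definition cst :: "const \<Rightarrow> stm" where
  "cst c = (\<lambda>n. Const c)"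

definition app :: "stm \<Rightarrow> stm \<Rightarrow> stm" (infixl "\<cdot>" 90) where
  "f \<cdot> a = (\<lambda>n. App (f n) (a n))"

definition pi :: "stm \<Rightarrow> (stm \<Rightarrow> stm) \<Rightarrow> stm" where
  "pi A B = (\<lambda>n. Pi (A n) (B (bvar n) (Suc n)))"

definition lam :: "stm \<Rightarrow> (stm \<Rightarrow> stm) \<Rightarrow> stm" where
  "lam A b = (\<lambda>n. Lam (A n) (b (bvar n) (Suc n)))"

definition arrow :: "stm \<Rightarrow> stm \<Rightarrow> stm" (infixr "\<rightarrow>" 60) where
  "A \<rightarrow> B = pi A (\<lambda>_. B)"

syntax
  "_pi" :: "pttrn \<Rightarrow> stm \<Rightarrow> stm \<Rightarrow> stm" ("(3\<Pi> _:_./ _)" [0, 60, 60] 60)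
  "_lam" :: "pttrn \<Rightarrow> stm \<Rightarrow> stm \<Rightarrow> stm" ("(3\<Lambda> _:_./ _)" [0, 60, 60] 60)
translations
  "\<Pi> x:A. B" \<rightleftharpoons> "CONST pi A (\<lambda>x. B)"
  "\<Lambda> x:A. b" \<rightleftharpoons> "CONST lam A (\<lambda>x. b)"


subsection \<open>The constants applied to all their arguments\<close>

definition empty_ty :: stm where
  "empty_ty = cst KEmpty"

definition unit_ty :: stm where
  "unit_ty = cst KUnit"

definition unit_star :: stm where
  "unit_star = cst KStar"

definition unit_ind :: "nat \<Rightarrow> stm \<Rightarrow> stm \<Rightarrow> stm \<Rightarrow> stm" where
  "unit_ind j C c t = cst (KUnitInd j) \<cdot> C \<cdot> c \<cdot> t"

definition nat_ty :: stm where
  "nat_ty = cst KNat"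

definition nat_zero :: stm where
  "nat_zero = cst KZero"

definition nat_succ :: "stm \<Rightarrow> stm" where
  "nat_succ m = cst KSucc \<cdot> m"

definition nat_ind :: "nat \<Rightarrow> stm \<Rightarrow> stm \<Rightarrow> stm \<Rightarrow> stm \<Rightarrow> stm" where
  "nat_ind j C z s m = cst (KNatInd j) \<cdot> C \<cdot> z \<cdot> s \<cdot> m"

definition sum_ty :: "nat \<Rightarrow> stm \<Rightarrow> stm \<Rightarrow> stm" where
  "sum_ty i A B = cst (KSum i) \<cdot> A \<cdot> B"

definition sum_inl :: "nat \<Rightarrow> stm \<Rightarrow> stm \<Rightarrow> stm \<Rightarrow> stm" where
  "sum_inl i A B a = cst (KInl i) \<cdot> A \<cdot> B \<cdot> a"

definition sum_inr :: "nat \<Rightarrow> stm \<Rightarrow> stm \<Rightarrow> stm \<Rightarrow> stm" where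
  "sum_inr i A B b = cst (KInr i) \<cdot> A \<cdot> B \<cdot> b"

definition sum_ind :: "nat \<Rightarrow> nat \<Rightarrow> stm \<Rightarrow> stm \<Rightarrow> stm \<Rightarrow> stm \<Rightarrow> stm \<Rightarrow> stm \<Rightarrow> stm" where
  "sum_ind i j A B C f g s = cst (KSumInd i j) \<cdot> A \<cdot> B \<cdot> C \<cdot> f \<cdot> g \<cdot> s"

definition sigma_ty :: "nat \<Rightarrow> stm \<Rightarrow> stm \<Rightarrow> stm" where
  "sigma_ty i A B = cst (KSigma i) \<cdot> A \<cdot> B"

definition sigma_pair :: "nat \<Rightarrow> stm \<Rightarrow> stm \<Rightarrow> stm \<Rightarrow> stm \<Rightarrow> stm" where
  "sigma_pair i A B a b = cst (KPair i) \<cdot> A \<cdot> B \<cdot> a \<cdot> b"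

definition sigma_ind :: "nat \<Rightarrow> nat \<Rightarrow> stm \<Rightarrow> stm \<Rightarrow> stm \<Rightarrow> stm \<Rightarrow> stm \<Rightarrow> stm" where
  "sigma_ind i j A B C f p = cst (KSigmaInd i j) \<cdot> A \<cdot> B \<cdot> C \<cdot> f \<cdot> p"

definition id_ty :: "nat \<Rightarrow> stm \<Rightarrow> stm \<Rightarrow> stm \<Rightarrow> stm" where
  "id_ty i A a b = cst (KId i) \<cdot> A \<cdot> a \<cdot> b"

definition id_refl :: "nat \<Rightarrow> stm \<Rightarrow> stm \<Rightarrow> stm" where
  "id_refl i A a = cst (KRefl i) \<cdot> A \<cdot> a"

definition id_ind :: "nat \<Rightarrow> nat \<Rightarrow> stm \<Rightarrow> stm \<Rightarrow> stm \<Rightarrow> stm \<Rightarrow> stm \<Rightarrow> stm \<Rightarrow> stm" where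
  "id_ind i j A C c x y p = cst (KIdInd i j) \<cdot> A \<cdot> C \<cdot> c \<cdot> x \<cdot> y \<cdot> p"

definition clos_ty :: "nat \<Rightarrow> stm \<Rightarrow> stm \<Rightarrow> stm \<Rightarrow> stm \<Rightarrow> stm" where
  "clos_ty i X R x y = cst (KClos i) \<cdot> X \<cdot> R \<cdot> x \<cdot> y"

definition clos_nil :: "nat \<Rightarrow> stm \<Rightarrow> stm \<Rightarrow> stm \<Rightarrow> stm" where
  "clos_nil i X R x = cst (KNil i) \<cdot> X \<cdot> R \<cdot> x"

definition clos_snoc :: "nat \<Rightarrow> stm \<Rightarrow> stm \<Rightarrow> stm \<Rightarrow> stm \<Rightarrow> stm \<Rightarrow> stm \<Rightarrow> stm \<Rightarrow> stm" where
  "clos_snoc i X R x y z u r = cst (KSnoc i) \<cdot> X \<cdot> R \<cdot> x \<cdot> y \<cdot> z \<cdot> u \<cdot> r"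

definition clos_ind ::
  "nat \<Rightarrow> nat \<Rightarrow> stm \<Rightarrow> stm \<Rightarrow> stm \<Rightarrow> stm \<Rightarrow> stm \<Rightarrow> stm \<Rightarrow> stm \<Rightarrow> stm \<Rightarrow> stm" where
  "clos_ind i j X R C n s x y u = cst (KClosInd i j) \<cdot> X \<cdot> R \<cdot> C \<cdot> n \<cdot> s \<cdot> x \<cdot> y \<cdot> u"

definition acc_ty :: "nat \<Rightarrow> stm \<Rightarrow> stm \<Rightarrow> stm \<Rightarrow> stm" where
  "acc_ty i X L a = cst (KAcc i) \<cdot> X \<cdot> L \<cdot> a"

definition acc_in :: "nat \<Rightarrow> stm \<Rightarrow> stm \<Rightarrow> stm \<Rightarrow> stm \<Rightarrow> stm" where
  "acc_in i X L a h = cst (KAccIn i) \<cdot> X \<cdot> L \<cdot> a \<cdot> h"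

definition acc_ind :: "nat \<Rightarrow> nat \<Rightarrow> stm \<Rightarrow> stm \<Rightarrow> stm \<Rightarrow> stm \<Rightarrow> stm \<Rightarrow> stm \<Rightarrow> stm" where
  "acc_ind i j X L C s a p = cst (KAccInd i j) \<cdot> X \<cdot> L \<cdot> C \<cdot> s \<cdot> a \<cdot> p"


subsection \<open>Types of the constants\<close>

text \<open>
  \<open>KClos\<close> and \<open>KAcc\<close> are the inductive families of the reflexive-transitive closure and of
  accessibility. Function extensionality is assumed in its weak form, from which the statement
  that \<open>happly\<close> is an equivalence is derivable.
\<close>

definition nil_case_ty :: "nat \<Rightarrow> stm \<Rightarrow> stm \<Rightarrow> stm \<Rightarrow> stm" where
  "nil_case_ty i X R C = (\<Pi> x:X. C \<cdot> x \<cdot> x \<cdot> clos_nil i X R x)"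

definition snoc_case_ty :: "nat \<Rightarrow> stm \<Rightarrow> stm \<Rightarrow> stm \<Rightarrow> stm" where
  "snoc_case_ty i X R C =
    (\<Pi> x:X. \<Pi> y:X. \<Pi> z:X. \<Pi> u:clos_ty i X R x y. \<Pi> r:R \<cdot> y \<cdot> z.
      C \<cdot> x \<cdot> y \<cdot> u \<rightarrow> C \<cdot> x \<cdot> z \<cdot> clos_snoc i X R x y z u r)"

definition acc_case_ty :: "nat \<Rightarrow> stm \<Rightarrow> stm \<Rightarrow> stm \<Rightarrow> stm" where
  "acc_case_ty i X L C =
    (\<Pi> a:X. \<Pi> h:(\<Pi> x:X. L \<cdot> x \<cdot> a \<rightarrow> acc_ty i X L x).
      (\<Pi> x:X. \<Pi> l:L \<cdot> x \<cdot> a. C \<cdot> x \<cdot> (h \<cdot> x \<cdot> l)) \<rightarrow> C \<cdot> a \<cdot> acc_in i X L a h)"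

fun const_ty :: "const \<Rightarrow> stm" where
  "const_ty KEmpty = U 0"
| "const_ty (KEmptyInd j) = (\<Pi> C:(empty_ty \<rightarrow> U j). \<Pi> t:empty_ty. C \<cdot> t)"
| "const_ty KUnit = U 0"
| "const_ty KStar = unit_ty"
| "const_ty (KUnitInd j) = (\<Pi> C:(unit_ty \<rightarrow> U j). C \<cdot> unit_star \<rightarrow> (\<Pi> t:unit_ty. C \<cdot> t))"
| "const_ty KNat = U 0"
| "const_ty KZero = nat_ty"
| "const_ty KSucc = nat_ty \<rightarrow> nat_ty"
| "const_ty (KNatInd j) =
    (\<Pi> C:(nat_ty \<rightarrow> U j). C \<cdot> nat_zero \<rightarrow> (\<Pi> m:nat_ty. C \<cdot> m \<rightarrow> C \<cdot> nat_succ m) \<rightarrow> (\<Pi> m:nat_ty. C \<cdot> m))"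
| "const_ty (KSum i) = U i \<rightarrow> U i \<rightarrow> U i"
| "const_ty (KInl i) = (\<Pi> A:U i. \<Pi> B:U i. A \<rightarrow> sum_ty i A B)"
| "const_ty (KInr i) = (\<Pi> A:U i. \<Pi> B:U i. B \<rightarrow> sum_ty i A B)"
| "const_ty (KSumInd i j) =
    (\<Pi> A:U i. \<Pi> B:U i. \<Pi> C:(sum_ty i A B \<rightarrow> U j).
      (\<Pi> a:A. C \<cdot> sum_inl i A B a) \<rightarrow> (\<Pi> b:B. C \<cdot> sum_inr i A B b) \<rightarrow> (\<Pi> s:sum_ty i A B. C \<cdot> s))"
| "const_ty (KSigma i) = (\<Pi> A:U i. (A \<rightarrow> U i) \<rightarrow> U i)"
| "const_ty (KPair i) = (\<Pi> A:U i. \<Pi> B:(A \<rightarrow> U i). \<Pi> a:A. B \<cdot> a \<rightarrow> sigma_ty i A B)"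
| "const_ty (KSigmaInd i j) =
    (\<Pi> A:U i. \<Pi> B:(A \<rightarrow> U i). \<Pi> C:(sigma_ty i A B \<rightarrow> U j).
      (\<Pi> a:A. \<Pi> b:B \<cdot> a. C \<cdot> sigma_pair i A B a b) \<rightarrow> (\<Pi> p:sigma_ty i A B. C \<cdot> p))"
| "const_ty (KId i) = (\<Pi> A:U i. A \<rightarrow> A \<rightarrow> U i)"
| "const_ty (KRefl i) = (\<Pi> A:U i. \<Pi> a:A. id_ty i A a a)"
| "const_ty (KIdInd i j) =
    (\<Pi> A:U i. \<Pi> C:(\<Pi> x:A. \<Pi> y:A. id_ty i A x y \<rightarrow> U j).
      (\<Pi> x:A. C \<cdot> x \<cdot> x \<cdot> id_refl i A x) \<rightarrow> (\<Pi> x:A. \<Pi> y:A. \<Pi> p:id_ty i A x y. C \<cdot> x \<cdot> y \<cdot> p))"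
| "const_ty (KClos i) = (\<Pi> X:U i. (X \<rightarrow> X \<rightarrow> U i) \<rightarrow> X \<rightarrow> X \<rightarrow> U i)"
| "const_ty (KNil i) = (\<Pi> X:U i. \<Pi> R:(X \<rightarrow> X \<rightarrow> U i). \<Pi> x:X. clos_ty i X R x x)"
| "const_ty (KSnoc i) =
    (\<Pi> X:U i. \<Pi> R:(X \<rightarrow> X \<rightarrow> U i). \<Pi> x:X. \<Pi> y:X. \<Pi> z:X.
      clos_ty i X R x y \<rightarrow> R \<cdot> y \<cdot> z \<rightarrow> clos_ty i X R x z)"
| "const_ty (KClosInd i j) =
    (\<Pi> X:U i. \<Pi> R:(X \<rightarrow> X \<rightarrow> U i). \<Pi> C:(\<Pi> x:X. \<Pi> y:X. clos_ty i X R x y \<rightarrow> U j).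
      nil_case_ty i X R C \<rightarrow> snoc_case_ty i X R C \<rightarrow>
      (\<Pi> x:X. \<Pi> y:X. \<Pi> u:clos_ty i X R x y. C \<cdot> x \<cdot> y \<cdot> u))"
| "const_ty (KAcc i) = (\<Pi> X:U i. (X \<rightarrow> X \<rightarrow> U i) \<rightarrow> X \<rightarrow> U i)"
| "const_ty (KAccIn i) =
    (\<Pi> X:U i. \<Pi> L:(X \<rightarrow> X \<rightarrow> U i). \<Pi> a:X. (\<Pi> x:X. L \<cdot> x \<cdot> a \<rightarrow> acc_ty i X L x) \<rightarrow> acc_ty i X L a)"
| "const_ty (KAccInd i j) =
    (\<Pi> X:U i. \<Pi> L:(X \<rightarrow> X \<rightarrow> U i). \<Pi> C:(\<Pi> a:X. acc_ty i X L a \<rightarrow> U j).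
      acc_case_ty i X L C \<rightarrow> (\<Pi> a:X. \<Pi> p:acc_ty i X L a. C \<cdot> a \<cdot> p))"
| "const_ty (KFunext i) =
    (\<Pi> A:U i. \<Pi> B:(A \<rightarrow> U i). \<Pi> f:(\<Pi> x:A. B \<cdot> x). \<Pi> g:(\<Pi> x:A. B \<cdot> x).
      (\<Pi> x:A. id_ty i (B \<cdot> x) (f \<cdot> x) (g \<cdot> x)) \<rightarrow> id_ty i (\<Pi> x:A. B \<cdot> x) f g)"


subsection \<open>Defining equations of the constants\<close>

text \<open>
  An equation between terms of the same type (left-hand side, right-hand side, type) under a
  telescope is represented by the equation between closed functions that results from
  abstracting over the telescope.
\<close>

type_synonym eqn = "nat \<Rightarrow> tm \<times> tm \<times> tm"

definition eqn :: "stm \<Rightarrow> stm \<Rightarrow> stm \<Rightarrow> eqn" ("(_ \<doteq>/ _ :/ _)" [61, 61, 61] 60) where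
  "(l \<doteq> r : T) = (\<lambda>n. (l n, r n, T n))"

definition all_eqn :: "stm \<Rightarrow> (stm \<Rightarrow> eqn) \<Rightarrow> eqn" where
  "all_eqn A E = (\<lambda>n. case E (bvar n) (Suc n) of
    (l, r, T) \<Rightarrow> (Lam (A n) l, Lam (A n) r, Pi (A n) T))"

syntax
  "_all_eqn" :: "pttrn \<Rightarrow> stm \<Rightarrow> eqn \<Rightarrow> eqn" ("(3\<And>\<And> _:_./ _)" [0, 60, 60] 60)
translations
  "\<And>\<And> x:A. E" \<rightleftharpoons> "CONST all_eqn A (\<lambda>x. E)"

inductive defining_eqn :: "eqn \<Rightarrow> bool" where
  comp_unit_star: "defining_eqn
    (\<And>\<And> C:(unit_ty \<rightarrow> U j). \<And>\<And> c:C \<cdot> unit_star. unit_ind j C c unit_star \<doteq> c : C \<cdot> unit_star)"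
| comp_nat_zero: "defining_eqn
    (\<And>\<And> C:(nat_ty \<rightarrow> U j). \<And>\<And> z:C \<cdot> nat_zero. \<And>\<And> s:(\<Pi> m:nat_ty. C \<cdot> m \<rightarrow> C \<cdot> nat_succ m).
      nat_ind j C z s nat_zero \<doteq> z : C \<cdot> nat_zero)"
| comp_nat_succ: "defining_eqn
    (\<And>\<And> C:(nat_ty \<rightarrow> U j). \<And>\<And> z:C \<cdot> nat_zero. \<And>\<And> s:(\<Pi> m:nat_ty. C \<cdot> m \<rightarrow> C \<cdot> nat_succ m). \<And>\<And> m:nat_ty.
      nat_ind j C z s (nat_succ m) \<doteq> s \<cdot> m \<cdot> nat_ind j C z s m : C \<cdot> nat_succ m)"
| comp_sum_inl: "defining_eqn
    (\<And>\<And> A:U i. \<And>\<And> B:U i. \<And>\<And> C:(sum_ty i A B \<rightarrow> U j).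
     \<And>\<And> f:(\<Pi> a:A. C \<cdot> sum_inl i A B a). \<And>\<And> g:(\<Pi> b:B. C \<cdot> sum_inr i A B b). \<And>\<And> a:A.
      sum_ind i j A B C f g (sum_inl i A B a) \<doteq> f \<cdot> a : C \<cdot> sum_inl i A B a)"
| comp_sum_inr: "defining_eqn
    (\<And>\<And> A:U i. \<And>\<And> B:U i. \<And>\<And> C:(sum_ty i A B \<rightarrow> U j).
     \<And>\<And> f:(\<Pi> a:A. C \<cdot> sum_inl i A B a). \<And>\<And> g:(\<Pi> b:B. C \<cdot> sum_inr i A B b). \<And>\<And> b:B.
      sum_ind i j A B C f g (sum_inr i A B b) \<doteq> g \<cdot> b : C \<cdot> sum_inr i A B b)"
| comp_sigma_pair: "defining_eqn
    (\<And>\<And> A:U i. \<And>\<And> B:(A \<rightarrow> U i). \<And>\<And> C:(sigma_ty i A B \<rightarrow> U j).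
     \<And>\<And> f:(\<Pi> a:A. \<Pi> b:B \<cdot> a. C \<cdot> sigma_pair i A B a b). \<And>\<And> a:A. \<And>\<And> b:B \<cdot> a.
      sigma_ind i j A B C f (sigma_pair i A B a b) \<doteq> f \<cdot> a \<cdot> b : C \<cdot> sigma_pair i A B a b)"
| comp_id_refl: "defining_eqn
    (\<And>\<And> A:U i. \<And>\<And> C:(\<Pi> x:A. \<Pi> y:A. id_ty i A x y \<rightarrow> U j).
     \<And>\<And> c:(\<Pi> x:A. C \<cdot> x \<cdot> x \<cdot> id_refl i A x). \<And>\<And> x:A.
      id_ind i j A C c x x (id_refl i A x) \<doteq> c \<cdot> x : C \<cdot> x \<cdot> x \<cdot> id_refl i A x)"
| comp_clos_nil: "defining_eqn
    (\<And>\<And> X:U i. \<And>\<And> R:(X \<rightarrow> X \<rightarrow> U i). \<And>\<And> C:(\<Pi> x:X. \<Pi> y:X. clos_ty i X R x y \<rightarrow> U j).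
     \<And>\<And> n:nil_case_ty i X R C. \<And>\<And> s:snoc_case_ty i X R C. \<And>\<And> x:X.
      clos_ind i j X R C n s x x (clos_nil i X R x) \<doteq> n \<cdot> x : C \<cdot> x \<cdot> x \<cdot> clos_nil i X R x)"
| comp_clos_snoc: "defining_eqn
    (\<And>\<And> X:U i. \<And>\<And> R:(X \<rightarrow> X \<rightarrow> U i). \<And>\<And> C:(\<Pi> x:X. \<Pi> y:X. clos_ty i X R x y \<rightarrow> U j).
     \<And>\<And> n:nil_case_ty i X R C. \<And>\<And> s:snoc_case_ty i X R C.
     \<And>\<And> x:X. \<And>\<And> y:X. \<And>\<And> z:X. \<And>\<And> u:clos_ty i X R x y. \<And>\<And> r:R \<cdot> y \<cdot> z.
      clos_ind i j X R C n s x z (clos_snoc i X R x y z u r)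
        \<doteq> s \<cdot> x \<cdot> y \<cdot> z \<cdot> u \<cdot> r \<cdot> clos_ind i j X R C n s x y u
        : C \<cdot> x \<cdot> z \<cdot> clos_snoc i X R x y z u r)"
| comp_acc_in: "defining_eqn
    (\<And>\<And> X:U i. \<And>\<And> L:(X \<rightarrow> X \<rightarrow> U i). \<And>\<And> C:(\<Pi> a:X. acc_ty i X L a \<rightarrow> U j).
     \<And>\<And> s:acc_case_ty i X L C. \<And>\<And> a:X. \<And>\<And> h:(\<Pi> x:X. L \<cdot> x \<cdot> a \<rightarrow> acc_ty i X L x).
      acc_ind i j X L C s a (acc_in i X L a h)
        \<doteq> s \<cdot> a \<cdot> h \<cdot> (\<Lambda> x:X. \<Lambda> l:L \<cdot> x \<cdot> a. acc_ind i j X L C s x (h \<cdot> x \<cdot> l))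
        : C \<cdot> a \<cdot> acc_in i X L a h)"


subsection \<open>Derivability\<close>

text \<open>Contexts list the most recent variable first; \<open>\<Gamma> ! n\<close> is the type of \<open>Var n\<close> in the part of
  the context before that variable.\<close>

inductive
  ctx :: "tm list \<Rightarrow> bool" and
  has_type :: "tm list \<Rightarrow> tm \<Rightarrow> tm \<Rightarrow> bool" ("(_ \<turnstile>/ _ :/ _)" [51, 51, 51] 50) and
  judg_equal :: "tm list \<Rightarrow> tm \<Rightarrow> tm \<Rightarrow> tm \<Rightarrow> bool" ("(_ \<turnstile>/ _ \<equiv>/ _ :/ _)" [51, 51, 51, 51] 50)
where
  ctx_Nil: "ctx []"
| ctx_Cons: "\<Gamma> \<turnstile> A : Univ i \<Longrightarrow> ctx (A # \<Gamma>)"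

| ty_Var: "ctx \<Gamma> \<Longrightarrow> n < length \<Gamma> \<Longrightarrow> \<Gamma> \<turnstile> Var n : shift (Suc n) 0 (\<Gamma> ! n)"
| ty_Const: "ctx \<Gamma> \<Longrightarrow> \<Gamma> \<turnstile> Const c : close (const_ty c)"
| ty_Univ: "ctx \<Gamma> \<Longrightarrow> \<Gamma> \<turnstile> Univ i : Univ (Suc i)"
| ty_cumul: "\<Gamma> \<turnstile> A : Univ i \<Longrightarrow> \<Gamma> \<turnstile> A : Univ (Suc i)"
| ty_Pi: "\<Gamma> \<turnstile> A : Univ i \<Longrightarrow> A # \<Gamma> \<turnstile> B : Univ i \<Longrightarrow> \<Gamma> \<turnstile> Pi A B : Univ i"
| ty_Lam: "A # \<Gamma> \<turnstile> b : B \<Longrightarrow> \<Gamma> \<turnstile> Lam A b : Pi A B"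
| ty_App: "\<Gamma> \<turnstile> f : Pi A B \<Longrightarrow> \<Gamma> \<turnstile> a : A \<Longrightarrow> \<Gamma> \<turnstile> App f a : subst 0 a B"
| ty_conv: "\<Gamma> \<turnstile> a : A \<Longrightarrow> \<Gamma> \<turnstile> A \<equiv> B : Univ i \<Longrightarrow> \<Gamma> \<turnstile> a : B"

| jeq_refl: "\<Gamma> \<turnstile> a : A \<Longrightarrow> \<Gamma> \<turnstile> a \<equiv> a : A"
| jeq_sym: "\<Gamma> \<turnstile> a \<equiv> b : A \<Longrightarrow> \<Gamma> \<turnstile> b \<equiv> a : A"
| jeq_trans: "\<Gamma> \<turnstile> a \<equiv> b : A \<Longrightarrow> \<Gamma> \<turnstile> b \<equiv> c : A \<Longrightarrow> \<Gamma> \<turnstile> a \<equiv> c : A"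
| jeq_conv: "\<Gamma> \<turnstile> a \<equiv> b : A \<Longrightarrow> \<Gamma> \<turnstile> A \<equiv> B : Univ i \<Longrightarrow> \<Gamma> \<turnstile> a \<equiv> b : B"
| jeq_cumul: "\<Gamma> \<turnstile> A \<equiv> B : Univ i \<Longrightarrow> \<Gamma> \<turnstile> A \<equiv> B : Univ (Suc i)"
| jeq_Pi: "\<Gamma> \<turnstile> A \<equiv> A' : Univ i \<Longrightarrow> A # \<Gamma> \<turnstile> B \<equiv> B' : Univ i \<Longrightarrow> \<Gamma> \<turnstile> Pi A B \<equiv> Pi A' B' : Univ i"
| jeq_Lam: "\<Gamma> \<turnstile> A \<equiv> A' : Univ i \<Longrightarrow> A # \<Gamma> \<turnstile> b \<equiv> b' : B \<Longrightarrow> \<Gamma> \<turnstile> Lam A b \<equiv> Lam A' b' : Pi A B"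
| jeq_App: "\<Gamma> \<turnstile> f \<equiv> f' : Pi A B \<Longrightarrow> \<Gamma> \<turnstile> a \<equiv> a' : A \<Longrightarrow> \<Gamma> \<turnstile> App f a \<equiv> App f' a' : subst 0 a B"
| jeq_beta: "A # \<Gamma> \<turnstile> b : B \<Longrightarrow> \<Gamma> \<turnstile> a : A \<Longrightarrow> \<Gamma> \<turnstile> App (Lam A b) a \<equiv> subst 0 a b : subst 0 a B"
| jeq_eta: "\<Gamma> \<turnstile> f : Pi A B \<Longrightarrow> \<Gamma> \<turnstile> f \<equiv> Lam A (App (shift 1 0 f) (Var 0)) : Pi A B"
| jeq_defining: "ctx \<Gamma> \<Longrightarrow> defining_eqn E \<Longrightarrow> E 0 = (l, r, T) \<Longrightarrow> \<Gamma> \<turnstile> l \<equiv> r : T"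


section \<open>Zig-zags\<close>

text \<open>Sequences of steps of a relation \<open>R\<close> on \<open>X\<close>, both in \<open>U i\<close>.\<close>

context
  fixes i :: nat and X R :: stm
begin

definition clos_single :: "stm \<Rightarrow> stm \<Rightarrow> stm \<Rightarrow> stm" where
  "clos_single x y r = clos_snoc i X R x x y (clos_nil i X R x) r"

text \<open>Concatenation of \<open>u\<close> from \<open>x\<close> to \<open>y\<close> and \<open>v\<close> from \<open>y\<close> to \<open>z\<close>, by recursion on \<open>v\<close>.\<close>

definition append :: "stm \<Rightarrow> stm \<Rightarrow> stm \<Rightarrow> stm \<Rightarrow> stm \<Rightarrow> stm" where
  "append x y z u v =
    clos_ind i i X R
      (\<Lambda> a:X. \<Lambda> b:X. \<Lambda> _:clos_ty i X R a b. clos_ty i X R x a \<rightarrow> clos_ty i X R x b)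
      (\<Lambda> a:X. \<Lambda> w:clos_ty i X R x a. w)
      (\<Lambda> a:X. \<Lambda> b:X. \<Lambda> c:X. \<Lambda> _:clos_ty i X R a b. \<Lambda> r:R \<cdot> b \<cdot> c.
       \<Lambda> h:(clos_ty i X R x a \<rightarrow> clos_ty i X R x b). \<Lambda> w:clos_ty i X R x a.
         clos_snoc i X R x b c (h \<cdot> w) r)
      y z v \<cdot> u"

definition clos_length :: "stm \<Rightarrow> stm \<Rightarrow> stm \<Rightarrow> stm" where
  "clos_length x y u =
    clos_ind i 0 X R
      (\<Lambda> a:X. \<Lambda> b:X. \<Lambda> _:clos_ty i X R a b. nat_ty)
      (\<Lambda> a:X. nat_zero)
      (\<Lambda> a:X. \<Lambda> b:X. \<Lambda> c:X. \<Lambda> _:clos_ty i X R a b. \<Lambda> _:R \<cdot> b \<cdot> c. \<Lambda> h:nat_ty. nat_succ h)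
      x y u"

text \<open>\<open>P\<close> holds of all objects of \<open>u\<close> except its first one: the objects of \<open>snoc u r\<close> are those
  of \<open>u\<close>, followed by the target of \<open>r\<close>.\<close>

definition all_but_first :: "(stm \<Rightarrow> stm) \<Rightarrow> stm \<Rightarrow> stm \<Rightarrow> stm \<Rightarrow> stm" where
  "all_but_first P x y u =
    clos_ind i (Suc i) X R
      (\<Lambda> a:X. \<Lambda> b:X. \<Lambda> _:clos_ty i X R a b. U i)
      (\<Lambda> a:X. unit_ty)
      (\<Lambda> a:X. \<Lambda> b:X. \<Lambda> c:X. \<Lambda> _:clos_ty i X R a b. \<Lambda> _:R \<cdot> b \<cdot> c. \<Lambda> h:U i.
         sigma_ty i h (\<Lambda> _:h. P c))
      x y u"

text \<open>\<open>P\<close> holds of all objects strictly between the first and the last object of \<open>u\<close>.\<close>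

definition all_inner :: "(stm \<Rightarrow> stm) \<Rightarrow> stm \<Rightarrow> stm \<Rightarrow> stm \<Rightarrow> stm" where
  "all_inner P x y u =
    clos_ind i (Suc i) X R
      (\<Lambda> a:X. \<Lambda> b:X. \<Lambda> _:clos_ty i X R a b. U i)
      (\<Lambda> a:X. unit_ty)
      (\<Lambda> a:X. \<Lambda> b:X. \<Lambda> c:X. \<Lambda> w:clos_ty i X R a b. \<Lambda> _:R \<cdot> b \<cdot> c. \<Lambda> _:U i.
         all_but_first P a b w)
      x y u"

definition sym_closure :: stm where
  "sym_closure = (\<Lambda> x:X. \<Lambda> y:X. sum_ty i (R \<cdot> x \<cdot> y) (R \<cdot> y \<cdot> x))"

end

definition zig :: "nat \<Rightarrow> stm \<Rightarrow> stm \<Rightarrow> stm \<Rightarrow> stm \<Rightarrow> stm" where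
  "zig i X R x y = clos_ty i X (sym_closure i X R) x y"

context
  fixes i :: nat and X R :: stm
begin

definition empty_zig :: "stm \<Rightarrow> stm" where
  "empty_zig x = clos_nil i X (sym_closure i X R) x"

definition forward :: "stm \<Rightarrow> stm \<Rightarrow> stm \<Rightarrow> stm" where
  "forward x y s = clos_single i X (sym_closure i X R) x y (sum_inl i (R \<cdot> x \<cdot> y) (R \<cdot> y \<cdot> x) s)"

definition zconcat :: "stm \<Rightarrow> stm \<Rightarrow> stm \<Rightarrow> stm \<Rightarrow> stm \<Rightarrow> stm" where
  "zconcat x y z u v = append i X (sym_closure i X R) x y z u v"

definition reverse_step :: "stm \<Rightarrow> stm \<Rightarrow> stm \<Rightarrow> stm" where
  "reverse_step x y r =
    sum_ind i i (R \<cdot> x \<cdot> y) (R \<cdot> y \<cdot> x)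
      (\<Lambda> _:sum_ty i (R \<cdot> x \<cdot> y) (R \<cdot> y \<cdot> x). sum_ty i (R \<cdot> y \<cdot> x) (R \<cdot> x \<cdot> y))
      (\<Lambda> s:R \<cdot> x \<cdot> y. sum_inr i (R \<cdot> y \<cdot> x) (R \<cdot> x \<cdot> y) s)
      (\<Lambda> s:R \<cdot> y \<cdot> x. sum_inl i (R \<cdot> y \<cdot> x) (R \<cdot> x \<cdot> y) s)
      r"

definition zinv :: "stm \<Rightarrow> stm \<Rightarrow> stm \<Rightarrow> stm" where
  "zinv x y u =
    clos_ind i i X (sym_closure i X R)
      (\<Lambda> a:X. \<Lambda> b:X. \<Lambda> _:zig i X R a b. zig i X R b a)
      (\<Lambda> a:X. empty_zig a)
      (\<Lambda> a:X. \<Lambda> b:X. \<Lambda> c:X. \<Lambda> _:zig i X R a b. \<Lambda> r:sym_closure i X R \<cdot> b \<cdot> c. \<Lambda> h:zig i X R b a.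
         zconcat c b a (clos_single i X (sym_closure i X R) c b (reverse_step b c r)) h)
      x y u"

end


section \<open>Generalised 2-polygraphs\<close>

text \<open>
  A generalised 2-polygraph consists of \<open>A : U i\<close>, \<open>R : rel_ty i A\<close> and \<open>D : rewrite_ty i A R\<close>, the
  last two being the relations written with a wavy and with a double arrow. \<open>G\<close> is the order \<open>>\<close>.
\<close>

definition rel_ty :: "nat \<Rightarrow> stm \<Rightarrow> stm" where
  "rel_ty i A = (A \<rightarrow> A \<rightarrow> U i)"

definition rewrite_ty :: "nat \<Rightarrow> stm \<Rightarrow> stm \<Rightarrow> stm" where
  "rewrite_ty i A R = (\<Pi> x:A. \<Pi> y:A. zig i A R x y \<rightarrow> zig i A R x y \<rightarrow> U i)"

definition transitive :: "stm \<Rightarrow> stm \<Rightarrow> stm" where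
  "transitive A G = (\<Pi> x:A. \<Pi> y:A. \<Pi> z:A. G \<cdot> x \<cdot> y \<rightarrow> G \<cdot> y \<cdot> z \<rightarrow> G \<cdot> x \<cdot> z)"

definition wellfounded :: "nat \<Rightarrow> stm \<Rightarrow> stm \<Rightarrow> stm" where
  "wellfounded i A L = (\<Pi> a:A. acc_ty i A L a)"

definition noetherian :: "nat \<Rightarrow> stm \<Rightarrow> stm \<Rightarrow> stm" where
  "noetherian i A G = wellfounded i A (\<Lambda> x:A. \<Lambda> y:A. G \<cdot> y \<cdot> x)"

definition steps_decrease :: "stm \<Rightarrow> stm \<Rightarrow> stm \<Rightarrow> stm" where
  "steps_decrease A R G = (\<Pi> x:A. \<Pi> y:A. R \<cdot> x \<cdot> y \<rightarrow> G \<cdot> x \<cdot> y)"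

context
  fixes i :: nat and A R D :: stm
begin

definition rewrite_seq :: "stm \<Rightarrow> stm \<Rightarrow> stm \<Rightarrow> stm \<Rightarrow> stm" where
  "rewrite_seq x y u v = clos_ty i (zig i A R x y) (D \<cdot> x \<cdot> y) u v"

definition rewrite_zig :: "stm \<Rightarrow> stm \<Rightarrow> stm \<Rightarrow> stm \<Rightarrow> stm" where
  "rewrite_zig x y u v = zig i (zig i A R x y) (D \<cdot> x \<cdot> y) u v"

definition closed_under_congruence :: stm where
  "closed_under_congruence =
    (\<Pi> x:A. \<Pi> y:A. \<Pi> y':A. \<Pi> z:A.
     \<Pi> u:zig i A R x y. \<Pi> w:zig i A R y y'. \<Pi> w':zig i A R y y'. \<Pi> v:zig i A R y' z.
      rewrite_zig y y' w w' \<rightarrow>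
      rewrite_zig x z
        (zconcat i A R x y' z (zconcat i A R x y y' u w) v)
        (zconcat i A R x y' z (zconcat i A R x y y' u w') v))"

definition cancels_inverses :: stm where
  "cancels_inverses =
    (\<Pi> x:A. \<Pi> y:A. \<Pi> u:zig i A R x y.
      rewrite_seq x x (zconcat i A R x y x u (zinv i A R x y u)) (empty_zig i A R x))"

definition winkler_buchberger :: "stm \<Rightarrow> stm" where
  "winkler_buchberger G =
    (\<Pi> x:A. \<Pi> y:A. \<Pi> z:A. \<Pi> s:R \<cdot> x \<cdot> y. \<Pi> t:R \<cdot> x \<cdot> z.
      sigma_ty i (zig i A R y z) (\<Lambda> u':zig i A R y z.
        sigma_ty i (all_inner i A (sym_closure i A R) (\<lambda>a. G \<cdot> x \<cdot> a) y z u')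
          (\<Lambda> _:all_inner i A (sym_closure i A R) (\<lambda>a. G \<cdot> x \<cdot> a) y z u'.
            rewrite_zig y z
              (zconcat i A R y x z (zinv i A R x y (forward i A R x y s)) (forward i A R x z t))
              u')))"

definition cancels_empty_closed :: stm where
  "cancels_empty_closed =
    (\<Pi> x:A. \<Pi> u:zig i A R x x.
      id_ty 0 nat_ty (clos_length i A (sym_closure i A R) x x u) nat_zero \<rightarrow>
      rewrite_zig x x u (empty_zig i A R x))"

definition homotopy_basis :: stm where
  "homotopy_basis =
    (\<Pi> x:A. \<Pi> y:A. \<Pi> u:zig i A R x y. \<Pi> v:zig i A R x y. rewrite_zig x y u v)"

end

end

theory Submission
  imports Defs
begin

text \<open>
  The theorem only asks for some inhabitant, so most of the derivation is about inhabited types.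

  Up to \<open>\<Leftrightarrow>\<^sup>*\<close>, zig-zags form a groupoid. As in the proof of Newman's lemma, Noetherian induction on
  \<open>x\<close> shows that two descending paths from \<open>x\<close> can be completed to a commuting square: the local peak
  at \<open>x\<close> is replaced by its Winkler-Buchberger zig-zag, all of whose objects lie below \<open>x\<close>, so that by
  induction hypothesis this zig-zag is equal to a valley, and the two remaining spans start below \<open>x\<close>.
  A second Noetherian induction shows that parallel descending paths \<open>p, q\<close> from \<open>x\<close> to \<open>z\<close> are equal:
  confluence yields \<open>l, r\<close> with \<open>p \<cdot> l = q \<cdot> r\<close>, and \<open>l = r\<close> by induction hypothesis at \<open>z\<close>.
  If \<open>p\<close> is empty, then \<open>q\<close> is a closed path, which has length zero and cancels, or makes \<open>x\<close>
  smaller than itself. Finally, every zig-zag is equal to a valley; joining the valleys of two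
  parallel zig-zags reduces their equality to that of parallel descending paths.
\<close>

section \<open>Weakening\<close>

text \<open>What shapes the proof is that every step must be a derivation in a calculus of raw
  terms. The only metatheorem about derivations is weakening; a substitution theorem for judgements
  is avoided. Premises about a bound variable are stated for all terms in all extensions of the
  context, so variables of the metalogic stand for object variables and weakening carries facts
  between contexts. The price is a naturality condition on Isabelle functions used as bodies of
  binders: they must commute with renaming and substitution of raw terms. Induction is available
  only through eliminators, so each inductive claim, Noetherian hypotheses included, is coded as a
  type and shown inhabited. Eliminators vary all indices of a family, hence motives quantify over
  data that depend on an endpoint. Composition of zig-zags recurses on its second argument. Its
  right unit law is therefore judgmental; the left one needs induction with an equality finer than
  \<open>\<Leftrightarrow>\<^sup>*\<close>, since the given congruence only reaches a zig-zag behind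
  a prefix.\<close>

lemma shift_shift: "c \<le> k \<Longrightarrow> shift d (k + e) (shift e c t) = shift e c (shift d k t)"
  by (induction t arbitrary: c k) (auto simp flip: add_Suc)

lemma shift_shift_merge: "c \<le> k \<Longrightarrow> k \<le> c + e \<Longrightarrow> shift d k (shift e c t) = shift (e + d) c t"
  by (induction t arbitrary: c k) auto

lemma shift_subst:
  "shift d (k + c) (subst k s t) = subst k (shift d c s) (shift d (Suc (k + c)) t)"
proof (induction t arbitrary: k)
  case (Var n)
  show ?case using shift_shift[of 0 c d k s] by (auto simp: add.commute)
next
  case (Pi A B) then show ?case using Pi.IH(2)[of "Suc k"] by simp
next
  case (Lam A B) then show ?case using Lam.IH(2)[of "Suc k"] by simp
qed auto

text \<open>Terms written with HOAS binders commute with shifting and substitution; this is a free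
  theorem for the type \<open>stm\<close>, obtained from a logical relation over traversals \<open>\<phi>\<close> of raw terms, where
  \<open>\<phi> j\<close> acts below \<open>j\<close> binders and changes the length of the context from \<open>p\<close> to \<open>q\<close>.\<close>

definition traversal :: "(nat \<Rightarrow> tm \<Rightarrow> tm) \<Rightarrow> nat \<Rightarrow> nat \<Rightarrow> nat \<Rightarrow> bool" where
  "traversal \<phi> p q n \<longleftrightarrow> n \<le> p \<and> n \<le> q \<and>
    (\<forall>j i. \<phi> j (Univ i) = Univ i) \<and> (\<forall>j c. \<phi> j (Const c) = Const c) \<and>
    (\<forall>j A B. \<phi> j (Pi A B) = Pi (\<phi> j A) (\<phi> (Suc j) B)) \<and>
    (\<forall>j A B. \<phi> j (Lam A B) = Lam (\<phi> j A) (\<phi> (Suc j) B)) \<and>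
    (\<forall>j f a. \<phi> j (App f a) = App (\<phi> j f) (\<phi> j a)) \<and>
    (\<forall>j v. v < j \<longrightarrow> \<phi> j (Var v) = Var v) \<and>
    (\<forall>j m. m < n \<longrightarrow> \<phi> j (Var (p + j - Suc m)) = Var (q + j - Suc m))"

text \<open>The flag tells whether the outermost level \<open>j = 0\<close> is excluded: a variable bound inside the
  term has no meaning there.\<close>

definition related ::
  "(nat \<Rightarrow> tm \<Rightarrow> tm) \<Rightarrow> nat \<Rightarrow> nat \<Rightarrow> bool \<Rightarrow> stm \<Rightarrow> stm \<Rightarrow> bool" where
  "related \<phi> p q b t t' \<longleftrightarrow> (\<forall>j. (b \<longrightarrow> 0 < j) \<longrightarrow> \<phi> j (t (p + j)) = t' (q + j))"

text \<open>\<open>n\<close> counts context entries by level, oldest first: the term may refer to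
  these only, and must depend naturally on the depth. Such a term needs no renaming when the context
  grows; the same \<open>stm\<close> is evaluated at a larger depth.\<close>

definition uniform :: "nat \<Rightarrow> stm \<Rightarrow> bool" where
  "uniform n t \<longleftrightarrow> (\<forall>\<phi> p q. traversal \<phi> p q n \<longrightarrow> related \<phi> p q False t t)"

text \<open>Naturality of the body of a binder. One flag \<open>b\<close> for argument and value
  makes it serve twice: with \<open>b\<close> true below a binder (\<open>uniform_pi\<close>), and
  with \<open>b\<close> false when a term is plugged in by substitution at depth 0
  (\<open>family_subst\<close>).\<close>

definition family :: "nat \<Rightarrow> (stm \<Rightarrow> stm) \<Rightarrow> bool" where
  "family n B \<longleftrightarrow> (\<forall>\<phi> p q b x x'. traversal \<phi> p q n \<longrightarrow> related \<phi> p q b x x' \<longrightarrow>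
     related \<phi> p q b (B x) (B x'))"

section \<open>Closure properties of the logical relation\<close>

lemma traversal_mono: "traversal \<phi> p q n \<Longrightarrow> m \<le> n \<Longrightarrow> traversal \<phi> p q m"
  by (auto simp: traversal_def)

lemma uniform_mono: "uniform m t \<Longrightarrow> m \<le> n \<Longrightarrow> uniform n t"
  unfolding uniform_def by (meson traversal_mono)

lemma related_weaken: "related \<phi> p q b t t' \<Longrightarrow> related \<phi> p q True t t'"
  by (auto simp: related_def)

lemma related_uniform: "traversal \<phi> p q n \<Longrightarrow> uniform n t \<Longrightarrow> related \<phi> p q b t t"
  by (auto simp: related_def uniform_def)

lemma related_const:
  assumes "traversal \<phi> p q n"
  shows "related \<phi> p q b (cst c) (cst c)" "related \<phi> p q b (U i) (U i)"
  using assms by (auto simp: related_def cst_def U_def traversal_def)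

lemma related_app:
  assumes "traversal \<phi> p q n" "related \<phi> p q b f f'" "related \<phi> p q b a a'"
  shows "related \<phi> p q b (f \<cdot> a) (f' \<cdot> a')"
  using assms by (auto simp: related_def app_def traversal_def)

text \<open>Below \<open>j'\<close> further binders both variables have index
  \<open>j' - Suc j\<close>, which is less than \<open>j'\<close> and hence untouched by the
  traversal. At \<open>j' = 0\<close> truncated subtraction yields index 0, a context variable that
  the traversal may move; this is why the flag must be \<open>True\<close>.\<close>

lemma related_bvar:
  assumes "traversal \<phi> p q n"
  shows "related \<phi> p q True (bvar (p + j)) (bvar (q + j))"
proof -
  have "\<phi> j' (Var (j' - Suc j)) = Var (j' - Suc j)" if "0 < j'" for j'
    using assms that by (simp add: traversal_def)
  then show ?thesis by (simp add: related_def bvar_def)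
qed

lemma related_pi:
  assumes t: "traversal \<phi> p q n" and A: "related \<phi> p q b A A'"
    and B: "\<And>x x'. related \<phi> p q True x x' \<Longrightarrow> related \<phi> p q True (B x) (B' x')"
  shows "related \<phi> p q b (pi A B) (pi A' B')"
proof -
  have "\<phi> (Suc j) (B (bvar (p + j)) (Suc (p + j))) = B' (bvar (q + j)) (Suc (q + j))" for j
    using B[OF related_bvar[OF t, of j]] unfolding related_def by (metis add_Suc_right zero_less_Suc)
  then show ?thesis using t A by (auto simp: related_def pi_def traversal_def)
qed

lemma related_lam:
  assumes t: "traversal \<phi> p q n" and A: "related \<phi> p q b A A'"
    and B: "\<And>x x'. related \<phi> p q True x x' \<Longrightarrow> related \<phi> p q True (B x) (B' x')"
  shows "related \<phi> p q b (lam A B) (lam A' B')"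
proof -
  have "\<phi> (Suc j) (B (bvar (p + j)) (Suc (p + j))) = B' (bvar (q + j)) (Suc (q + j))" for j
    using B[OF related_bvar[OF t, of j]] unfolding related_def by (metis add_Suc_right zero_less_Suc)
  then show ?thesis using t A by (auto simp: related_def lam_def traversal_def)
qed

lemma related_arrow:
  assumes "traversal \<phi> p q n" "related \<phi> p q b A A'" "related \<phi> p q b B B'"
  shows "related \<phi> p q b (A \<rightarrow> B) (A' \<rightarrow> B')"
  unfolding arrow_def using assms by (blast intro: related_pi related_weaken)

lemma uniformI:
  assumes "\<And>\<phi> p q. traversal \<phi> p q n \<Longrightarrow> related \<phi> p q False t t"
  shows "uniform n t"
  using assms by (auto simp: uniform_def)

lemma familyI:
  assumes "\<And>\<phi> p q b x x'. traversal \<phi> p q n \<Longrightarrow> related \<phi> p q b x x' \<Longrightarrow>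
    related \<phi> p q True x x' \<Longrightarrow> related \<phi> p q b (B x) (B x')"
  shows "family n B"
  using assms related_weaken unfolding family_def by blast

definition family3 :: "nat \<Rightarrow> (stm \<Rightarrow> stm \<Rightarrow> stm \<Rightarrow> stm) \<Rightarrow> bool" where
  "family3 n M \<longleftrightarrow> (\<forall>\<phi> p q b x x' y y' u u'. traversal \<phi> p q n \<longrightarrow> related \<phi> p q b x x' \<longrightarrow>
     related \<phi> p q b y y' \<longrightarrow> related \<phi> p q b u u' \<longrightarrow> related \<phi> p q b (M x y u) (M x' y' u'))"

lemma family3I:
  assumes "\<And>\<phi> p q b x x' y y' u u'. traversal \<phi> p q n \<Longrightarrow> related \<phi> p q b x x' \<Longrightarrow>
    related \<phi> p q True x x' \<Longrightarrow> related \<phi> p q b y y' \<Longrightarrow> related \<phi> p q True y y' \<Longrightarrow>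
    related \<phi> p q b u u' \<Longrightarrow> related \<phi> p q True u u' \<Longrightarrow> related \<phi> p q b (M x y u) (M x' y' u')"
  shows "family3 n M"
  using assms related_weaken unfolding family3_def by blast

lemma family3_related: "traversal \<phi> p q n \<Longrightarrow> family3 n M \<Longrightarrow> related \<phi> p q b x x' \<Longrightarrow>
  related \<phi> p q b y y' \<Longrightarrow> related \<phi> p q b u u' \<Longrightarrow> related \<phi> p q b (M x y u) (M x' y' u')"
  unfolding family3_def by blast

lemma uniform_family: "family n B \<Longrightarrow> uniform n a \<Longrightarrow> uniform n (B a)"
  unfolding family_def uniform_def by blast

lemma family_related: "traversal \<phi> p q n \<Longrightarrow> family n B \<Longrightarrow> related \<phi> p q b x x' \<Longrightarrow>
  related \<phi> p q b (B x) (B x')"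
  unfolding family_def by blast

lemma traversal_shift: "traversal (\<lambda>j. shift d (c + j)) (n + c) (n + c + d) n"
  by (auto simp: traversal_def)

text \<open>With no context variable to track, both lengths may be 0 whatever the cutoff
  \<open>c\<close> is. This makes closed terms invariant under every shift.\<close>

lemma traversal_closed: "traversal (\<lambda>j. shift d (c + j)) 0 0 0"
  by (auto simp: traversal_def)

text \<open>The variable substituted for is the newest one, of level \<open>n\<close>; only the
  \<open>n\<close> older levels have to be preserved.\<close>

lemma traversal_subst: "traversal (\<lambda>j. subst j s) (Suc n) n n"
  by (auto simp: traversal_def)

lemma uniform_at: "uniform n t \<Longrightarrow> traversal \<phi> p q n \<Longrightarrow> \<phi> 0 (t p) = t q"
  unfolding uniform_def related_def by (metis add_0_right)

lemma uniform_shift: "uniform n t \<Longrightarrow> t (n + d) = shift d 0 (t n)"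
  using uniform_at[OF _ traversal_shift[of d 0 n]] by simp

lemma uniform_closed: "uniform 0 t \<Longrightarrow> shift d c (t 0) = t 0"
  using uniform_at[OF _ traversal_closed[of d c]] by simp

lemma uniform_closed': "uniform 0 t \<Longrightarrow> t n = t 0"
  using uniform_shift[of 0 t n] uniform_closed[of t n 0] by simp

lemma uniform_subst: "uniform n t \<Longrightarrow> subst 0 s (t (Suc n)) = t n"
  using uniform_at[OF _ traversal_subst[of s n]] by simp

text \<open>The free theorem of \<open>B\<close> at the traversal that substitutes \<open>a\<close>:
  at length \<open>Suc n\<close> the variable \<open>bvar n\<close> has index 0, so this traversal
  relates it to \<open>a\<close>. It turns de Bruijn substitution in the rules for application and
  beta into application of the Isabelle function \<open>B\<close>.\<close>

lemma family_subst:
  assumes B: "family n B" and a: "uniform n a"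
  shows "subst 0 (a n) (B (bvar n) (Suc n)) = B a n"
proof -
  have "related (\<lambda>j. subst j (a n)) (Suc n) n False (bvar n) a"
    using uniform_shift[OF a] by (auto simp: related_def bvar_def)
  then have "related (\<lambda>j. subst j (a n)) (Suc n) n False (B (bvar n)) (B a)"
    using B traversal_subst unfolding family_def by blast
  then show ?thesis unfolding related_def by (metis add_0_right)
qed

lemma uniform_bvar: "m < n \<Longrightarrow> uniform n (bvar m)"
  by (auto simp: uniform_def related_def bvar_def traversal_def)

lemma all_eqn_eqn: "all_eqn A (\<lambda>x. eqn (l x) (r x) (T x)) = eqn (lam A l) (lam A r) (pi A T)"
  by (simp add: all_eqn_def eqn_def lam_def pi_def)

lemmas const_defs = empty_ty_def unit_ty_def unit_star_def unit_ind_def nat_ty_def nat_zero_def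
  nat_succ_def nat_ind_def sum_ty_def sum_inl_def sum_inr_def sum_ind_def sigma_ty_def
  sigma_pair_def sigma_ind_def id_ty_def id_refl_def id_ind_def clos_ty_def clos_nil_def
  clos_snoc_def clos_ind_def acc_ty_def acc_in_def acc_ind_def nil_case_ty_def snoc_case_ty_def
  acc_case_ty_def

lemma uniform_const_ty: "uniform 0 (const_ty c)"
  apply (rule uniformI)
  apply (cases c; simp only: const_ty.simps const_defs)
  apply (assumption | rule related_const related_app related_pi related_lam related_arrow)+
  done

lemma uniform_defining_eqn:
  "defining_eqn E \<Longrightarrow> \<exists>l r T. E = eqn l r T \<and> uniform 0 l \<and> uniform 0 r \<and> uniform 0 T"
  apply (induction rule: defining_eqn.induct)
  apply (unfold all_eqn_eqn const_defs)
  apply (rule exI conjI refl uniformI | assumption | rule related_const related_app related_pi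
    related_lam related_arrow)+
  done

text \<open>Stated for all suffixes of the context, because \<open>ty_Lam\<close> has its only
  premise in the longer context \<open>A # \<Gamma>\<close>; well-formedness of
  \<open>\<Gamma>\<close> has to be read off from there.\<close>

lemma judgement_ctx:
  "ctx \<Gamma> \<Longrightarrow> \<forall>\<Delta> \<Theta>. \<Gamma> = \<Delta> @ \<Theta> \<longrightarrow> ctx \<Theta>"
  "\<Gamma> \<turnstile> a : A \<Longrightarrow> \<forall>\<Delta> \<Theta>. \<Gamma> = \<Delta> @ \<Theta> \<longrightarrow> ctx \<Theta>"
  "\<Gamma> \<turnstile> a \<equiv> b : A \<Longrightarrow> \<forall>\<Delta> \<Theta>. \<Gamma> = \<Delta> @ \<Theta> \<longrightarrow> ctx \<Theta>"
proof (induction rule: ctx_has_type_judg_equal.inducts)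
  case (ctx_Cons \<Gamma> A i)
  show ?case
  proof (intro allI impI)
    fix \<Delta> \<Theta> assume "A # \<Gamma> = \<Delta> @ \<Theta>"
    then show "ctx \<Theta>"
      using ctx_Cons ctx_has_type_judg_equal.ctx_Cons by (cases \<Delta>) auto
  qed
next
  case (ty_Lam A \<Gamma> b B) then show ?case by (metis append_Cons)
qed (auto intro: ctx_Nil)

lemma has_type_ctx: "\<Gamma> \<turnstile> a : A \<Longrightarrow> ctx \<Gamma>"
  using judgement_ctx(2) by blast

primrec shift_ctx :: "nat \<Rightarrow> tm list \<Rightarrow> tm list" where
  "shift_ctx d [] = []"
| "shift_ctx d (A # \<Delta>) = shift d (length \<Delta>) A # shift_ctx d \<Delta>"

lemma length_shift_ctx [simp]: "length (shift_ctx d \<Delta>) = length \<Delta>"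
  by (induction \<Delta>) auto

lemma nth_shift_ctx: "n < length \<Delta> \<Longrightarrow> shift_ctx d \<Delta> ! n = shift d (length \<Delta> - Suc n) (\<Delta> ! n)"
  by (induction \<Delta> arbitrary: n) (auto simp: nth_Cons less_Suc_eq_0_disj split: nat.split)

lemma shift_const_ty: "shift d c (close (const_ty k)) = close (const_ty k)"
  unfolding close_def by (intro uniform_closed uniform_const_ty)

lemma shift_defining_eqn:
  assumes "defining_eqn E" "E 0 = (l, r, T)"
  shows "shift d c l = l \<and> shift d c r = r \<and> shift d c T = T"
  using uniform_defining_eqn[OF assms(1)] assms(2) by (auto simp: eqn_def uniform_closed)

text \<open>The block is inserted in the middle, since the prefix \<open>\<Delta>\<close> grows
  whenever the induction passes a binder. Well-formedness of the enlarged base is a separate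
  premise: nothing in the given derivation types \<open>\<Theta>\<close>.\<close>

lemma weakening:
  "ctx \<Gamma> \<Longrightarrow> (\<And>\<Delta>. \<Gamma> = \<Delta> @ \<Gamma>0 \<Longrightarrow> ctx (\<Theta> @ \<Gamma>0) \<Longrightarrow> ctx (shift_ctx (length \<Theta>) \<Delta> @ \<Theta> @ \<Gamma>0))"
  "\<Gamma> \<turnstile> a : A \<Longrightarrow> (\<And>\<Delta>. \<Gamma> = \<Delta> @ \<Gamma>0 \<Longrightarrow> ctx (\<Theta> @ \<Gamma>0) \<Longrightarrow>
    shift_ctx (length \<Theta>) \<Delta> @ \<Theta> @ \<Gamma>0 \<turnstile> shift (length \<Theta>) (length \<Delta>) a : shift (length \<Theta>) (length \<Delta>) A)"
  "\<Gamma> \<turnstile> a \<equiv> b : A \<Longrightarrow> (\<And>\<Delta>. \<Gamma> = \<Delta> @ \<Gamma>0 \<Longrightarrow> ctx (\<Theta> @ \<Gamma>0) \<Longrightarrow>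
    shift_ctx (length \<Theta>) \<Delta> @ \<Theta> @ \<Gamma>0 \<turnstile> shift (length \<Theta>) (length \<Delta>) a
      \<equiv> shift (length \<Theta>) (length \<Delta>) b : shift (length \<Theta>) (length \<Delta>) A)"
proof (induction rule: ctx_has_type_judg_equal.inducts)
  case (ctx_Cons \<Gamma> A i)
  then show ?case
    by (cases \<Delta>) (auto intro: ctx_has_type_judg_equal.ctx_Cons)
next
  case (ty_Var \<Gamma> n)
  let ?d = "length \<Theta>"
  let ?\<Gamma> = "shift_ctx ?d \<Delta> @ \<Theta> @ \<Gamma>0"
  have c: "ctx ?\<Gamma>" using ty_Var by blast
  show ?case
  \<comment> \<open>A variable newer than the block keeps its index, and the two shifts of its type
    commute. An older one has its index raised by the length of the block, and the two shifts
    merge.\<close>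
  proof (cases "n < length \<Delta>")
    case True
    have "?\<Gamma> ! n = shift ?d (length \<Delta> - Suc n) (\<Delta> ! n)"
      using True by (simp add: nth_append nth_shift_ctx)
    then have "shift (Suc n) 0 (?\<Gamma> ! n) = shift ?d (length \<Delta>) (shift (Suc n) 0 (\<Delta> ! n))"
      using shift_shift[of 0 "length \<Delta> - Suc n" ?d "Suc n" "\<Delta> ! n"]
      unfolding le_add_diff_inverse2[OF Suc_leI[OF True]] by simp
    then show ?thesis
      using ctx_has_type_judg_equal.ty_Var[OF c, of n] True ty_Var by (simp add: nth_append)
  next
    case False
    then have "n + ?d = length (shift_ctx ?d \<Delta>) + (length \<Theta> + (n - length \<Delta>))" by simp
    then have "?\<Gamma> ! (n + ?d) = \<Gamma>0 ! (n - length \<Delta>)"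
      by (simp only: nth_append_length_plus)
    moreover have "shift ?d (length \<Delta>) (shift (Suc n) 0 (\<Gamma>0 ! (n - length \<Delta>)))
        = shift (Suc n + ?d) 0 (\<Gamma>0 ! (n - length \<Delta>))"
      using False by (intro shift_shift_merge) auto
    ultimately show ?thesis
      using ctx_has_type_judg_equal.ty_Var[OF c, of "n + ?d"] False ty_Var by (simp add: nth_append)
  qed
next
  case (ty_Lam A \<Gamma> b B)
  then show ?case using ty_Lam.IH[of "A # \<Delta>"] by (auto intro: ctx_has_type_judg_equal.ty_Lam)
next
  case (ty_Pi \<Gamma> A i B)
  then show ?case using ty_Pi.IH(2)[of "A # \<Delta>"] by (auto intro: ctx_has_type_judg_equal.ty_Pi)
next
  case (ty_App \<Gamma> f A B a)
  then show ?case
    using ctx_has_type_judg_equal.ty_App shift_subst[of _ 0 "length \<Delta>"] by fastforce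
next
  case (jeq_App \<Gamma> f f' A B a a')
  then show ?case
    using ctx_has_type_judg_equal.jeq_App shift_subst[of _ 0 "length \<Delta>"] by fastforce
next
  case (jeq_Pi \<Gamma> A A' i B B')
  then show ?case using jeq_Pi.IH(2)[of "A # \<Delta>"] by (auto intro: ctx_has_type_judg_equal.jeq_Pi)
next
  case (jeq_Lam \<Gamma> A A' i b b' B)
  then show ?case using jeq_Lam.IH(2)[of "A # \<Delta>"] by (auto intro: ctx_has_type_judg_equal.jeq_Lam)
next
  case (jeq_beta A \<Gamma> b B a)
  then show ?case
    using jeq_beta.IH(1)[of "A # \<Delta>"] ctx_has_type_judg_equal.jeq_beta[of "shift (length \<Theta>) (length
      \<Delta>) A"]
    by (simp add: shift_subst[of _ 0, simplified])
next
  case (jeq_eta \<Gamma> f A B)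
  then show ?case
    using ctx_has_type_judg_equal.jeq_eta shift_shift[of 0 "length \<Delta>" "length \<Theta>" 1 f] by simp
next
  case (jeq_defining \<Gamma> E l r T)
  then show ?case
    using shift_defining_eqn[OF jeq_defining.hyps(2,3)]
    by (auto intro: ctx_has_type_judg_equal.jeq_defining)
qed (auto simp: shift_const_ty intro: ctx_has_type_judg_equal.intros)

lemma weakening_front:
  assumes "ctx (\<Theta> @ \<Gamma>)"
  shows "\<Gamma> \<turnstile> a : A \<Longrightarrow> \<Theta> @ \<Gamma> \<turnstile> shift (length \<Theta>) 0 a : shift (length \<Theta>) 0 A"
    and "\<Gamma> \<turnstile> a \<equiv> b : A \<Longrightarrow>
      \<Theta> @ \<Gamma> \<turnstile> shift (length \<Theta>) 0 a \<equiv> shift (length \<Theta>) 0 b : shift (length \<Theta>) 0 A"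
  using weakening(2)[where ?\<Gamma>0.0 = \<Gamma> and \<Delta> = "[]" and \<Theta> = \<Theta>, OF _ _ assms]
    weakening(3)[where ?\<Gamma>0.0 = \<Gamma> and \<Delta> = "[]" and \<Theta> = \<Theta>, OF _ _ assms] by simp_all

section \<open>Judgements about uniform terms\<close>

definition ext :: "tm list \<Rightarrow> tm list \<Rightarrow> bool" where
  "ext \<Gamma> \<Delta> \<longleftrightarrow> ctx \<Delta> \<and> (\<exists>\<Theta>. \<Delta> = \<Theta> @ \<Gamma>)"

definition has :: "tm list \<Rightarrow> stm \<Rightarrow> stm \<Rightarrow> bool" where
  "has \<Gamma> t T \<longleftrightarrow> uniform (length \<Gamma>) t \<and> uniform (length \<Gamma>) T \<and> \<Gamma> \<turnstile> t (length \<Gamma>) : T (length \<Gamma>)"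

definition jeq :: "tm list \<Rightarrow> stm \<Rightarrow> stm \<Rightarrow> stm \<Rightarrow> bool" where
  "jeq \<Gamma> a b T \<longleftrightarrow> uniform (length \<Gamma>) a \<and> uniform (length \<Gamma>) b \<and> uniform (length \<Gamma>) T \<and>
     \<Gamma> \<turnstile> a (length \<Gamma>) \<equiv> b (length \<Gamma>) : T (length \<Gamma>)"

text \<open>The witness is a raw term at the depth of \<open>\<Gamma>\<close>, with no naturality
  demanded of it. Where a later argument has to mention an inhabitant, it is replaced by a new
  variable, see \<open>inh_obtain\<close>.\<close>

definition inh :: "tm list \<Rightarrow> stm \<Rightarrow> bool" where
  "inh \<Gamma> T \<longleftrightarrow> uniform (length \<Gamma>) T \<and> (\<exists>t. \<Gamma> \<turnstile> t : T (length \<Gamma>))"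

lemma ext_trans [trans]: "ext \<Gamma> \<Delta> \<Longrightarrow> ext \<Delta> \<Theta> \<Longrightarrow> ext \<Gamma> \<Theta>"
  by (auto simp: ext_def)

lemma ext_refl: "ctx \<Gamma> \<Longrightarrow> ext \<Gamma> \<Gamma>"
  by (auto simp: ext_def)

lemma has_ctx: "has \<Gamma> t T \<Longrightarrow> ctx \<Gamma>"
  by (auto simp: has_def dest: has_type_ctx)

lemma has_ext: "has \<Gamma> t T \<Longrightarrow> ext \<Gamma> \<Gamma>"
  by (blast intro: has_ctx ext_refl)

lemma extE:
  assumes "ext \<Gamma> \<Delta>"
  obtains \<Theta> where "\<Delta> = \<Theta> @ \<Gamma>" "ctx (\<Theta> @ \<Gamma>)" "length \<Delta> = length \<Gamma> + length \<Theta>"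
  using assms by (auto simp: ext_def)

text \<open>By \<open>uniform_shift\<close> the shifts produced by weakening are absorbed by
  evaluating \<open>t\<close> and \<open>T\<close> at the larger depth, so the judgement moves to
  \<open>\<Delta>\<close> with its terms unchanged.\<close>

lemma has_mono:
  assumes "has \<Gamma> t T" "ext \<Gamma> \<Delta>"
  shows "has \<Delta> t T"
  using assms(2)
proof (rule extE)
  fix \<Theta> assume \<Theta>: "\<Delta> = \<Theta> @ \<Gamma>" "ctx (\<Theta> @ \<Gamma>)" "length \<Delta> = length \<Gamma> + length \<Theta>"
  show ?thesis
    using assms(1) weakening_front(1)[OF \<Theta>(2), of "t (length \<Gamma>)" "T (length \<Gamma>)"]
    unfolding has_def \<Theta>(3) by (auto simp: uniform_shift \<Theta>(1) intro: uniform_mono)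
qed

lemma jeq_mono:
  assumes "jeq \<Gamma> t t' T" "ext \<Gamma> \<Delta>"
  shows "jeq \<Delta> t t' T"
  using assms(2)
proof (rule extE)
  fix \<Theta> assume \<Theta>: "\<Delta> = \<Theta> @ \<Gamma>" "ctx (\<Theta> @ \<Gamma>)" "length \<Delta> = length \<Gamma> + length \<Theta>"
  show ?thesis
    using assms(1)
      weakening_front(2)[OF \<Theta>(2), of "t (length \<Gamma>)" "t' (length \<Gamma>)" "T (length \<Gamma>)"]
    unfolding jeq_def \<Theta>(3) by (auto simp: uniform_shift \<Theta>(1) intro: uniform_mono)
qed

lemma inh_mono:
  assumes "inh \<Gamma> T" "ext \<Gamma> \<Delta>"
  shows "inh \<Delta> T"
  using assms(2)
proof (rule extE)
  fix \<Theta> assume \<Theta>: "\<Delta> = \<Theta> @ \<Gamma>" "ctx (\<Theta> @ \<Gamma>)" "length \<Delta> = length \<Gamma> + length \<Theta>"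
  obtain t where t: "\<Gamma> \<turnstile> t : T (length \<Gamma>)" using assms(1) by (auto simp: inh_def)
  show ?thesis
    using assms(1) weakening_front(1)[OF \<Theta>(2) t]
    unfolding inh_def \<Theta>(3) by (auto simp: uniform_shift \<Theta>(1) intro: uniform_mono)
qed

lemma ext_length: "ext \<Gamma> \<Delta> \<Longrightarrow> length \<Gamma> \<le> length \<Delta>"
  by (auto simp: ext_def)

lemma traversal_ext: "traversal \<phi> p q (length \<Delta>) \<Longrightarrow> ext \<Gamma> \<Delta> \<Longrightarrow> traversal \<phi> p q (length \<Gamma>)"
  by (meson traversal_mono ext_length)

lemma family_mono: "family (length \<Gamma>) B \<Longrightarrow> ext \<Gamma> \<Delta> \<Longrightarrow> family (length \<Delta>) B"
  unfolding family_def by (meson traversal_mono ext_length)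

lemma family3_mono: "family3 (length \<Gamma>) B \<Longrightarrow> ext \<Gamma> \<Delta> \<Longrightarrow> family3 (length \<Delta>) B"
  unfolding family3_def by (meson traversal_mono ext_length)

lemma related_has: "traversal \<phi> p q (length \<Gamma>) \<Longrightarrow> has \<Gamma> t T \<Longrightarrow> related \<phi> p q b t t"
  unfolding has_def by (blast intro: related_uniform)

text \<open>Typing and uniformity goals are solved by syntax-directed rules; when a variable is reached,
  \<open>climb\<close> returns to the context that introduced it.\<close>

lemmas climb = has_mono[rotated] related_has ext_trans[rotated] traversal_ext

lemma has_inh: "has \<Gamma> t T \<Longrightarrow> inh \<Gamma> T"
  by (auto simp: has_def inh_def)

text \<open>The new variable is named by its level, the length of the old context; hence the same
  expression denotes it in all later extensions.\<close>

lemma new_var: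
  assumes "has \<Gamma> A (U i)"
  shows "ext \<Gamma> (A (length \<Gamma>) # \<Gamma>)" "has (A (length \<Gamma>) # \<Gamma>) (bvar (length \<Gamma>)) A"
proof -
  have A: "uniform (length \<Gamma>) A" "\<Gamma> \<turnstile> A (length \<Gamma>) : Univ i"
    using assms by (auto simp: has_def U_def)
  have c: "ctx (A (length \<Gamma>) # \<Gamma>)" by (rule ctx_Cons[OF A(2)])
  then show "ext \<Gamma> (A (length \<Gamma>) # \<Gamma>)" by (auto simp: ext_def)
  show "has (A (length \<Gamma>) # \<Gamma>) (bvar (length \<Gamma>)) A"
    using ty_Var[OF c, of 0] uniform_shift[OF A(1), of 1] uniform_mono[OF A(1), of "Suc (length \<Gamma>)"]
    by (simp add: has_def uniform_bvar) (simp add: bvar_def)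
qed

lemma uniform_pi: "uniform n A \<Longrightarrow> family n B \<Longrightarrow> uniform n (pi A B)"
  by (rule uniformI) (blast intro: related_pi related_uniform family_related)

lemma uniform_lam: "uniform n A \<Longrightarrow> family n B \<Longrightarrow> uniform n (lam A B)"
  by (rule uniformI) (blast intro: related_lam related_uniform family_related)

lemma uniform_app: "uniform n f \<Longrightarrow> uniform n a \<Longrightarrow> uniform n (f \<cdot> a)"
  by (rule uniformI) (blast intro: related_app related_uniform)

lemma uniform_U: "uniform n (U i)"
  by (rule uniformI) (rule related_const)

lemma has_cst:
  assumes "ctx \<Gamma>"
  shows "has \<Gamma> (cst c) (const_ty c)"
proof -
  have "uniform (length \<Gamma>) (cst c)" by (rule uniformI) (rule related_const)
  then show ?thesis
    using ty_Const[OF assms, of c] uniform_mono[OF uniform_const_ty]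
    unfolding has_def close_def by (subst uniform_closed'[OF uniform_const_ty]) (auto simp: cst_def)
qed

lemma has_U: "ctx \<Gamma> \<Longrightarrow> has \<Gamma> (U i) (U (Suc i))"
  by (auto simp: has_def uniform_U) (auto simp: U_def intro: ty_Univ)

lemma has_cumul: "has \<Gamma> A (U i) \<Longrightarrow> i \<le> j \<Longrightarrow> has \<Gamma> A (U j)"
proof (induction j)
  case (Suc j)
  then show ?case
    by (cases "i = Suc j") (auto simp: has_def uniform_U, auto simp: U_def intro: ty_cumul)
qed auto

text \<open>
  Premises below a binder are stated for all terms in all extensions of the context instead of one
  new variable. Bound variables are thereby variables of the metalogic.
\<close>

lemma has_pi:
  assumes A: "has \<Gamma> A (U i)" and B: "\<And>\<Delta> x. ext \<Gamma> \<Delta> \<Longrightarrow> has \<Delta> x A \<Longrightarrow> has \<Delta> (B x) (U i)"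
    and fB: "family (length \<Gamma>) B"
  shows "has \<Gamma> (pi A B) (U i)"
proof -
  have "has (A (length \<Gamma>) # \<Gamma>) (B (bvar (length \<Gamma>))) (U i)"
    using B new_var[OF A] by blast
  then have "\<Gamma> \<turnstile> Pi (A (length \<Gamma>)) (B (bvar (length \<Gamma>)) (Suc (length \<Gamma>))) : Univ i"
    using A by (intro ty_Pi) (auto simp: has_def U_def)
  then show ?thesis
    using A fB by (auto simp: has_def uniform_pi uniform_U) (auto simp: pi_def U_def)
qed

lemma has_arrow:
  assumes A: "has \<Gamma> A (U i)" and B: "has \<Gamma> B (U i)"
  shows "has \<Gamma> (A \<rightarrow> B) (U i)"
  unfolding arrow_def using A
  by (rule has_pi)
    (use B in \<open>auto intro: has_mono familyI related_has\<close>)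

lemma has_lam:
  assumes A: "has \<Gamma> A (U i)" and b: "\<And>\<Delta> x. ext \<Gamma> \<Delta> \<Longrightarrow> has \<Delta> x A \<Longrightarrow> has \<Delta> (b x) (B x)"
    and fb: "family (length \<Gamma>) b" and fB: "family (length \<Gamma>) B"
  shows "has \<Gamma> (lam A b) (pi A B)"
proof -
  have "has (A (length \<Gamma>) # \<Gamma>) (b (bvar (length \<Gamma>))) (B (bvar (length \<Gamma>)))"
    using b new_var[OF A] by blast
  then have "\<Gamma> \<turnstile> lam A b (length \<Gamma>) : pi A B (length \<Gamma>)"
    unfolding lam_def pi_def by (intro ty_Lam) (auto simp: has_def)
  then show ?thesis
    using A fb fB by (auto simp: has_def uniform_pi uniform_lam)
qed

lemma has_app:
  assumes "has \<Gamma> f (pi A B)" "has \<Gamma> a A" and fB: "family (length \<Gamma>) B"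
  shows "has \<Gamma> (f \<cdot> a) (B a)"
proof -
  let ?n = "length \<Gamma>"
  have "\<Gamma> \<turnstile> App (f ?n) (a ?n) : subst 0 (a ?n) (B (bvar ?n) (Suc ?n))"
    using assms by (intro ty_App) (auto simp: has_def pi_def)
  then show ?thesis
    using assms by (auto simp: has_def family_subst uniform_app uniform_family)
      (auto simp: app_def)
qed

lemma inh_pi:
  assumes A: "has \<Gamma> A (U i)" and fB: "family (length \<Gamma>) B"
    and B: "\<And>\<Delta> x. ext \<Gamma> \<Delta> \<Longrightarrow> has \<Delta> x A \<Longrightarrow> inh \<Delta> (B x)"
  shows "inh \<Gamma> (pi A B)"
proof -
  have "inh (A (length \<Gamma>) # \<Gamma>) (B (bvar (length \<Gamma>)))"
    using B new_var[OF A] by blast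
  then obtain t where "A (length \<Gamma>) # \<Gamma> \<turnstile> t : B (bvar (length \<Gamma>)) (Suc (length \<Gamma>))"
    by (auto simp: inh_def)
  then have "\<Gamma> \<turnstile> Lam (A (length \<Gamma>)) t : pi A B (length \<Gamma>)"
    unfolding pi_def by (rule ty_Lam)
  then show ?thesis
    using A fB by (auto simp: has_def inh_def uniform_pi)
qed

lemma inh_app:
  assumes f: "inh \<Gamma> (pi A B)" and a: "has \<Gamma> a A" and fB: "family (length \<Gamma>) B"
  shows "inh \<Gamma> (B a)"
proof -
  let ?n = "length \<Gamma>"
  obtain t where "\<Gamma> \<turnstile> t : pi A B ?n" using f by (auto simp: inh_def)
  then have "\<Gamma> \<turnstile> App t (a ?n) : subst 0 (a ?n) (B (bvar ?n) (Suc ?n))"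
    using a by (intro ty_App) (auto simp: has_def pi_def)
  then show ?thesis
    using a fB by (auto simp: has_def inh_def family_subst uniform_family)
qed

lemma inh_arrow:
  assumes A: "has \<Gamma> A (U i)" and uB: "uniform (length \<Gamma>) B"
    and B: "\<And>\<Delta>. ext \<Gamma> \<Delta> \<Longrightarrow> inh \<Delta> A \<Longrightarrow> inh \<Delta> B"
  shows "inh \<Gamma> (A \<rightarrow> B)"
  unfolding arrow_def using A
  by (rule inh_pi) (use uB B in \<open>auto intro!: familyI intro: related_uniform has_inh\<close>)

lemma inh_mp:
  assumes f: "inh \<Gamma> (A \<rightarrow> B)" and a: "inh \<Gamma> A" and uB: "uniform (length \<Gamma>) B"
  shows "inh \<Gamma> B"
proof -
  let ?n = "length \<Gamma>"
  obtain t s where "\<Gamma> \<turnstile> t : Pi (A ?n) (B (Suc ?n))" "\<Gamma> \<turnstile> s : A ?n"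
    using f a by (auto simp: inh_def arrow_def pi_def)
  then have "\<Gamma> \<turnstile> App t s : subst 0 s (B (Suc ?n))"
    by (rule ty_App)
  then show ?thesis
    using uB by (auto simp: inh_def uniform_subst)
qed

text \<open>A cut: deriving \<open>T\<close> from a variable of type \<open>A\<close> inhabits
  \<open>A \<rightarrow> T\<close>, which is then applied to the unnamed witness. It trades an
  anonymous inhabitant for a term that dependent types can mention; \<open>T\<close> itself must not
  depend on it.\<close>

lemma inh_obtain:
  assumes "inh \<Gamma> A" "has \<Gamma> A (U i)" "uniform (length \<Gamma>) T"
    "\<And>\<Delta> a. ext \<Gamma> \<Delta> \<Longrightarrow> has \<Delta> a A \<Longrightarrow> inh \<Delta> T"
  shows "inh \<Gamma> T"
proof (rule inh_mp)
  show "inh \<Gamma> (A \<rightarrow> T)"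
    unfolding arrow_def using assms(2)
    by (rule inh_pi) (use assms(3,4) in \<open>auto intro!: familyI intro: related_uniform\<close>)
qed (use assms in auto)

section \<open>Judgmental equality and its computation rules\<close>

lemma jeq_reflI: "has \<Gamma> a A \<Longrightarrow> jeq \<Gamma> a a A"
  by (auto simp: has_def jeq_def intro: jeq_refl)

lemma jeq_symI: "jeq \<Gamma> a b A \<Longrightarrow> jeq \<Gamma> b a A"
  by (auto simp: jeq_def intro: jeq_sym)

lemma jeq_transI [trans]: "jeq \<Gamma> a b A \<Longrightarrow> jeq \<Gamma> b c A \<Longrightarrow> jeq \<Gamma> a c A"
  by (auto simp: jeq_def intro: jeq_trans)

lemma has_conv: "has \<Gamma> a A \<Longrightarrow> jeq \<Gamma> A B (U i) \<Longrightarrow> has \<Gamma> a B"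
  by (auto simp: has_def jeq_def U_def intro: ty_conv)

lemma inh_conv: "inh \<Gamma> A \<Longrightarrow> jeq \<Gamma> A B (U i) \<Longrightarrow> inh \<Gamma> B"
  by (auto simp: inh_def jeq_def U_def intro: ty_conv)

lemma jeq_convI: "jeq \<Gamma> a b A \<Longrightarrow> jeq \<Gamma> A B (U i) \<Longrightarrow> jeq \<Gamma> a b B"
  by (auto simp: jeq_def U_def intro: jeq_conv)

lemma jeq_app:
  assumes "jeq \<Gamma> f f' (pi A B)" "jeq \<Gamma> a a' A" and fB: "family (length \<Gamma>) B"
  shows "jeq \<Gamma> (f \<cdot> a) (f' \<cdot> a') (B a)"
proof -
  let ?n = "length \<Gamma>"
  have "\<Gamma> \<turnstile> App (f ?n) (a ?n) \<equiv> App (f' ?n) (a' ?n) : subst 0 (a ?n) (B (bvar ?n) (Suc ?n))"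
    using assms by (intro jeq_App) (auto simp: jeq_def pi_def)
  then show ?thesis
    using assms by (auto simp: jeq_def family_subst uniform_app uniform_family)
      (auto simp: app_def)
qed

lemma jeq_pi:
  assumes A: "jeq \<Gamma> A A' (U i)" "has \<Gamma> A (U i)"
    and B: "\<And>\<Delta> x. ext \<Gamma> \<Delta> \<Longrightarrow> has \<Delta> x A \<Longrightarrow> jeq \<Delta> (B x) (B' x) (U i)"
    and fB: "family (length \<Gamma>) B" "family (length \<Gamma>) B'"
  shows "jeq \<Gamma> (pi A B) (pi A' B') (U i)"
proof -
  have "jeq (A (length \<Gamma>) # \<Gamma>) (B (bvar (length \<Gamma>))) (B' (bvar (length \<Gamma>))) (U i)"
    using B new_var[OF A(2)] by blast
  then have "\<Gamma> \<turnstile> pi A B (length \<Gamma>) \<equiv> pi A' B' (length \<Gamma>) : Univ i"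
    using A unfolding pi_def by (intro jeq_Pi) (auto simp: jeq_def U_def)
  then show ?thesis
    using A fB by (auto simp: jeq_def uniform_pi uniform_U) (auto simp: U_def)
qed

text \<open>The head need only be equal to an abstraction, so that the rule can be iterated.\<close>

lemma jeq_beta_step:
  assumes f: "jeq \<Gamma> f (lam A b) (pi A B)" and a: "has \<Gamma> a A" and A: "has \<Gamma> A (U i)"
    and b: "\<And>\<Delta> x. ext \<Gamma> \<Delta> \<Longrightarrow> has \<Delta> x A \<Longrightarrow> has \<Delta> (b x) (B x)"
    and fb: "family (length \<Gamma>) b" and fB: "family (length \<Gamma>) B"
  shows "jeq \<Gamma> (f \<cdot> a) (b a) (B a)"
proof -
  let ?n = "length \<Gamma>"
  have "has (A ?n # \<Gamma>) (b (bvar ?n)) (B (bvar ?n))"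
    using b new_var[OF A] by blast
  then have "\<Gamma> \<turnstile> App (Lam (A ?n) (b (bvar ?n) (Suc ?n))) (a ?n) \<equiv> subst 0 (a ?n) (b (bvar ?n) (Suc ?n))
      : subst 0 (a ?n) (B (bvar ?n) (Suc ?n))"
    using a by (intro jeq_beta) (auto simp: has_def)
  then have "jeq \<Gamma> (lam A b \<cdot> a) (b a) (B a)"
    using a A fb fB by (auto simp: has_def jeq_def family_subst uniform_app uniform_family uniform_lam)
      (auto simp: app_def lam_def)
  then show ?thesis
    using jeq_app[OF f jeq_reflI[OF a] fB] by (rule jeq_transI[rotated])
qed

lemma eqn_inject: "eqn l r T = eqn l' r' T' \<longleftrightarrow> l = l' \<and> r = r' \<and> T = T'"
  by (auto simp: eqn_def fun_eq_iff)

lemma jeq_defining_eqn: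
  assumes "ctx \<Gamma>" "defining_eqn E" and "E = eqn l r T"
  shows "jeq \<Gamma> l r T"
proof -
  have u: "uniform 0 l" "uniform 0 r" "uniform 0 T"
    using uniform_defining_eqn[OF assms(2)] assms(3) by (auto simp: eqn_inject)
  have "\<Gamma> \<turnstile> l 0 \<equiv> r 0 : T 0"
    using jeq_defining[OF assms(1,2)] assms(3) by (simp add: eqn_def)
  then have "\<Gamma> \<turnstile> l (length \<Gamma>) \<equiv> r (length \<Gamma>) : T (length \<Gamma>)"
    by (simp only: u[THEN uniform_closed', of "length \<Gamma>"])
  then show ?thesis
    using u by (auto simp: jeq_def intro: uniform_mono)
qed

text \<open>Defining equations are equations between closed abstractions over a telescope. Applying
  both sides to \<open>a\<close> and reducing by beta peels off one entry; the rule is iterated once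
  per entry.\<close>

lemma jeq_instantiate:
  assumes e: "jeq \<Gamma> (lam A l) (lam A r) (pi A T)" and a: "has \<Gamma> a A" and A: "has \<Gamma> A (U i)"
    and l: "\<And>\<Delta> x. ext \<Gamma> \<Delta> \<Longrightarrow> has \<Delta> x A \<Longrightarrow> has \<Delta> (l x) (T x)"
    and r: "\<And>\<Delta> x. ext \<Gamma> \<Delta> \<Longrightarrow> has \<Delta> x A \<Longrightarrow> has \<Delta> (r x) (T x)"
    and f: "family (length \<Gamma>) l" "family (length \<Gamma>) r" "family (length \<Gamma>) T"
  shows "jeq \<Gamma> (l a) (r a) (T a)"
proof -
  have "jeq \<Gamma> (lam A l \<cdot> a) (l a) (T a)"
    using a A l f by (intro jeq_beta_step[OF jeq_reflI] has_lam) auto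
  moreover have "jeq \<Gamma> (lam A l \<cdot> a) (r a) (T a)"
    by (rule jeq_beta_step[OF e a A r f(2,3)])
  ultimately show ?thesis using jeq_symI jeq_transI by blast
qed

section \<open>Typing rules for the constants\<close>

lemma related_consts:
  assumes "traversal \<phi> p q n"
  shows "related \<phi> p q b unit_ty unit_ty" "related \<phi> p q b nat_ty nat_ty"
    "related \<phi> p q b nat_zero nat_zero"
  unfolding const_defs by (rule related_const[OF assms])+

lemma related_constants:
  assumes t: "traversal \<phi> p q n" and a: "related \<phi> p q b a a'"
  shows "related \<phi> p q b (nat_succ a) (nat_succ a')"
    and "related \<phi> p q b c c' \<Longrightarrow> related \<phi> p q b (sum_ty i a c) (sum_ty i a' c')"
    and "related \<phi> p q b c c' \<Longrightarrow> related \<phi> p q b (sigma_ty i a c) (sigma_ty i a' c')"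
    and "related \<phi> p q b c c' \<Longrightarrow> related \<phi> p q b d d' \<Longrightarrow> related \<phi> p q b (id_ty i a c d) (id_ty i a'
      c' d')"
    and "related \<phi> p q b c c' \<Longrightarrow> related \<phi> p q b d d' \<Longrightarrow> related \<phi> p q b (sum_inl i a c d) (sum_inl i
      a' c' d')"
    and "related \<phi> p q b c c' \<Longrightarrow> related \<phi> p q b d d' \<Longrightarrow> related \<phi> p q b (sum_inr i a c d) (sum_inr i
      a' c' d')"
    and "related \<phi> p q b c c' \<Longrightarrow> related \<phi> p q b d d' \<Longrightarrow> related \<phi> p q b (acc_ty i a c d) (acc_ty i a'
      c' d')"
    and "related \<phi> p q b c c' \<Longrightarrow> related \<phi> p q b d d' \<Longrightarrow> related \<phi> p q b (clos_nil i a c d) (clos_nil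
      i a' c' d')"
    and "related \<phi> p q b c c' \<Longrightarrow> related \<phi> p q b d d' \<Longrightarrow> related \<phi> p q b (nil_case_ty i a c d)
      (nil_case_ty i a' c' d')"
    and "related \<phi> p q b c c' \<Longrightarrow> related \<phi> p q b d d' \<Longrightarrow> related \<phi> p q b (snoc_case_ty i a c d)
      (snoc_case_ty i a' c' d')"
    and "related \<phi> p q b c c' \<Longrightarrow> related \<phi> p q b d d' \<Longrightarrow> related \<phi> p q b (acc_case_ty i a c d)
      (acc_case_ty i a' c' d')"
    and "related \<phi> p q b c c' \<Longrightarrow> related \<phi> p q b d d' \<Longrightarrow> related \<phi> p q b e e' \<Longrightarrow>
      related \<phi> p q b (clos_ty i a c d e) (clos_ty i a' c' d' e')"
    and "related \<phi> p q b c c' \<Longrightarrow> related \<phi> p q b d d' \<Longrightarrow> related \<phi> p q b e e' \<Longrightarrow>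
      related \<phi> p q b (acc_in i a c d e) (acc_in i a' c' d' e')"
    and "related \<phi> p q b c c' \<Longrightarrow> related \<phi> p q b d d' \<Longrightarrow> related \<phi> p q b e e' \<Longrightarrow>
      related \<phi> p q b f f' \<Longrightarrow> related \<phi> p q b g g' \<Longrightarrow> related \<phi> p q b h h' \<Longrightarrow>
      related \<phi> p q b (clos_snoc i a c d e f g h) (clos_snoc i a' c' d' e' f' g' h')"
    and "related \<phi> p q b c c' \<Longrightarrow> related \<phi> p q b d d' \<Longrightarrow> related \<phi> p q b e e' \<Longrightarrow>
      related \<phi> p q b f f' \<Longrightarrow> related \<phi> p q b g g' \<Longrightarrow>
      related \<phi> p q b (sum_ind i j a c d e f g) (sum_ind i j a' c' d' e' f' g')"
    and "related \<phi> p q b c c' \<Longrightarrow> related \<phi> p q b d d' \<Longrightarrow> related \<phi> p q b e e' \<Longrightarrow>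
      related \<phi> p q b f f' \<Longrightarrow> related \<phi> p q b g g' \<Longrightarrow> related \<phi> p q b h h' \<Longrightarrow>
      related \<phi> p q b k k' \<Longrightarrow>
      related \<phi> p q b (clos_ind i j a c d e f g h k) (clos_ind i j a' c' d' e' f' g' h' k')"
  using assms unfolding const_defs
  by - (assumption | (rule related_weaken, assumption) | rule related_const related_app related_pi
    related_lam related_arrow)+

lemmas related_intros = related_const related_app related_pi related_lam related_arrow
  related_consts related_constants

lemmas uniformity = familyI family3I uniformI related_intros

lemma has_rel:
  assumes "has \<Gamma> R (X \<rightarrow> X \<rightarrow> U i)" "has \<Gamma> X (U j)" "has \<Gamma> x X" "has \<Gamma> y X"
  shows "has \<Gamma> (R \<cdot> x \<cdot> y) (U i)"
  by (rule has_app[OF has_app[OF assms(1)[unfolded arrow_def] assms(3)] assms(4)])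
    (insert assms, (assumption | rule uniformity | erule climb)+)

text \<open>The scheme for the constants: the closed type is unfolded into iterated products and one
  \<open>has_app\<close> is spent per argument. The remaining goals say that the codomains are
  families, which the uniformity rules settle.\<close>

lemma has_clos_ty:
  assumes "has \<Gamma> X (U i)" "has \<Gamma> R (X \<rightarrow> X \<rightarrow> U i)" "has \<Gamma> x X" "has \<Gamma> y X"
  shows "has \<Gamma> (clos_ty i X R x y) (U i)"
proof -
  note c = has_cst[OF has_ctx[OF assms(1)], of "KClos i", simplified const_ty.simps arrow_def]
  note * = assms[unfolded arrow_def]
  show ?thesis
    unfolding clos_ty_def
    by (rule has_app[OF has_app[OF has_app[OF has_app[OF c *(1)] *(2)] *(3)] *(4)])
      (insert *, (assumption | rule uniformity | erule climb)+)
qed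

lemma has_clos_nil:
  assumes "has \<Gamma> X (U i)" "has \<Gamma> R (X \<rightarrow> X \<rightarrow> U i)" "has \<Gamma> x X"
  shows "has \<Gamma> (clos_nil i X R x) (clos_ty i X R x x)"
proof -
  note c = has_cst[OF has_ctx[OF assms(1)], of "KNil i", simplified const_ty.simps arrow_def]
  note * = assms[unfolded arrow_def]
  show ?thesis
    unfolding clos_nil_def
    by (rule has_app[OF has_app[OF has_app[OF c *(1)] *(2)] *(3)])
      (insert *, (assumption | rule uniformity | erule climb)+)
qed

lemma has_clos_snoc:
  assumes "has \<Gamma> X (U i)" "has \<Gamma> R (X \<rightarrow> X \<rightarrow> U i)" "has \<Gamma> x X" "has \<Gamma> y X" "has \<Gamma> z X"
    "has \<Gamma> u (clos_ty i X R x y)" "has \<Gamma> r (R \<cdot> y \<cdot> z)"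
  shows "has \<Gamma> (clos_snoc i X R x y z u r) (clos_ty i X R x z)"
proof -
  note c = has_cst[OF has_ctx[OF assms(1)], of "KSnoc i", simplified const_ty.simps arrow_def]
  note * = assms[unfolded arrow_def]
  show ?thesis
    unfolding clos_snoc_def
    by (rule has_app[OF has_app[OF has_app[OF has_app[OF has_app[OF has_app[OF has_app[OF c
          *(1)] *(2)] *(3)] *(4)] *(5)] *(6)] *(7)])
      (insert *, (assumption | rule uniformity | erule climb)+)
qed

lemma has_clos_motive:
  assumes "has \<Gamma> C (\<Pi> x:X. \<Pi> y:X. clos_ty i X R x y \<rightarrow> U j)"
    "has \<Gamma> X (U i)" "has \<Gamma> R (X \<rightarrow> X \<rightarrow> U i)" "has \<Gamma> x X" "has \<Gamma> y X" "has \<Gamma> u (clos_ty i X R x y)"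
  shows "has \<Gamma> (C \<cdot> x \<cdot> y \<cdot> u) (U j)"
proof -
  note * = assms[unfolded arrow_def]
  show ?thesis
    by (rule has_app[OF has_app[OF has_app[OF *(1) *(4)] *(5)] *(6)])
      (insert *, (assumption | rule uniformity | erule climb)+)
qed

lemma has_clos_ind:
  assumes "has \<Gamma> X (U i)" "has \<Gamma> R (X \<rightarrow> X \<rightarrow> U i)" "has \<Gamma> C (\<Pi> x:X. \<Pi> y:X. clos_ty i X R x y \<rightarrow> U j)"
    "has \<Gamma> n (nil_case_ty i X R C)" "has \<Gamma> s (snoc_case_ty i X R C)"
    "has \<Gamma> x X" "has \<Gamma> y X" "has \<Gamma> u (clos_ty i X R x y)"
  shows "has \<Gamma> (clos_ind i j X R C n s x y u) (C \<cdot> x \<cdot> y \<cdot> u)"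
proof -
  note c = has_cst[OF has_ctx[OF assms(1)], of "KClosInd i j", simplified const_ty.simps arrow_def]
  note * = assms[unfolded arrow_def]
  show ?thesis
    unfolding clos_ind_def
    by (rule has_app[OF has_app[OF has_app[OF has_app[OF has_app[OF has_app[OF has_app[OF has_app[OF c
          *(1)] *(2)] *(3)] *(4)] *(5)] *(6)] *(7)] *(8)])
      (insert *, (assumption | rule uniformity | erule climb)+)
qed

lemma has_snoc_case:
  assumes "has \<Gamma> s (snoc_case_ty i X R C)" "has \<Gamma> X (U i)" "has \<Gamma> R (X \<rightarrow> X \<rightarrow> U i)"
    "has \<Gamma> C (\<Pi> x:X. \<Pi> y:X. clos_ty i X R x y \<rightarrow> U j)" "has \<Gamma> x X" "has \<Gamma> y X" "has \<Gamma> z X"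
    "has \<Gamma> u (clos_ty i X R x y)" "has \<Gamma> r (R \<cdot> y \<cdot> z)" "has \<Gamma> h (C \<cdot> x \<cdot> y \<cdot> u)"
  shows "has \<Gamma> (s \<cdot> x \<cdot> y \<cdot> z \<cdot> u \<cdot> r \<cdot> h) (C \<cdot> x \<cdot> z \<cdot> clos_snoc i X R x y z u r)"
proof -
  note * = assms[unfolded arrow_def snoc_case_ty_def]
  show ?thesis
    by (rule has_app[OF has_app[OF has_app[OF has_app[OF has_app[OF has_app[OF
          *(1) *(5)] *(6)] *(7)] *(8)] *(9)] *(10)])
      (insert *, (assumption | rule uniformity | erule climb)+)
qed

lemma has_nil_case:
  assumes "has \<Gamma> n (nil_case_ty i X R C)" "has \<Gamma> X (U i)" "has \<Gamma> R (X \<rightarrow> X \<rightarrow> U i)"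
    "has \<Gamma> C (\<Pi> x:X. \<Pi> y:X. clos_ty i X R x y \<rightarrow> U j)" "has \<Gamma> x X"
  shows "has \<Gamma> (n \<cdot> x) (C \<cdot> x \<cdot> x \<cdot> clos_nil i X R x)"
  by (rule has_app[OF assms(1)[unfolded nil_case_ty_def] assms(5)])
    (insert assms, (assumption | rule uniformity | erule climb)+)

lemma has_U': "has \<Gamma> t T \<Longrightarrow> has \<Gamma> (U i) (U (Suc i))"
  by (blast intro: has_U has_ctx)

lemma has_rel_ty: "has \<Gamma> X (U i) \<Longrightarrow> has \<Gamma> (X \<rightarrow> X \<rightarrow> U i) (U (Suc i))"
  by (intro has_arrow has_U') (auto intro: has_cumul)

lemmas has_type_rules = has_pi has_arrow has_clos_nil has_clos_snoc has_clos_ind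
  has_clos_ty[THEN has_cumul] has_clos_motive[THEN has_cumul] has_rel[THEN has_cumul]
  max.cobounded1 max.cobounded2 le_SucI le_refl

lemma has_nil_case_ty:
  assumes "has \<Gamma> X (U i)" "has \<Gamma> R (X \<rightarrow> X \<rightarrow> U i)" "has \<Gamma> C (\<Pi> x:X. \<Pi> y:X. clos_ty i X R x y \<rightarrow> U j)"
  shows "has \<Gamma> (nil_case_ty i X R C) (U (max i j))"
  using assms has_cumul[OF assms(1) max.cobounded1] unfolding nil_case_ty_def
  by - (assumption | rule has_type_rules
    | rule uniformity | erule climb)+

lemma has_snoc_case_ty:
  assumes "has \<Gamma> X (U i)" "has \<Gamma> R (X \<rightarrow> X \<rightarrow> U i)" "has \<Gamma> C (\<Pi> x:X. \<Pi> y:X. clos_ty i X R x y \<rightarrow> U j)"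
  shows "has \<Gamma> (snoc_case_ty i X R C) (U (max i j))"
  using assms has_cumul[OF assms(1) max.cobounded1] unfolding snoc_case_ty_def
  by - (assumption | rule has_type_rules
    | rule uniformity | erule climb)+

lemma has_clos_motive_ty:
  assumes "has \<Gamma> X (U i)" "has \<Gamma> R (X \<rightarrow> X \<rightarrow> U i)"
  shows "has \<Gamma> (\<Pi> x:X. \<Pi> y:X. clos_ty i X R x y \<rightarrow> U j) (U (max i (Suc j)))"
  using assms has_cumul[OF assms(1) max.cobounded1] has_cumul[OF has_U'[OF assms(1), of j]
    max.cobounded2]
  by - (assumption | rule has_type_rules
    | rule uniformity | erule climb)+

lemma jeq_clos_nil:
  assumes "has \<Gamma> X (U i)" "has \<Gamma> R (X \<rightarrow> X \<rightarrow> U i)" "has \<Gamma> C (\<Pi> x:X. \<Pi> y:X. clos_ty i X R x y \<rightarrow> U j)"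
    "has \<Gamma> n (nil_case_ty i X R C)" "has \<Gamma> s (snoc_case_ty i X R C)"
    "has \<Gamma> x X"
  shows "jeq \<Gamma> (clos_ind i j X R C n s x x (clos_nil i X R x)) (n \<cdot> x) (C \<cdot> x \<cdot> x \<cdot> clos_nil i X R x)"
proof -
  note e = jeq_defining_eqn[OF has_ctx[OF assms(1)] comp_clos_nil[of i j, unfolded all_eqn_eqn] refl]
  note U = has_U'[OF assms(1)]
  show ?thesis
    by (rule jeq_instantiate[OF jeq_instantiate[OF jeq_instantiate[OF jeq_instantiate[OF
          jeq_instantiate[OF jeq_instantiate[OF e assms(1)] assms(2)] assms(3)] assms(4)] assms(5)]
            assms(6)])
      (insert assms U[of i], (assumption | rule has_lam has_nil_case_ty has_snoc_case_ty
        has_clos_motive_ty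
        has_rel_ty has_nil_case has_type_rules
        | rule uniformity | erule climb)+)
qed

lemma jeq_clos_snoc:
  assumes "has \<Gamma> X (U i)" "has \<Gamma> R (X \<rightarrow> X \<rightarrow> U i)" "has \<Gamma> C (\<Pi> x:X. \<Pi> y:X. clos_ty i X R x y \<rightarrow> U j)"
    "has \<Gamma> n (nil_case_ty i X R C)" "has \<Gamma> s (snoc_case_ty i X R C)"
    "has \<Gamma> x X" "has \<Gamma> y X" "has \<Gamma> z X" "has \<Gamma> u (clos_ty i X R x y)" "has \<Gamma> r (R \<cdot> y \<cdot> z)"
  shows "jeq \<Gamma> (clos_ind i j X R C n s x z (clos_snoc i X R x y z u r))
    (s \<cdot> x \<cdot> y \<cdot> z \<cdot> u \<cdot> r \<cdot> clos_ind i j X R C n s x y u) (C \<cdot> x \<cdot> z \<cdot> clos_snoc i X R x y z u r)"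
proof -
  note e = jeq_defining_eqn[OF has_ctx[OF assms(1)] comp_clos_snoc[of i j, unfolded all_eqn_eqn] refl]
  note U = has_U'[OF assms(1)]
  show ?thesis
    by (rule jeq_instantiate[OF jeq_instantiate[OF jeq_instantiate[OF jeq_instantiate[OF
          jeq_instantiate[OF jeq_instantiate[OF jeq_instantiate[OF jeq_instantiate[OF
          jeq_instantiate[OF jeq_instantiate[OF e assms(1)] assms(2)] assms(3)] assms(4)] assms(5)]
          assms(6)] assms(7)] assms(8)] assms(9)] assms(10)])
      (insert assms U[of i], (assumption | rule has_lam has_nil_case_ty has_snoc_case_ty
        has_clos_motive_ty
        has_rel_ty has_snoc_case has_type_rules
        | rule uniformity | erule climb)+)
qed

lemma has_arrow_app:
  assumes "has \<Gamma> C (A \<rightarrow> U j)" "has \<Gamma> A (U i)" "has \<Gamma> a A"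
  shows "has \<Gamma> (C \<cdot> a) (U j)"
  by (rule has_app[OF assms(1)[unfolded arrow_def] assms(3)])
    (insert assms, (assumption | rule uniformity | erule climb)+)

lemma has_sum_ty:
  assumes "has \<Gamma> A (U i)" "has \<Gamma> B (U i)"
  shows "has \<Gamma> (sum_ty i A B) (U i)"
proof -
  note c = has_cst[OF has_ctx[OF assms(1)], of "KSum i", simplified const_ty.simps arrow_def]
  show ?thesis
    unfolding sum_ty_def
    by (rule has_app[OF has_app[OF c assms(1)] assms(2)])
      (insert assms, (assumption | rule uniformity | erule climb)+)
qed

lemma has_sum_inl:
  assumes "has \<Gamma> A (U i)" "has \<Gamma> B (U i)" "has \<Gamma> a A"
  shows "has \<Gamma> (sum_inl i A B a) (sum_ty i A B)"
proof -
  note c = has_cst[OF has_ctx[OF assms(1)], of "KInl i", simplified const_ty.simps arrow_def]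
  show ?thesis
    unfolding sum_inl_def
    by (rule has_app[OF has_app[OF has_app[OF c assms(1)] assms(2)] assms(3)])
      (insert assms, (assumption | rule uniformity | erule climb)+)
qed

lemma has_sum_inr:
  assumes "has \<Gamma> A (U i)" "has \<Gamma> B (U i)" "has \<Gamma> b B"
  shows "has \<Gamma> (sum_inr i A B b) (sum_ty i A B)"
proof -
  note c = has_cst[OF has_ctx[OF assms(1)], of "KInr i", simplified const_ty.simps arrow_def]
  show ?thesis
    unfolding sum_inr_def
    by (rule has_app[OF has_app[OF has_app[OF c assms(1)] assms(2)] assms(3)])
      (insert assms, (assumption | rule uniformity | erule climb)+)
qed

lemma has_sum_motive:
  assumes "has \<Gamma> C (sum_ty i A B \<rightarrow> U j)" "has \<Gamma> A (U i)" "has \<Gamma> B (U i)" "has \<Gamma> s (sum_ty i A B)"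
  shows "has \<Gamma> (C \<cdot> s) (U j)"
  using has_arrow_app[OF assms(1) has_sum_ty assms(4)] assms(2,3) .

lemma has_sum_ind:
  assumes "has \<Gamma> A (U i)" "has \<Gamma> B (U i)" "has \<Gamma> C (sum_ty i A B \<rightarrow> U j)"
    "has \<Gamma> f (\<Pi> a:A. C \<cdot> sum_inl i A B a)" "has \<Gamma> g (\<Pi> b:B. C \<cdot> sum_inr i A B b)"
      "has \<Gamma> s (sum_ty i A B)"
  shows "has \<Gamma> (sum_ind i j A B C f g s) (C \<cdot> s)"
proof -
  note c = has_cst[OF has_ctx[OF assms(1)], of "KSumInd i j", simplified const_ty.simps arrow_def]
  note * = assms[unfolded arrow_def]
  show ?thesis
    unfolding sum_ind_def
    by (rule has_app[OF has_app[OF has_app[OF has_app[OF has_app[OF has_app[OF c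
          *(1)] *(2)] *(3)] *(4)] *(5)] *(6)])
      (insert *, (assumption | rule uniformity | erule climb)+)
qed

lemma jeq_sum_inr:
  assumes "has \<Gamma> A (U i)" "has \<Gamma> B (U i)" "has \<Gamma> C (sum_ty i A B \<rightarrow> U j)"
    "has \<Gamma> f (\<Pi> a:A. C \<cdot> sum_inl i A B a)" "has \<Gamma> g (\<Pi> b:B. C \<cdot> sum_inr i A B b)" "has \<Gamma> b B"
  shows "jeq \<Gamma> (sum_ind i j A B C f g (sum_inr i A B b)) (g \<cdot> b) (C \<cdot> sum_inr i A B b)"
proof -
  note e = jeq_defining_eqn[OF has_ctx[OF assms(1)] comp_sum_inr[of i j, unfolded all_eqn_eqn] refl]
  note U = has_U'[OF assms(1)]
  have inl_ty: "has \<Delta> (\<Pi> a:A. C \<cdot> sum_inl i A B a) (U (max i j))"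
    if "has \<Delta> A (U i)" "has \<Delta> B (U i)" "has \<Delta> C (sum_ty i A B \<rightarrow> U j)" for \<Delta> A B C
    using that that(1,2)[THEN has_cumul, OF max.cobounded1[of i j]]
    by - (assumption | rule has_pi has_sum_motive[THEN has_cumul] has_sum_inl has_sum_inr max.cobounded2
      | rule uniformity | erule climb)+
  have inr_ty: "has \<Delta> (\<Pi> a:B. C \<cdot> sum_inr i A B a) (U (max i j))"
    if "has \<Delta> A (U i)" "has \<Delta> B (U i)" "has \<Delta> C (sum_ty i A B \<rightarrow> U j)" for \<Delta> A B C
    using that that(1,2)[THEN has_cumul, OF max.cobounded1[of i j]]
    by - (assumption | rule has_pi has_sum_motive[THEN has_cumul] has_sum_inl has_sum_inr max.cobounded2
      | rule uniformity | erule climb)+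
  have fun_ty: "has \<Delta> (sum_ty i A B \<rightarrow> U j) (U (max i (Suc j)))"
    if "has \<Delta> A (U i)" "has \<Delta> B (U i)" for \<Delta> A B
    using that has_cumul[OF has_U'[OF that(1), of j] max.cobounded2]
    by - (assumption | rule has_arrow has_sum_ty[THEN has_cumul] max.cobounded1)+
  have app_ty: "has \<Delta> (g \<cdot> b) (C \<cdot> sum_inr i A B b)"
    if "has \<Delta> g (\<Pi> b:B. C \<cdot> sum_inr i A B b)" "has \<Delta> A (U i)" "has \<Delta> B (U i)"
      "has \<Delta> C (sum_ty i A B \<rightarrow> U j)" "has \<Delta> b B" for \<Delta> g A B C b
    by (rule has_app[OF that(1,5)])
      (insert that, (assumption | rule uniformity | erule climb)+)
  show ?thesis
    by (rule jeq_instantiate[OF jeq_instantiate[OF jeq_instantiate[OF jeq_instantiate[OF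
          jeq_instantiate[OF jeq_instantiate[OF e assms(1)] assms(2)] assms(3)] assms(4)] assms(5)]
            assms(6)])
      (insert assms U[of i], (assumption | rule has_lam inl_ty inr_ty fun_ty app_ty has_sum_ind
        has_sum_inl has_sum_inr
        | rule uniformity | erule climb)+)
qed

lemma has_sigma:
  assumes "has \<Gamma> A (U i)" "has \<Gamma> B (A \<rightarrow> U i)"
  shows "has \<Gamma> (sigma_ty i A B) (U i)"
proof -
  note c = has_cst[OF has_ctx[OF assms(1)], of "KSigma i", simplified const_ty.simps arrow_def]
  show ?thesis
    unfolding sigma_ty_def
    by (rule has_app[OF has_app[OF c assms(1)] assms(2)[unfolded arrow_def]])
      (insert assms, (assumption | rule uniformity | erule climb)+)
qed

lemma has_sigma_pair:
  assumes "has \<Gamma> A (U i)" "has \<Gamma> B (A \<rightarrow> U i)" "has \<Gamma> a A" "has \<Gamma> b (B \<cdot> a)"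
  shows "has \<Gamma> (sigma_pair i A B a b) (sigma_ty i A B)"
proof -
  note c = has_cst[OF has_ctx[OF assms(1)], of "KPair i", simplified const_ty.simps arrow_def]
  show ?thesis
    unfolding sigma_pair_def
    by (rule has_app[OF has_app[OF has_app[OF has_app[OF c
          assms(1)] assms(2)[unfolded arrow_def]] assms(3)] assms(4)])
      (insert assms, (assumption | rule uniformity | erule climb)+)
qed

lemma has_family:
  assumes "has \<Gamma> A (U i)" "\<And>\<Delta> x. ext \<Gamma> \<Delta> \<Longrightarrow> has \<Delta> x A \<Longrightarrow> has \<Delta> (B x) (U j)"
    "family (length \<Gamma>) B"
  shows "has \<Gamma> (lam A B) (A \<rightarrow> U j)"
  unfolding arrow_def using assms
  by (rule has_lam) (rule uniformity | assumption)+

lemma has_sigma_ty: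
  assumes "has \<Gamma> A (U i)" "\<And>\<Delta> x. ext \<Gamma> \<Delta> \<Longrightarrow> has \<Delta> x A \<Longrightarrow> has \<Delta> (B x) (U i)"
    "family (length \<Gamma>) B"
  shows "has \<Gamma> (sigma_ty i A (lam A B)) (U i)"
  using assms by (intro has_sigma has_family)

section \<open>Elimination rules\<close>

lemma inh_cst: "ctx \<Gamma> \<Longrightarrow> inh \<Gamma> (const_ty c)"
  by (blast intro: has_inh has_cst)

lemma has_uniform: "has \<Gamma> t T \<Longrightarrow> uniform (length \<Gamma>) t"
  by (simp add: has_def)

lemma jeq_beta:
  assumes "has \<Gamma> A (U i)" "has \<Gamma> a A"
    and "\<And>\<Delta> x. ext \<Gamma> \<Delta> \<Longrightarrow> has \<Delta> x A \<Longrightarrow> has \<Delta> (b x) (B x)"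
    and "family (length \<Gamma>) b" "family (length \<Gamma>) B"
  shows "jeq \<Gamma> (lam A b \<cdot> a) (b a) (B a)"
  using assms by (intro jeq_beta_step[OF jeq_reflI] has_lam) auto

lemma jeq_beta_type:
  assumes A: "has \<Gamma> A (U i)" and a: "has \<Gamma> a A"
    and B: "\<And>\<Delta> x. ext \<Gamma> \<Delta> \<Longrightarrow> has \<Delta> x A \<Longrightarrow> has \<Delta> (B x) (U j)"
    and fB: "family (length \<Gamma>) B"
  shows "jeq \<Gamma> (lam A B \<cdot> a) (B a) (U j)"
  by (rule jeq_beta[OF A a B fB]) (rule uniformity | assumption)+

lemma inh_sigmaI:
  assumes A: "has \<Gamma> A (U i)" and B: "\<And>\<Delta> x. ext \<Gamma> \<Delta> \<Longrightarrow> has \<Delta> x A \<Longrightarrow> has \<Delta> (B x) (U i)"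
    and fB: "family (length \<Gamma>) B" and a: "has \<Gamma> a A" and b: "inh \<Gamma> (B a)"
  shows "inh \<Gamma> (sigma_ty i A (lam A B))"
proof -
  note l = has_family[OF A B fB]
  have e: "jeq \<Gamma> (B a) (lam A B \<cdot> a) (U i)"
    by (rule jeq_symI[OF jeq_beta_type[OF A a B fB]])
  have Ba: "has \<Gamma> (lam A B \<cdot> a) (U i)"
    by (rule has_arrow_app[OF l A a])
  show ?thesis
    by (rule inh_obtain[OF inh_conv[OF b e] Ba])
      (insert A B fB a l,
        (assumption | rule has_inh has_sigma_pair has_sigma_ty[THEN has_uniform] | erule climb)+)
qed

text \<open>Goals only ask for an inhabitant of a type that is already fixed, so the constant motive
  with value \<open>T\<close> suffices. Its applications reduce to \<open>T\<close> by beta, and the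
  two components enter as variables of a longer context.\<close>

lemma inh_sigma_elim:
  assumes p: "inh \<Gamma> (sigma_ty i A B)" and A: "has \<Gamma> A (U i)" and B: "has \<Gamma> B (A \<rightarrow> U i)"
    and T: "has \<Gamma> T (U j)"
    and t: "\<And>\<Delta> a b. ext \<Gamma> \<Delta> \<Longrightarrow> has \<Delta> a A \<Longrightarrow> has \<Delta> b (B \<cdot> a) \<Longrightarrow> inh \<Delta> T"
  shows "inh \<Gamma> T"
proof (rule inh_obtain[OF p has_sigma[OF A B]])
  show "uniform (length \<Gamma>) T" using T by (rule has_uniform)
  fix \<Delta> s assume d: "ext \<Gamma> \<Delta>" and s: "has \<Delta> s (sigma_ty i A B)"
  note A' = has_mono[OF A d] and B' = has_mono[OF B d] and T' = has_mono[OF T d]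
  note S = has_sigma[OF A' B']
  let ?C = "\<Lambda> _:sigma_ty i A B. T"
  have C: "has \<Delta> ?C (sigma_ty i A B \<rightarrow> U j)"
    using T' by - (rule has_family[OF S has_mono[OF T']], assumption, rule familyI, rule related_has)
  have CT: "jeq \<Theta> (?C \<cdot> s) T (U j)" if "ext \<Delta> \<Theta>" "has \<Theta> s (sigma_ty i A B)" for \<Theta> s
  proof (rule jeq_beta_type)
    show "has \<Theta> (sigma_ty i A B) (U i)" using S that(1) by (rule has_mono)
    show "has \<Theta>' T (U j)" if "ext \<Theta> \<Theta>'" for \<Theta>'
      using T' \<open>ext \<Delta> \<Theta>\<close> that by (blast intro: has_mono)
    show "family (length \<Theta>) (\<lambda>_. T)"
      using has_mono[OF T' that(1)] by - (rule familyI, rule related_has)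
  qed (use that in auto)
  note c = inh_cst[OF has_ctx[OF A'], of "KSigmaInd i j", simplified const_ty.simps arrow_def]
  let ?P = "\<Pi> a:A. \<Pi> b:B \<cdot> a. ?C \<cdot> sigma_pair i A B a b"
  have P: "inh \<Delta> ?P"
  proof (rule inh_pi[OF A'])
    fix \<Theta> a assume e: "ext \<Delta> \<Theta>" and a: "has \<Theta> a A"
    show "inh \<Theta> (\<Pi> b:B \<cdot> a. ?C \<cdot> sigma_pair i A B a b)"
    proof (rule inh_pi)
      show "has \<Theta> (B \<cdot> a) (U i)" by (rule has_arrow_app[OF has_mono[OF B' e] has_mono[OF A' e] a])
      fix \<Theta>' b assume e': "ext \<Theta> \<Theta>'" and b: "has \<Theta>' b (B \<cdot> a)"
      have "inh \<Theta>' T" using t[OF ext_trans[OF d ext_trans[OF e e']] has_mono[OF a e'] b] .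
      moreover have "jeq \<Theta>' (?C \<cdot> sigma_pair i A B a b) T (U j)"
        by (rule CT[OF ext_trans[OF e e'] has_sigma_pair])
          (insert A' B' a b e e', (assumption | erule climb)+)
      ultimately show "inh \<Theta>' (?C \<cdot> sigma_pair i A B a b)"
        using inh_conv jeq_symI by blast
    qed (insert A' B' T' a e, unfold sigma_pair_def, (assumption | rule uniformity | erule climb)+)
  qed (insert A' B' T', unfold sigma_pair_def, (assumption | rule uniformity | erule climb)+)
  have "inh \<Delta> (?P \<rightarrow> (\<Pi> p:sigma_ty i A B. ?C \<cdot> p))"
    unfolding arrow_def
    by (rule inh_app[OF inh_app[OF inh_app[OF c A'] B'[unfolded arrow_def]] C[unfolded arrow_def]])
      (insert A' B' T', unfold sigma_pair_def,
        (assumption | rule uniformity | erule climb)+)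
  then have "inh \<Delta> (\<Pi> p:sigma_ty i A B. ?C \<cdot> p)"
    by (rule inh_mp[OF _ P])
      (insert A' B' S T', (assumption | rule uniformity | erule climb)+)
  then have "inh \<Delta> (?C \<cdot> s)"
    by (rule inh_app[OF _ s])
      (insert A' B' S T', (assumption | rule uniformity | erule climb)+)
  then show "inh \<Delta> T"
    by (rule inh_conv[OF _ CT[OF has_ext[OF A'] s]])
qed

lemma inh_sigmaE:
  assumes p: "inh \<Gamma> (sigma_ty i A (lam A B))" and T: "has \<Gamma> T (U j)"
    and A: "has \<Gamma> A (U i)" and B: "\<And>\<Delta> x. ext \<Gamma> \<Delta> \<Longrightarrow> has \<Delta> x A \<Longrightarrow> has \<Delta> (B x) (U i)"
    and fB: "family (length \<Gamma>) B"
    and t: "\<And>\<Delta> a. ext \<Gamma> \<Delta> \<Longrightarrow> has \<Delta> a A \<Longrightarrow> inh \<Delta> (B a) \<Longrightarrow> inh \<Delta> T"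
  shows "inh \<Gamma> T"
proof (rule inh_sigma_elim[OF p A has_family[OF A B fB] T])
  fix \<Delta> a b assume d: "ext \<Gamma> \<Delta>" "has \<Delta> a A" "has \<Delta> b (lam A B \<cdot> a)"
  have "jeq \<Delta> (lam A B \<cdot> a) (B a) (U i)"
    by (rule jeq_beta_type[OF has_mono[OF A d(1)] d(2)])
      (use d(1) B family_mono[OF fB d(1)] in \<open>auto intro: ext_trans\<close>)
  then show "inh \<Delta> T"
    using t[OF d(1,2) inh_conv[OF has_inh[OF d(3)]]] by blast
qed

text \<open>Here the motive may depend on the eliminated term: the last step of a zig-zag is a term
  of a sum type, and the claims about the zig-zag mention it.\<close>

lemma inh_sum_elim:
  assumes A: "has \<Gamma> A (U i)" and B: "has \<Gamma> B (U i)"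
    and s: "has \<Gamma> s (sum_ty i A B)"
    and M: "\<And>\<Delta> s. ext \<Gamma> \<Delta> \<Longrightarrow> has \<Delta> s (sum_ty i A B) \<Longrightarrow> has \<Delta> (M s) (U j)"
    and fM: "family (length \<Gamma>) M"
    and l: "\<And>\<Delta> a. ext \<Gamma> \<Delta> \<Longrightarrow> has \<Delta> a A \<Longrightarrow> inh \<Delta> (M (sum_inl i A B a))"
    and r: "\<And>\<Delta> b. ext \<Gamma> \<Delta> \<Longrightarrow> has \<Delta> b B \<Longrightarrow> inh \<Delta> (M (sum_inr i A B b))"
  shows "inh \<Gamma> (M s)"
proof -
  note S = has_sum_ty[OF A B]
  let ?C = "lam (sum_ty i A B) M"
  note C = has_family[OF S M fM]
  have CM: "jeq \<Delta> (?C \<cdot> s) (M s) (U j)" if "ext \<Gamma> \<Delta>" "has \<Delta> s (sum_ty i A B)" for \<Delta> s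
    by (rule jeq_beta_type[OF has_mono[OF S that(1)] that(2)])
      (use that(1) M family_mono[OF fM that(1)] in \<open>auto intro: ext_trans\<close>)
  note c = inh_cst[OF has_ctx[OF A], of "KSumInd i j", simplified const_ty.simps arrow_def]
  let ?L = "\<Pi> a:A. ?C \<cdot> sum_inl i A B a"
  let ?R = "\<Pi> b:B. ?C \<cdot> sum_inr i A B b"
  have L: "inh \<Gamma> ?L"
  proof (rule inh_pi[OF A])
    fix \<Delta> a assume d: "ext \<Gamma> \<Delta>" "has \<Delta> a A"
    show "inh \<Delta> (?C \<cdot> sum_inl i A B a)"
      by (rule inh_conv[OF l[OF d] jeq_symI[OF CM[OF d(1) has_sum_inl]]])
        (insert A B d, (assumption | erule climb)+)
  qed (insert A B, (assumption | rule uniformity family_related[OF _ fM] | erule climb)+)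
  have R: "inh \<Gamma> ?R"
  proof (rule inh_pi[OF B])
    fix \<Delta> a assume d: "ext \<Gamma> \<Delta>" "has \<Delta> a B"
    show "inh \<Delta> (?C \<cdot> sum_inr i A B a)"
      by (rule inh_conv[OF r[OF d] jeq_symI[OF CM[OF d(1) has_sum_inr]]])
        (insert A B d, (assumption | erule climb)+)
  qed (insert A B, (assumption | rule uniformity family_related[OF _ fM] | erule climb)+)
  have "inh \<Gamma> (?L \<rightarrow> ?R \<rightarrow> (\<Pi> s:sum_ty i A B. ?C \<cdot> s))"
    unfolding arrow_def
    by (rule inh_app[OF inh_app[OF inh_app[OF c A] B] C[unfolded arrow_def]])
      (insert A B, (assumption | rule uniformity family_related[OF _ fM] | erule climb)+)
  then have "inh \<Gamma> (?R \<rightarrow> (\<Pi> s:sum_ty i A B. ?C \<cdot> s))"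
    by (rule inh_mp[OF _ L])
      (insert A B, (assumption | rule uniformity family_related[OF _ fM] | erule climb)+)
  then have "inh \<Gamma> (\<Pi> s:sum_ty i A B. ?C \<cdot> s)"
    by (rule inh_mp[OF _ R])
      (insert A B, (assumption | rule uniformity family_related[OF _ fM] | erule climb)+)
  then have "inh \<Gamma> (?C \<cdot> s)"
    by (rule inh_app[OF _ s])
      (insert A B, (assumption | rule uniformity family_related[OF _ fM] | erule climb)+)
  then show ?thesis
    by (rule inh_conv[OF _ CM[OF has_ext[OF A] s]])
qed

definition motive :: "nat \<Rightarrow> stm \<Rightarrow> stm \<Rightarrow> (stm \<Rightarrow> stm \<Rightarrow> stm \<Rightarrow> stm) \<Rightarrow> stm" where
  "motive i X R M = (\<Lambda> x:X. \<Lambda> y:X. \<Lambda> u:clos_ty i X R x y. M x y u)"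

context
  fixes \<Gamma> i j X R M
  assumes X: "has \<Gamma> X (U i)" and R: "has \<Gamma> R (X \<rightarrow> X \<rightarrow> U i)"
    and M: "\<And>\<Delta> x y u. ext \<Gamma> \<Delta> \<Longrightarrow> has \<Delta> x X \<Longrightarrow> has \<Delta> y X \<Longrightarrow> has \<Delta> u (clos_ty i X R x y) \<Longrightarrow>
      has \<Delta> (M x y u) (U j)"
    and fM: "family3 (length \<Gamma>) M"
begin

lemma has_motive: "has \<Gamma> (motive i X R M) (\<Pi> x:X. \<Pi> y:X. clos_ty i X R x y \<rightarrow> U j)"
  using X R unfolding motive_def
  by - (assumption | rule has_lam has_family has_clos_ty M
    | rule uniformity family3_related[OF _ fM] | erule climb)+

lemma jeq_motive:
  assumes "has \<Gamma> x X" "has \<Gamma> y X" "has \<Gamma> u (clos_ty i X R x y)"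
  shows "jeq \<Gamma> (motive i X R M \<cdot> x \<cdot> y \<cdot> u) (M x y u) (U j)"
  unfolding motive_def
  by (rule jeq_beta_step[OF jeq_beta_step[OF jeq_beta_step[OF
        jeq_reflI[OF has_motive[unfolded motive_def arrow_def]] assms(1)] assms(2)] assms(3)])
    (insert assms X R, (assumption | rule has_lam has_family has_clos_ty M
    | rule uniformity family3_related[OF _ fM] | erule climb)+)

end

context
  fixes \<Gamma> i j X R M
  assumes X: "has \<Gamma> X (U i)" and R: "has \<Gamma> R (X \<rightarrow> X \<rightarrow> U i)"
    and M: "\<And>\<Delta> x y u. ext \<Gamma> \<Delta> \<Longrightarrow> has \<Delta> x X \<Longrightarrow> has \<Delta> y X \<Longrightarrow> has \<Delta> u (clos_ty i X R x y) \<Longrightarrow>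
      has \<Delta> (M x y u) (U j)"
    and fM: "family3 (length \<Gamma>) M"
begin

text \<open>The eliminator receives the object-level function \<open>motive i X R M\<close>, whose
  values reduce to those of \<open>M\<close> only by beta. Both cases and the result are transported
  along that conversion.\<close>

lemma inh_clos_ind:
  assumes n: "\<And>\<Delta> x. ext \<Gamma> \<Delta> \<Longrightarrow> has \<Delta> x X \<Longrightarrow> inh \<Delta> (M x x (clos_nil i X R x))"
    and s: "\<And>\<Delta> x y z u r. ext \<Gamma> \<Delta> \<Longrightarrow> has \<Delta> x X \<Longrightarrow> has \<Delta> y X \<Longrightarrow> has \<Delta> z X \<Longrightarrow>
      has \<Delta> u (clos_ty i X R x y) \<Longrightarrow> has \<Delta> r (R \<cdot> y \<cdot> z) \<Longrightarrow> inh \<Delta> (M x y u) \<Longrightarrow>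
      inh \<Delta> (M x z (clos_snoc i X R x y z u r))"
    and xyu: "has \<Gamma> x X" "has \<Gamma> y X" "has \<Gamma> u (clos_ty i X R x y)"
  shows "inh \<Gamma> (M x y u)"
proof -
  let ?C = "motive i X R M"
  have C: "has \<Gamma> (motive i X R M) (\<Pi> x:X. \<Pi> y:X. clos_ty i X R x y \<rightarrow> U j)"
    by (rule has_motive[OF X R _ fM]) (rule M)
  have CM: "jeq \<Delta> (?C \<cdot> x \<cdot> y \<cdot> u) (M x y u) (U j)"
    if "ext \<Gamma> \<Delta>" "has \<Delta> x X" "has \<Delta> y X" "has \<Delta> u (clos_ty i X R x y)" for \<Delta> x y u
    by (rule jeq_motive[OF has_mono[OF X that(1)] has_mono[OF R that(1)] _ family3_mono[OF fM
      that(1)] that(2-)])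
      (rule M[OF ext_trans[OF that(1)]])
  have N: "inh \<Gamma> (nil_case_ty i X R ?C)"
    unfolding nil_case_ty_def
  proof (rule inh_pi[OF X])
    fix \<Delta> x assume d: "ext \<Gamma> \<Delta>" "has \<Delta> x X"
    note XR = has_mono[OF X d(1)] has_mono[OF R d(1)]
    show "inh \<Delta> (?C \<cdot> x \<cdot> x \<cdot> clos_nil i X R x)"
      by (rule inh_conv[OF n[OF d] jeq_symI[OF CM[OF d d(2) has_clos_nil[OF XR d(2)]]]])
  qed (insert C X R, (assumption | rule uniformity | erule climb)+)
  have step: "inh \<Delta> (?C \<cdot> x \<cdot> z \<cdot> clos_snoc i X R x y z u r)"
    if "inh \<Delta> (?C \<cdot> x \<cdot> y \<cdot> u)" "ext \<Gamma> \<Delta>" "has \<Delta> x X" "has \<Delta> y X" "has \<Delta> z X"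
      "has \<Delta> u (clos_ty i X R x y)" "has \<Delta> r (R \<cdot> y \<cdot> z)" for \<Delta> x y z u r
  proof -
    have "inh \<Delta> (M x y u)"
      using inh_conv[OF that(1) CM] that by blast
    then have "inh \<Delta> (M x z (clos_snoc i X R x y z u r))"
      using s that by blast
    moreover have "has \<Delta> (clos_snoc i X R x y z u r) (clos_ty i X R x z)"
      using that has_mono[OF X] has_mono[OF R] by (blast intro: has_clos_snoc)
    ultimately show ?thesis
      using inh_conv jeq_symI CM that by blast
  qed
  have S: "inh \<Gamma> (snoc_case_ty i X R ?C)"
    unfolding snoc_case_ty_def
    using C X R has_cumul[OF X max.cobounded1[of i j]]
    by - (assumption | rule inh_pi inh_arrow step has_type_rules | rule uniformity | erule climb)+
  note c = inh_cst[OF has_ctx[OF X], of "KClosInd i j", simplified const_ty.simps]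
  let ?T = "\<Pi> x:X. \<Pi> y:X. \<Pi> u:clos_ty i X R x y. ?C \<cdot> x \<cdot> y \<cdot> u"
  have "inh \<Gamma> (nil_case_ty i X R ?C \<rightarrow> snoc_case_ty i X R ?C \<rightarrow> ?T)"
    by (rule inh_app[OF inh_app[OF inh_app[OF c X] R] C])
      (insert C X R, (assumption | rule uniformity | erule climb)+)
  then have "inh \<Gamma> (snoc_case_ty i X R ?C \<rightarrow> ?T)"
    by (rule inh_mp[OF _ N])
      (insert C X R, (assumption | rule uniformity | erule climb)+)
  then have "inh \<Gamma> ?T"
    by (rule inh_mp[OF _ S])
      (insert C X R, (assumption | rule uniformity | erule climb)+)
  note T = inh_app[OF inh_app[OF inh_app[OF this xyu(1)] xyu(2)] xyu(3)]
  have "inh \<Gamma> (?C \<cdot> x \<cdot> y \<cdot> u)"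
    by (rule T)
      (insert C X R xyu, (assumption | rule uniformity | erule climb)+)
  then show ?thesis
    by (rule inh_conv[OF _ CM[OF has_ext[OF X] xyu]])
qed

end

lemma has_acc_ty:
  assumes "has \<Gamma> X (U i)" "has \<Gamma> L (X \<rightarrow> X \<rightarrow> U i)" "has \<Gamma> a X"
  shows "has \<Gamma> (acc_ty i X L a) (U i)"
proof -
  note c = has_cst[OF has_ctx[OF assms(1)], of "KAcc i", simplified const_ty.simps arrow_def]
  note * = assms[unfolded arrow_def]
  show ?thesis
    unfolding acc_ty_def
    by (rule has_app[OF has_app[OF has_app[OF c *(1)] *(2)] *(3)])
      (insert *, (assumption | rule uniformity | erule climb)+)
qed

lemma has_acc_in:
  assumes "has \<Gamma> X (U i)" "has \<Gamma> L (X \<rightarrow> X \<rightarrow> U i)" "has \<Gamma> a X"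
    "has \<Gamma> h (\<Pi> x:X. L \<cdot> x \<cdot> a \<rightarrow> acc_ty i X L x)"
  shows "has \<Gamma> (acc_in i X L a h) (acc_ty i X L a)"
proof -
  note c = has_cst[OF has_ctx[OF assms(1)], of "KAccIn i", simplified const_ty.simps arrow_def]
  note * = assms[unfolded arrow_def]
  show ?thesis
    unfolding acc_in_def
    by (rule has_app[OF has_app[OF has_app[OF has_app[OF c *(1)] *(2)] *(3)] *(4)])
      (insert *, (assumption | rule uniformity | erule climb)+)
qed

definition acc_motive :: "nat \<Rightarrow> stm \<Rightarrow> stm \<Rightarrow> (stm \<Rightarrow> stm) \<Rightarrow> stm" where
  "acc_motive i X L M = (\<Lambda> a:X. \<Lambda> _:acc_ty i X L a. M a)"

lemma has_acc_motive:
  assumes X: "has \<Gamma> X (U i)" and L: "has \<Gamma> L (X \<rightarrow> X \<rightarrow> U i)"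
    and M: "\<And>\<Delta> a. ext \<Gamma> \<Delta> \<Longrightarrow> has \<Delta> a X \<Longrightarrow> has \<Delta> (M a) (U i)"
    and fM: "family (length \<Gamma>) M"
  shows "has \<Gamma> (acc_motive i X L M) (\<Pi> a:X. acc_ty i X L a \<rightarrow> U i)"
  using X L unfolding acc_motive_def
  by - (assumption | rule has_lam has_family has_acc_ty M
    | rule uniformity family_related[OF _ fM] | erule climb)+

lemma jeq_acc_motive:
  assumes X: "has \<Gamma> X (U i)" and L: "has \<Gamma> L (X \<rightarrow> X \<rightarrow> U i)"
    and M: "\<And>\<Delta> a. ext \<Gamma> \<Delta> \<Longrightarrow> has \<Delta> a X \<Longrightarrow> has \<Delta> (M a) (U i)"
    and fM: "family (length \<Gamma>) M"
    and a: "has \<Gamma> a X" "has \<Gamma> p (acc_ty i X L a)"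
  shows "jeq \<Gamma> (acc_motive i X L M \<cdot> a \<cdot> p) (M a) (U i)"
proof -
  note C = has_acc_motive[OF X L M fM, unfolded acc_motive_def arrow_def]
  show ?thesis
    unfolding acc_motive_def
    by (rule jeq_beta_step[OF jeq_beta_step[OF jeq_reflI[OF C] a(1)] a(2)])
     (insert X L a,
       (assumption | rule has_lam has_acc_ty M
      | rule uniformity family_related[OF _ fM] | erule climb)+)
qed

lemma has_acc_case:
  assumes "has \<Gamma> C (\<Pi> a:X. acc_ty i X L a \<rightarrow> U i)" "has \<Gamma> X (U i)" "has \<Gamma> L (X \<rightarrow> X \<rightarrow> U i)"
    "has \<Gamma> a X" "has \<Gamma> p (acc_ty i X L a)"
  shows "has \<Gamma> (C \<cdot> a \<cdot> p) (U i)"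
  by (rule has_app[OF has_app[OF assms(1)[unfolded arrow_def] assms(4)] assms(5)])
    (insert assms, (assumption | rule uniformity | erule climb)+)

lemma has_acc_hyp:
  assumes "has \<Gamma> h (\<Pi> x:X. L \<cdot> x \<cdot> a \<rightarrow> acc_ty i X L x)" "has \<Gamma> X (U i)" "has \<Gamma> L (X \<rightarrow> X \<rightarrow> U i)"
    "has \<Gamma> a X" "has \<Gamma> x X" "has \<Gamma> l (L \<cdot> x \<cdot> a)"
  shows "has \<Gamma> (h \<cdot> x \<cdot> l) (acc_ty i X L x)"
  by (rule has_app[OF has_app[OF assms(1)[unfolded arrow_def] assms(5)] assms(6)])
    (insert assms, (assumption | rule uniformity | erule climb)+)

text \<open>The motive ignores the accessibility proof, so what remains is plain well-founded
  induction. Motive and relation share the universe level \<open>i\<close>, which suits the claims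
  proved by it later on.\<close>

lemma inh_acc_ind:
  assumes X: "has \<Gamma> X (U i)" and L: "has \<Gamma> L (X \<rightarrow> X \<rightarrow> U i)"
    and M: "\<And>\<Delta> a. ext \<Gamma> \<Delta> \<Longrightarrow> has \<Delta> a X \<Longrightarrow> has \<Delta> (M a) (U i)"
    and fM: "family (length \<Gamma>) M"
    and s: "\<And>\<Delta> a. ext \<Gamma> \<Delta> \<Longrightarrow> has \<Delta> a X \<Longrightarrow>
      (\<And>\<Theta> x. ext \<Delta> \<Theta> \<Longrightarrow> has \<Theta> x X \<Longrightarrow> inh \<Theta> (L \<cdot> x \<cdot> a) \<Longrightarrow> inh \<Theta> (M x)) \<Longrightarrow> inh \<Delta> (M a)"
    and a: "has \<Gamma> a X" "inh \<Gamma> (acc_ty i X L a)"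
  shows "inh \<Gamma> (M a)"
proof -
  let ?C = "acc_motive i X L M"
  have C: "has \<Gamma> ?C (\<Pi> a:X. acc_ty i X L a \<rightarrow> U i)"
    by (rule has_acc_motive[OF X L _ fM]) (rule M)
  have CM: "jeq \<Delta> (?C \<cdot> a \<cdot> p) (M a) (U i)"
    if d: "ext \<Gamma> \<Delta>" and a: "has \<Delta> a X" and p: "has \<Delta> p (acc_ty i X L a)" for \<Delta> a p
    by (rule jeq_acc_motive[OF has_mono[OF X d] has_mono[OF L d] _ family_mono[OF fM d] a p])
      (rule M[OF ext_trans[OF d]])
  have step: "inh \<Delta> (?C \<cdot> a \<cdot> acc_in i X L a h)"
    if d: "ext \<Gamma> \<Delta>" and a: "has \<Delta> a X" and h: "has \<Delta> h (\<Pi> x:X. L \<cdot> x \<cdot> a \<rightarrow> acc_ty i X L x)"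
      and ih: "inh \<Delta> (\<Pi> x:X. \<Pi> l:L \<cdot> x \<cdot> a. ?C \<cdot> x \<cdot> (h \<cdot> x \<cdot> l))" for \<Delta> a h
  proof -
    have "inh \<Delta> (M a)"
    proof (rule s[OF d a])
      fix \<Theta> x assume e: "ext \<Delta> \<Theta>" and x: "has \<Theta> x X" and l: "inh \<Theta> (L \<cdot> x \<cdot> a)"
      have d': "ext \<Gamma> \<Theta>" using d e by (rule ext_trans)
      note * = has_mono[OF X d'] has_mono[OF L d'] has_mono[OF C d'] has_mono[OF a e] has_mono[OF h e] x
      show "inh \<Theta> (M x)"
      \<comment> \<open>Only inhabitation of \<open>L \<cdot> x \<cdot> a\<close> is given, but the
        hypothesis of the eliminator speaks about the accessibility proof
        \<open>h \<cdot> x \<cdot> l\<close>; hence a variable \<open>l\<close> of that type is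
        introduced.\<close>
      proof (rule inh_obtain[OF l])
        show "has \<Theta> (L \<cdot> x \<cdot> a) (U i)" using has_rel * by blast
        show "uniform (length \<Theta>) (M x)" using has_uniform[OF M[OF d' x]] .
        fix \<Theta>' l assume e': "ext \<Theta> \<Theta>'" and l: "has \<Theta>' l (L \<cdot> x \<cdot> a)"
        note ** = *[THEN has_mono, OF e']
        have "inh \<Theta>' (?C \<cdot> x \<cdot> (h \<cdot> x \<cdot> l))"
          by (rule inh_app[OF inh_app[OF inh_mono[OF ih ext_trans[OF e e']] **(6)] l])
            (insert **, (assumption | rule uniformity | erule climb)+)
        then show "inh \<Theta>' (M x)"
          by (rule inh_conv[OF _ CM[OF ext_trans[OF d' e'] **(6) has_acc_hyp[OF **(5,1,2,4,6) l]]])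
      qed
    qed
    then show ?thesis
      by (rule inh_conv[OF _ jeq_symI[OF CM[OF d a has_acc_in[OF has_mono[OF X d] has_mono[OF L d] a
        h]]]])
  qed
  have S: "inh \<Gamma> (acc_case_ty i X L ?C)"
    unfolding acc_case_ty_def
    using C X L
    by - (assumption | rule inh_pi inh_arrow step has_pi has_arrow has_acc_case[where C = ?C]
      has_rel[where R = L]
        has_acc_hyp has_acc_ty has_acc_in | rule uniformity | erule climb)+
  note c = inh_cst[OF has_ctx[OF X], of "KAccInd i i", simplified const_ty.simps]
  let ?T = "\<Pi> a:X. \<Pi> p:acc_ty i X L a. ?C \<cdot> a \<cdot> p"
  show ?thesis
  proof (rule inh_obtain[OF a(2) has_acc_ty[OF X L a(1)]])
    show "uniform (length \<Gamma>) (M a)" using has_uniform[OF M[OF has_ext[OF X] a(1)]] .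
    fix \<Delta> p assume d: "ext \<Gamma> \<Delta>" and p: "has \<Delta> p (acc_ty i X L a)"
    have "inh \<Gamma> (acc_case_ty i X L ?C \<rightarrow> ?T)"
      by (rule inh_app[OF inh_app[OF inh_app[OF c X] L] C])
        (insert C X L, (assumption | rule uniformity family_related[OF _ fM] | erule climb)+)
    then have "inh \<Gamma> ?T"
      by (rule inh_mp[OF _ S])
        (insert C X L, (assumption | rule uniformity family_related[OF _ fM] | erule climb)+)
    then have "inh \<Delta> ?T" using d by (rule inh_mono)
    note T = inh_app[OF inh_app[OF this has_mono[OF a(1) d]] p]
    have "inh \<Delta> (?C \<cdot> a \<cdot> p)"
      by (rule T) (insert has_mono[OF C d] has_mono[OF X d] has_mono[OF L d] has_mono[OF a(1) d] p,
        (assumption | rule uniformity | erule climb)+)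
    then show "inh \<Delta> (M a)"
      by (rule inh_conv[OF _ CM[OF d has_mono[OF a(1) d] p]])
  qed
qed

section \<open>Recursion on sequences\<close>

lemma jeq_arrow:
  assumes "jeq \<Gamma> A A' (U i)" "has \<Gamma> A (U i)" "jeq \<Gamma> B B' (U i)"
  shows "jeq \<Gamma> (A \<rightarrow> B) (A' \<rightarrow> B') (U i)"
  unfolding arrow_def using assms(1,2)
proof (rule jeq_pi)
  show "family (length \<Gamma>) (\<lambda>_. B)" "family (length \<Gamma>) (\<lambda>_. B')"
    using assms(3) by (auto simp: jeq_def intro!: familyI intro: related_uniform)
qed (use assms(3) jeq_mono in blast)

definition clos_rec where
  "clos_rec i j X R M N S x y u = clos_ind i j X R (motive i X R M) (\<Lambda> x:X. N x)
     (\<Lambda> x:X. \<Lambda> y:X. \<Lambda> z:X. \<Lambda> u:clos_ty i X R x y. \<Lambda> r:R \<cdot> y \<cdot> z. \<Lambda> h:M x y u. S x y z u r h) x y u"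

text \<open>Typing and naturality of the two cases of a recursion, collected once. Every function
  defined by recursion on sequences (\<open>append\<close>, \<open>clos_length\<close>,
  \<open>all_but_first\<close>, \<open>all_inner\<close>, \<open>zinv\<close>, \<open>path\<close>)
  obtains its typing and computation rules as an instance.\<close>

locale recursor =
  fixes \<Gamma> i j X R M N S
  assumes X: "has \<Gamma> X (U i)" and R: "has \<Gamma> R (X \<rightarrow> X \<rightarrow> U i)"
    and M: "\<And>\<Delta> x y u. ext \<Gamma> \<Delta> \<Longrightarrow> has \<Delta> x X \<Longrightarrow> has \<Delta> y X \<Longrightarrow> has \<Delta> u (clos_ty i X R x y) \<Longrightarrow>
      has \<Delta> (M x y u) (U j)"
    and fM: "family3 (length \<Gamma>) M"
    and N: "\<And>\<Delta> x. ext \<Gamma> \<Delta> \<Longrightarrow> has \<Delta> x X \<Longrightarrow> has \<Delta> (N x) (M x x (clos_nil i X R x))"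
    and fN: "family (length \<Gamma>) N"
    and S: "\<And>\<Delta> x y z u r h. ext \<Gamma> \<Delta> \<Longrightarrow> has \<Delta> x X \<Longrightarrow> has \<Delta> y X \<Longrightarrow> has \<Delta> z X \<Longrightarrow>
      has \<Delta> u (clos_ty i X R x y) \<Longrightarrow> has \<Delta> r (R \<cdot> y \<cdot> z) \<Longrightarrow> has \<Delta> h (M x y u) \<Longrightarrow>
      has \<Delta> (S x y z u r h) (M x z (clos_snoc i X R x y z u r))"
    and fS: "\<And>\<phi> p q b x x' y y' z z' u u' r r' h h'. traversal \<phi> p q (length \<Gamma>) \<Longrightarrow>
      related \<phi> p q b x x' \<Longrightarrow> related \<phi> p q True x x' \<Longrightarrow>
      related \<phi> p q b y y' \<Longrightarrow> related \<phi> p q True y y' \<Longrightarrow>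
      related \<phi> p q b z z' \<Longrightarrow> related \<phi> p q True z z' \<Longrightarrow>
      related \<phi> p q b u u' \<Longrightarrow> related \<phi> p q True u u' \<Longrightarrow>
      related \<phi> p q b r r' \<Longrightarrow> related \<phi> p q True r r' \<Longrightarrow>
      related \<phi> p q b h h' \<Longrightarrow> related \<phi> p q True h h' \<Longrightarrow>
      related \<phi> p q b (S x y z u r h) (S x' y' z' u' r' h')"
begin

abbreviation "snoc_fn \<equiv> (\<Lambda> x:X. \<Lambda> y:X. \<Lambda> z:X. \<Lambda> u:clos_ty i X R x y. \<Lambda> r:R \<cdot> y \<cdot> z. \<Lambda> h:M x y u. S x
  y z u r h)"

lemma C: "has \<Gamma> (motive i X R M) (\<Pi> x:X. \<Pi> y:X. clos_ty i X R x y \<rightarrow> U j)"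
  by (rule has_motive[OF X R _ fM]) (rule M)

lemma CM:
  assumes "ext \<Gamma> \<Delta>" "has \<Delta> x X" "has \<Delta> y X" "has \<Delta> u (clos_ty i X R x y)"
  shows "jeq \<Delta> (motive i X R M \<cdot> x \<cdot> y \<cdot> u) (M x y u) (U j)"
  by (rule jeq_motive[OF has_mono[OF X assms(1)] has_mono[OF R assms(1)] _ family3_mono[OF fM
    assms(1)] assms(2-)])
    (rule M[OF ext_trans[OF assms(1)]])

lemma snoc_typed:
  assumes "ext \<Gamma> \<Delta>" "has \<Delta> x X" "has \<Delta> y X" "has \<Delta> z X" "has \<Delta> u (clos_ty i X R x y)"
    "has \<Delta> r (R \<cdot> y \<cdot> z)"
  shows "has \<Delta> (clos_snoc i X R x y z u r) (clos_ty i X R x z)"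
  by (rule has_clos_snoc[OF has_mono[OF X assms(1)] has_mono[OF R assms(1)] assms(2-)])

lemma nil_typed:
  assumes "ext \<Gamma> \<Delta>" "has \<Delta> x X"
  shows "has \<Delta> (clos_nil i X R x) (clos_ty i X R x x)"
  by (rule has_clos_nil[OF has_mono[OF X assms(1)] has_mono[OF R assms(1)] assms(2-)])

lemma nil_fn: "has \<Gamma> (lam X N) (nil_case_ty i X R (motive i X R M))"
  unfolding nil_case_ty_def using X
proof (rule has_lam)
  fix \<Delta> x assume "ext \<Gamma> \<Delta>" "has \<Delta> x X"
  then show "has \<Delta> (N x) (motive i X R M \<cdot> x \<cdot> x \<cdot> clos_nil i X R x)"
    by (blast intro: has_conv N jeq_symI CM nil_typed)
qed (insert X R C fN, (assumption | rule uniformity family_related[OF _ fN] | erule climb)+)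

lemma step_fn:
  assumes d: "ext \<Gamma> \<Delta>" "has \<Delta> x X" "has \<Delta> y X" "has \<Delta> z X" "has \<Delta> u (clos_ty i X R x y)"
    "has \<Delta> r (R \<cdot> y \<cdot> z)"
  shows "has \<Delta> (lam (M x y u) (S x y z u r)) (M x y u \<rightarrow> M x z (clos_snoc i X R x y z u r))"
proof -
  have Mt: "has \<Delta> (M x y u) (U j)" "has \<Delta> (M x z (clos_snoc i X R x y z u r)) (U j)"
    using M d snoc_typed by blast+
  show ?thesis
    unfolding arrow_def using Mt(1)
  proof (rule has_lam)
    show "has \<Theta> (S x y z u r h) (M x z (clos_snoc i X R x y z u r))"
      if "ext \<Delta> \<Theta>" "has \<Theta> h (M x y u)" for \<Theta> h
      using S[OF ext_trans[OF d(1) that(1)] d(2-)[THEN has_mono, OF that(1)] that(2)] .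
  qed (insert d Mt, (assumption | rule uniformity fS | erule climb)+)
qed

lemma step_fn':
  assumes d: "ext \<Gamma> \<Delta>" "has \<Delta> x X" "has \<Delta> y X" "has \<Delta> z X" "has \<Delta> u (clos_ty i X R x y)"
    "has \<Delta> r (R \<cdot> y \<cdot> z)"
  shows "has \<Delta> (lam (M x y u) (S x y z u r)) (motive i X R M \<cdot> x \<cdot> y \<cdot> u \<rightarrow> motive i X R M \<cdot> x \<cdot> z \<cdot>
    clos_snoc i X R x y z u r)"
  by (rule has_conv[OF step_fn[OF d] jeq_arrow])
    (use d M CM snoc_typed in \<open>blast intro: jeq_symI\<close>)+

lemma snoc_fn: "has \<Gamma> snoc_fn (snoc_case_ty i X R (motive i X R M))"
  unfolding snoc_case_ty_def using X R C
  by - (assumption | rule step_fn' has_lam has_clos_ty has_rel[where R = R] | rule uniformity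
    family3_related[OF _ fM] fS | erule climb)+

lemma has_clos_rec:
  assumes "has \<Gamma> x X" "has \<Gamma> y X" "has \<Gamma> u (clos_ty i X R x y)"
  shows "has \<Gamma> (clos_rec i j X R M N S x y u) (M x y u)"
  unfolding clos_rec_def
  by (rule has_conv[OF has_clos_ind[OF X R C nil_fn snoc_fn assms] CM[OF has_ext[OF X] assms]])

lemma jeq_clos_rec_nil:
  assumes x: "has \<Gamma> x X"
  shows "jeq \<Gamma> (clos_rec i j X R M N S x x (clos_nil i X R x)) (N x) (M x x (clos_nil i X R x))"
proof -
  have "jeq \<Gamma> (lam X N \<cdot> x) (N x) (M x x (clos_nil i X R x))"
    by (rule jeq_beta[OF X x N fN])
      (insert X R, (assumption | rule uniformity family3_related[OF _ fM] | erule climb)+)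
  then show ?thesis
    unfolding clos_rec_def
    by (rule jeq_transI[OF jeq_convI[OF jeq_clos_nil[OF X R C nil_fn snoc_fn x]
          CM[OF has_ext[OF X] x x nil_typed[OF has_ext[OF X] x]]]])
qed

lemma jeq_clos_rec_snoc:
  assumes x: "has \<Gamma> x X" "has \<Gamma> y X" "has \<Gamma> z X" "has \<Gamma> u (clos_ty i X R x y)" "has \<Gamma> r (R \<cdot> y \<cdot> z)"
  shows "jeq \<Gamma> (clos_rec i j X R M N S x z (clos_snoc i X R x y z u r))
    (S x y z u r (clos_rec i j X R M N S x y u)) (M x z (clos_snoc i X R x y z u r))"
proof -
  let ?h = "clos_rec i j X R M N S x y u"
  have h: "has \<Gamma> ?h (M x y u)" by (rule has_clos_rec[OF x(1,2,4)])
  have "has \<Gamma> snoc_fn (\<Pi> x:X. \<Pi> y:X. \<Pi> z:X. \<Pi> u:clos_ty i X R x y. \<Pi> r:R \<cdot> y \<cdot> z.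
      M x y u \<rightarrow> M x z (clos_snoc i X R x y z u r))"
    using X R
    by - (assumption | rule step_fn has_lam has_clos_ty has_rel[where R = R]
      | rule uniformity family3_related[OF _ fM] fS | erule climb)+
  note e = jeq_beta_step[OF jeq_beta_step[OF jeq_beta_step[OF jeq_beta_step[OF jeq_beta_step[OF
      jeq_beta_step[OF jeq_reflI[OF this[unfolded arrow_def]] x(1)] x(2)] x(3)] x(4)] x(5)] h]
  have "jeq \<Gamma> (snoc_fn \<cdot> x \<cdot> y \<cdot> z \<cdot> u \<cdot> r \<cdot> ?h) (S x y z u r ?h) (M x z (clos_snoc i X R x y z u r))"
    by (rule e) (insert X R x M[OF has_ext[OF X] x(1,2,4)],
      (assumption | rule step_fn[unfolded arrow_def] S has_lam has_clos_ty has_rel[where R = R] |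
        rule uniformity family3_related[OF _ fM] fS | erule climb)+)
  then show ?thesis
    unfolding clos_rec_def
    by (rule jeq_transI[OF jeq_convI[OF jeq_clos_snoc[OF X R C nil_fn snoc_fn x]
          CM[OF has_ext[OF X] x(1,3) snoc_typed[OF has_ext[OF X] x]]]])
qed

end

section \<open>Sequences and zig-zags\<close>

lemma has_mp:
  assumes "has \<Gamma> f (A \<rightarrow> B)" "has \<Gamma> a A" "has \<Gamma> B (U i)"
  shows "has \<Gamma> (f \<cdot> a) B"
  by (rule has_app[OF assms(1)[unfolded arrow_def] assms(2)])
    (insert assms(3), (assumption | rule familyI | erule climb)+)

lemma has_lam_arrow:
  assumes "has \<Gamma> A (U i)" "\<And>\<Delta> x. ext \<Gamma> \<Delta> \<Longrightarrow> has \<Delta> x A \<Longrightarrow> has \<Delta> (b x) B"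
    "family (length \<Gamma>) b" "has \<Gamma> B (U j)"
  shows "has \<Gamma> (lam A b) (A \<rightarrow> B)"
  unfolding arrow_def
  by (rule has_lam[OF assms(1-3)])
    (insert assms(4), (assumption | rule familyI | erule climb)+)

text \<open>Both ends of \<open>v\<close> vary in the eliminator, so a sequence \<open>u\<close>
  with fixed end \<open>y\<close> cannot occur in the motive. The recursion therefore produces a
  function on all sequences from \<open>x\<close> to the left end, and is applied to
  \<open>u\<close> afterwards.\<close>

lemma append_clos_rec:
  "append i X R x y z u v = clos_rec i i X R (\<lambda>a b _. clos_ty i X R x a \<rightarrow> clos_ty i X R x b)
     (\<lambda>a. \<Lambda> w:clos_ty i X R x a. w)
     (\<lambda>a b c _ r h. \<Lambda> w:clos_ty i X R x a. clos_snoc i X R x b c (h \<cdot> w) r) y z v \<cdot> u"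
  unfolding append_def clos_rec_def motive_def ..

lemma append_recursor:
  assumes "has \<Gamma> X (U i)" "has \<Gamma> R (X \<rightarrow> X \<rightarrow> U i)" "has \<Gamma> x X"
  shows "recursor \<Gamma> i i X R (\<lambda>a b _. clos_ty i X R x a \<rightarrow> clos_ty i X R x b)
     (\<lambda>a. \<Lambda> w:clos_ty i X R x a. w)
     (\<lambda>a b c _ r h. \<Lambda> w:clos_ty i X R x a. clos_snoc i X R x b c (h \<cdot> w) r)"
  using assms
  by unfold_locales (assumption | rule has_lam_arrow has_arrow has_clos_ty has_clos_snoc has_mp
    uniformity | erule
        climb)+

lemma has_append:
  assumes "has \<Gamma> X (U i)" "has \<Gamma> R (X \<rightarrow> X \<rightarrow> U i)" "has \<Gamma> x X" "has \<Gamma> y X" "has \<Gamma> z X"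
    "has \<Gamma> u (clos_ty i X R x y)" "has \<Gamma> v (clos_ty i X R y z)"
  shows "has \<Gamma> (append i X R x y z u v) (clos_ty i X R x z)"
  unfolding append_clos_rec
  by (rule has_mp[OF recursor.has_clos_rec[OF append_recursor[OF assms(1-3)] assms(4,5,7)] assms(6)])
    (rule has_clos_ty[OF assms(1,2,3,5)])

lemma jeq_mp:
  assumes "jeq \<Gamma> f f' (A \<rightarrow> B)" "jeq \<Gamma> a a' A" "has \<Gamma> B (U i)"
  shows "jeq \<Gamma> (f \<cdot> a) (f' \<cdot> a') B"
  by (rule jeq_app[OF assms(1)[unfolded arrow_def] assms(2)])
    (insert assms(3), (assumption | rule familyI | erule climb)+)

lemma jeq_beta_arrow:
  assumes f: "jeq \<Gamma> f (lam A b) (A \<rightarrow> B)" and a: "has \<Gamma> a A" and A: "has \<Gamma> A (U i)"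
    and b: "\<And>\<Delta> x. ext \<Gamma> \<Delta> \<Longrightarrow> has \<Delta> x A \<Longrightarrow> has \<Delta> (b x) B"
    and fb: "family (length \<Gamma>) b" and B: "has \<Gamma> B (U j)"
  shows "jeq \<Gamma> (f \<cdot> a) (b a) B"
  by (rule jeq_beta_step[OF f[unfolded arrow_def] a A b fb])
    (insert B, (assumption | rule familyI | erule climb)+)

lemma jeq_append_nil:
  assumes "has \<Gamma> X (U i)" "has \<Gamma> R (X \<rightarrow> X \<rightarrow> U i)" "has \<Gamma> x X" "has \<Gamma> y X" "has \<Gamma> u (clos_ty i X R x y)"
  shows "jeq \<Gamma> (append i X R x y y u (clos_nil i X R y)) u (clos_ty i X R x y)"
  unfolding append_clos_rec
  by (rule jeq_beta_arrow[OF recursor.jeq_clos_rec_nil[OF append_recursor[OF assms(1-3)] assms(4)]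
    assms(5)])
    (insert assms, (assumption | rule has_clos_ty uniformity | erule climb)+)

lemma jeq_append_snoc:
  assumes "has \<Gamma> X (U i)" "has \<Gamma> R (X \<rightarrow> X \<rightarrow> U i)" "has \<Gamma> x X" "has \<Gamma> y X" "has \<Gamma> z X" "has \<Gamma> z' X"
    "has \<Gamma> u (clos_ty i X R x y)" "has \<Gamma> v (clos_ty i X R y z)" "has \<Gamma> r (R \<cdot> z \<cdot> z')"
  shows "jeq \<Gamma> (append i X R x y z' u (clos_snoc i X R y z z' v r))
    (clos_snoc i X R x z z' (append i X R x y z u v) r) (clos_ty i X R x z')"
  unfolding append_clos_rec
  by (rule jeq_beta_arrow[OF recursor.jeq_clos_rec_snoc[OF append_recursor[OF assms(1-3)]
    assms(4,5,6,8,9)] assms(7)])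
    (insert assms recursor.has_clos_rec[OF append_recursor[OF assms(1-3)] assms(4,5,8)], (assumption
      | rule has_clos_ty has_clos_snoc has_mp uniformity | erule climb)+)

lemma jeq_clos_ind_cong:
  assumes "has \<Gamma> X (U i)" "has \<Gamma> R (X \<rightarrow> X \<rightarrow> U i)" "has \<Gamma> C (\<Pi> x:X. \<Pi> y:X. clos_ty i X R x y \<rightarrow> U j)"
    "has \<Gamma> n (nil_case_ty i X R C)" "has \<Gamma> s (snoc_case_ty i X R C)"
    "has \<Gamma> x X" "has \<Gamma> y X" "jeq \<Gamma> u u' (clos_ty i X R x y)"
  shows "jeq \<Gamma> (clos_ind i j X R C n s x y u) (clos_ind i j X R C n s x y u') (C \<cdot> x \<cdot> y \<cdot> u)"
proof -
  note c = has_cst[OF has_ctx[OF assms(1)], of "KClosInd i j", simplified const_ty.simps arrow_def]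
  note * = assms[unfolded arrow_def]
  show ?thesis
    unfolding clos_ind_def
    by (rule jeq_app[OF jeq_reflI[OF has_app[OF has_app[OF has_app[OF has_app[OF has_app[OF
      has_app[OF has_app[OF c
          *(1)] *(2)] *(3)] *(4)] *(5)] *(6)] *(7)]] *(8)])
      (insert *, (assumption | rule uniformity | erule climb)+)
qed

lemma (in recursor) jeq_clos_rec_cong:
  assumes x: "has \<Gamma> x X" "has \<Gamma> y X" and u: "jeq \<Gamma> u u' (clos_ty i X R x y)"
    "has \<Gamma> u (clos_ty i X R x y)"
  shows "jeq \<Gamma> (clos_rec i j X R M N S x y u) (clos_rec i j X R M N S x y u') (M x y u)"
  unfolding clos_rec_def
  by (rule jeq_convI[OF jeq_clos_ind_cong[OF X R C nil_fn snoc_fn x u(1)] CM[OF has_ext[OF X] x u(2)]])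

lemma jeq_append_cong:
  assumes "has \<Gamma> X (U i)" "has \<Gamma> R (X \<rightarrow> X \<rightarrow> U i)" "has \<Gamma> x X" "has \<Gamma> y X" "has \<Gamma> z X"
    "has \<Gamma> u (clos_ty i X R x y)" "jeq \<Gamma> v v' (clos_ty i X R y z)" "has \<Gamma> v (clos_ty i X R y z)"
  shows "jeq \<Gamma> (append i X R x y z u v) (append i X R x y z u v') (clos_ty i X R x z)"
  unfolding append_clos_rec
  by (rule jeq_mp[OF recursor.jeq_clos_rec_cong[OF append_recursor[OF assms(1-3)] assms(4,5,7,8)]
    jeq_reflI[OF assms(6)]])
    (rule has_clos_ty[OF assms(1,2,3,5)])

section \<open>Length of a sequence and conditions on its objects\<close>

lemma clos_length_clos_rec:
  "clos_length i X R x y u = clos_rec i 0 X R (\<lambda>_ _ _. nat_ty) (\<lambda>_. nat_zero) (\<lambda>_ _ _ _ _ h.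
    nat_succ h) x y u"
  unfolding clos_length_def clos_rec_def motive_def ..

lemma has_nat:
  assumes "has \<Gamma> t T"
  shows "has \<Gamma> nat_ty (U 0)" "has \<Gamma> nat_zero nat_ty" "has \<Gamma> n nat_ty \<Longrightarrow> has \<Gamma> (nat_succ n) nat_ty"
proof -
  note c = has_cst[OF has_ctx[OF assms]]
  show n: "has \<Gamma> nat_ty (U 0)" using c[of KNat] by (simp add: nat_ty_def)
  show "has \<Gamma> nat_zero nat_ty" using c[of KZero] by (simp add: nat_zero_def)
  show "has \<Gamma> (nat_succ n) nat_ty" if "has \<Gamma> n nat_ty"
    unfolding nat_succ_def by (rule has_mp[OF _ that n]) (use c[of KSucc] in simp)
qed

lemma has_unit: "has \<Gamma> t T \<Longrightarrow> has \<Gamma> unit_ty (U 0)"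
  using has_cst[OF has_ctx, of \<Gamma> t T KUnit] by (simp add: unit_ty_def)

lemma clos_length_recursor:
  assumes "has \<Gamma> X (U i)" "has \<Gamma> R (X \<rightarrow> X \<rightarrow> U i)"
  shows "recursor \<Gamma> i 0 X R (\<lambda>_ _ _. nat_ty) (\<lambda>_. nat_zero) (\<lambda>_ _ _ _ _ h. nat_succ h)"
  using assms
  by unfold_locales (assumption | rule has_nat uniformity | erule climb)+

lemma has_clos_length:
  assumes "has \<Gamma> X (U i)" "has \<Gamma> R (X \<rightarrow> X \<rightarrow> U i)" "has \<Gamma> x X" "has \<Gamma> y X" "has \<Gamma> u (clos_ty i X R x y)"
  shows "has \<Gamma> (clos_length i X R x y u) nat_ty"
  unfolding clos_length_clos_rec
  by (rule recursor.has_clos_rec[OF clos_length_recursor[OF assms(1,2)] assms(3-5)])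

lemma jeq_clos_length_nil:
  assumes "has \<Gamma> X (U i)" "has \<Gamma> R (X \<rightarrow> X \<rightarrow> U i)" "has \<Gamma> x X" "has \<Gamma> u (clos_ty i X R x x)"
    "jeq \<Gamma> u (clos_nil i X R x) (clos_ty i X R x x)"
  shows "jeq \<Gamma> (clos_length i X R x x u) nat_zero nat_ty"
  unfolding clos_length_clos_rec
  by (rule jeq_transI[OF recursor.jeq_clos_rec_cong recursor.jeq_clos_rec_nil, OF
    clos_length_recursor assms(3,3,5,4) clos_length_recursor])
    (rule assms)+

lemma all_but_first_clos_rec:
  "all_but_first i X R P x y u = clos_rec i (Suc i) X R (\<lambda>_ _ _. U i) (\<lambda>_. unit_ty)
     (\<lambda>_ _ c _ _ h. sigma_ty i h (\<Lambda> _:h. P c)) x y u"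
  unfolding all_but_first_def clos_rec_def motive_def ..

lemma all_inner_clos_rec:
  "all_inner i X R P x y u = clos_rec i (Suc i) X R (\<lambda>_ _ _. U i) (\<lambda>_. unit_ty)
     (\<lambda>a b c w _ h. all_but_first i X R P a b w) x y u"
  unfolding all_inner_def clos_rec_def motive_def ..

context
  fixes \<Gamma> i X R P
  assumes X: "has \<Gamma> X (U i)" and R: "has \<Gamma> R (X \<rightarrow> X \<rightarrow> U i)"
    and P: "\<And>\<Delta> x. ext \<Gamma> \<Delta> \<Longrightarrow> has \<Delta> x X \<Longrightarrow> has \<Delta> (P x) (U i)"
    and fP: "family (length \<Gamma>) P"
begin

text \<open>A large elimination: the values of the recursion are types in \<open>U i\<close>, so the
  constant motive \<open>U i\<close> lives in \<open>U (Suc i)\<close>, whence the second level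
  index.\<close>

lemma all_but_first_recursor:
  "recursor \<Gamma> i (Suc i) X R (\<lambda>_ _ _. U i) (\<lambda>_. unit_ty) (\<lambda>_ _ c _ _ h. sigma_ty i h (\<Lambda> _:h. P c))"
  using X R has_unit[OF X] has_U'[OF X]
  by unfold_locales (assumption | rule P has_U' has_cumul[OF has_unit] has_sigma_ty le0 uniformity
        family_related[OF _ fP] | erule climb)+

lemma has_all_but_first:
  assumes "has \<Gamma> x X" "has \<Gamma> y X" "has \<Gamma> u (clos_ty i X R x y)"
  shows "has \<Gamma> (all_but_first i X R P x y u) (U i)"
  unfolding all_but_first_clos_rec
  by (rule recursor.has_clos_rec[OF all_but_first_recursor assms])

lemma jeq_all_but_first_snoc:
  assumes "has \<Gamma> x X" "has \<Gamma> y X" "has \<Gamma> z X" "has \<Gamma> u (clos_ty i X R x y)" "has \<Gamma> r (R \<cdot> y \<cdot> z)"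
  shows "jeq \<Gamma> (all_but_first i X R P x z (clos_snoc i X R x y z u r))
    (sigma_ty i (all_but_first i X R P x y u) (\<Lambda> _:all_but_first i X R P x y u. P z)) (U i)"
  unfolding all_but_first_clos_rec
  by (rule recursor.jeq_clos_rec_snoc[OF all_but_first_recursor assms])

end

lemma related_all_but_first:
  assumes t: "traversal \<phi> p q n" and P: "\<And>c c'. related \<phi> p q True c c' \<Longrightarrow> related \<phi> p q True (P c)
    (P' c')"
    and "related \<phi> p q b X X'" "related \<phi> p q b R R'" "related \<phi> p q b x x'" "related \<phi> p q b y y'"
    "related \<phi> p q b u u'"
  shows "related \<phi> p q b (all_but_first i X R P x y u) (all_but_first i X' R' P' x' y' u')"
  unfolding all_but_first_def using assms assms(3-)[THEN related_weaken]
  by - (assumption | (rule related_weaken, assumption) | rule related_intros P)+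

lemma related_all_inner:
  assumes t: "traversal \<phi> p q n" and P: "\<And>c c'. related \<phi> p q True c c' \<Longrightarrow> related \<phi> p q True (P c)
    (P' c')"
    and "related \<phi> p q b X X'" "related \<phi> p q b R R'" "related \<phi> p q b x x'" "related \<phi> p q b y y'"
    "related \<phi> p q b u u'"
  shows "related \<phi> p q b (all_inner i X R P x y u) (all_inner i X' R' P' x' y' u')"
  unfolding all_inner_def using assms assms(3-)[THEN related_weaken]
  by - (assumption | (rule related_weaken, assumption) | rule related_intros related_all_but_first P)+

lemma all_inner_recursor:
  assumes X: "has \<Gamma> X (U i)" and R: "has \<Gamma> R (X \<rightarrow> X \<rightarrow> U i)"
    and P: "\<And>\<Delta> x. ext \<Gamma> \<Delta> \<Longrightarrow> has \<Delta> x X \<Longrightarrow> has \<Delta> (P x) (U i)"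
    and fP: "family (length \<Gamma>) P"
  shows "recursor \<Gamma> i (Suc i) X R (\<lambda>_ _ _. U i) (\<lambda>_. unit_ty) (\<lambda>a b c w _ h. all_but_first i X R P a
    b w)"
  using X R has_unit[OF X] has_U'[OF X]
  by unfold_locales (assumption | rule P has_U' has_cumul[OF has_unit] le0 has_all_but_first
    family_mono[OF fP]
        uniformity related_all_but_first family_related[OF _ fP] | erule climb)+

lemma has_all_inner:
  assumes X: "has \<Gamma> X (U i)" and R: "has \<Gamma> R (X \<rightarrow> X \<rightarrow> U i)"
    and P: "\<And>\<Delta> x. ext \<Gamma> \<Delta> \<Longrightarrow> has \<Delta> x X \<Longrightarrow> has \<Delta> (P x) (U i)"
    and fP: "family (length \<Gamma>) P"
    and x: "has \<Gamma> x X" "has \<Gamma> y X" "has \<Gamma> u (clos_ty i X R x y)"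
  shows "has \<Gamma> (all_inner i X R P x y u) (U i)"
  unfolding all_inner_clos_rec
  by (rule recursor.has_clos_rec[OF all_inner_recursor[OF X R _ fP] x]) (rule P)

lemma jeq_all_inner_snoc:
  assumes X: "has \<Gamma> X (U i)" and R: "has \<Gamma> R (X \<rightarrow> X \<rightarrow> U i)"
    and P: "\<And>\<Delta> x. ext \<Gamma> \<Delta> \<Longrightarrow> has \<Delta> x X \<Longrightarrow> has \<Delta> (P x) (U i)"
    and fP: "family (length \<Gamma>) P"
    and x: "has \<Gamma> x X" "has \<Gamma> y X" "has \<Gamma> z X" "has \<Gamma> u (clos_ty i X R x y)" "has \<Gamma> r (R \<cdot> y \<cdot> z)"
  shows "jeq \<Gamma> (all_inner i X R P x z (clos_snoc i X R x y z u r)) (all_but_first i X R P x y u) (U i)"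
  unfolding all_inner_clos_rec
  by (rule recursor.jeq_clos_rec_snoc[OF all_inner_recursor[OF X R _ fP] x]) (rule P)

lemma has_binary_relation:
  assumes X: "has \<Gamma> X (U i)"
    and T: "\<And>\<Delta> x y. ext \<Gamma> \<Delta> \<Longrightarrow> has \<Delta> x X \<Longrightarrow> has \<Delta> y X \<Longrightarrow> has \<Delta> (T x y) (U j)"
    and fT: "\<And>\<phi> p q b x x' y y'. traversal \<phi> p q (length \<Gamma>) \<Longrightarrow> related \<phi> p q b x x' \<Longrightarrow>
      related \<phi> p q b y y' \<Longrightarrow> related \<phi> p q b (T x y) (T x' y')"
  shows "has \<Gamma> (\<Lambda> x:X. \<Lambda> y:X. T x y) (X \<rightarrow> X \<rightarrow> U j)"
  unfolding arrow_def using X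
  by - (assumption | rule has_lam T uniformity fT | erule climb)+

lemma jeq_binary_relation:
  assumes X: "has \<Gamma> X (U i)"
    and T: "\<And>\<Delta> x y. ext \<Gamma> \<Delta> \<Longrightarrow> has \<Delta> x X \<Longrightarrow> has \<Delta> y X \<Longrightarrow> has \<Delta> (T x y) (U j)"
    and fT: "\<And>\<phi> p q b x x' y y'. traversal \<phi> p q (length \<Gamma>) \<Longrightarrow> related \<phi> p q b x x' \<Longrightarrow>
      related \<phi> p q b y y' \<Longrightarrow> related \<phi> p q b (T x y) (T x' y')"
    and x: "has \<Gamma> x X" "has \<Gamma> y X"
  shows "jeq \<Gamma> ((\<Lambda> x:X. \<Lambda> y:X. T x y) \<cdot> x \<cdot> y) (T x y) (U j)"
proof -
  have l: "has \<Gamma> (\<Lambda> x:X. \<Lambda> y:X. T x y) (X \<rightarrow> X \<rightarrow> U j)"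
    by (rule has_binary_relation[OF X]) (fact T fT)+
  show ?thesis
    by (rule jeq_beta_step[OF jeq_beta_step[OF jeq_reflI[OF l[unfolded arrow_def]] x(1)] x(2)])
      (insert X x, (assumption | rule has_lam T uniformity fT | erule climb)+)
qed

section \<open>Naturality and typing of the operations on zig-zags\<close>

lemma related_clos_single:
  assumes t: "traversal \<phi> p q n" and "related \<phi> p q b X X'" "related \<phi> p q b R R'"
    "related \<phi> p q b x x'" "related \<phi> p q b y y'"
    "related \<phi> p q b r r'"
  shows "related \<phi> p q b (clos_single i X R x y r) (clos_single i X' R' x' y' r')"
  unfolding clos_single_def using assms
  by - (assumption | rule related_intros)+

lemma related_append:
  assumes t: "traversal \<phi> p q n" and "related \<phi> p q b X X'" "related \<phi> p q b R R'"
    "related \<phi> p q b x x'" "related \<phi> p q b y y'"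
    "related \<phi> p q b z z'" "related \<phi> p q b u u'" "related \<phi> p q b v v'"
  shows "related \<phi> p q b (append i X R x y z u v) (append i X' R' x' y' z' u' v')"
  unfolding append_def using assms assms(2-)[THEN related_weaken]
  by - (assumption | rule related_intros)+

lemma related_clos_length:
  assumes t: "traversal \<phi> p q n" and "related \<phi> p q b X X'" "related \<phi> p q b R R'"
    "related \<phi> p q b x x'" "related \<phi> p q b y y'"
    "related \<phi> p q b u u'"
  shows "related \<phi> p q b (clos_length i X R x y u) (clos_length i X' R' x' y' u')"
  unfolding clos_length_def using assms assms(2-)[THEN related_weaken]
  by - (assumption | rule related_intros)+

lemma related_sym_closure:
  assumes t: "traversal \<phi> p q n" and "related \<phi> p q b X X'" "related \<phi> p q b R R'"
  shows "related \<phi> p q b (sym_closure i X R) (sym_closure i X' R')"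
  unfolding sym_closure_def using assms assms(2-)[THEN related_weaken]
  by - (assumption | rule related_intros)+

lemma has_clos_single:
  assumes "has \<Gamma> X (U i)" "has \<Gamma> R (X \<rightarrow> X \<rightarrow> U i)" "has \<Gamma> x X" "has \<Gamma> y X" "has \<Gamma> r (R \<cdot> x \<cdot> y)"
  shows "has \<Gamma> (clos_single i X R x y r) (clos_ty i X R x y)"
  unfolding clos_single_def by (rule has_clos_snoc[OF assms(1,2,3,3,4) has_clos_nil[OF assms(1-3)]
    assms(5)])

lemma jeq_clos_snoc_cong:
  assumes "has \<Gamma> X (U i)" "has \<Gamma> R (X \<rightarrow> X \<rightarrow> U i)" "has \<Gamma> x X" "has \<Gamma> y X" "has \<Gamma> z X"
    "jeq \<Gamma> u u' (clos_ty i X R x y)" "jeq \<Gamma> r r' (R \<cdot> y \<cdot> z)"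
  shows "jeq \<Gamma> (clos_snoc i X R x y z u r) (clos_snoc i X R x y z u' r') (clos_ty i X R x z)"
proof -
  note c = has_cst[OF has_ctx[OF assms(1)], of "KSnoc i", simplified const_ty.simps arrow_def]
  note * = assms[unfolded arrow_def]
  show ?thesis
    unfolding clos_snoc_def
    by (rule jeq_app[OF jeq_app[OF jeq_reflI[OF has_app[OF has_app[OF has_app[OF has_app[OF has_app[OF c
          *(1)] *(2)] *(3)] *(4)] *(5)]] *(6)] *(7)])
      (insert *, (assumption | rule uniformity | erule climb)+)
qed

lemma jeq_append_single:
  assumes "has \<Gamma> X (U i)" "has \<Gamma> R (X \<rightarrow> X \<rightarrow> U i)" "has \<Gamma> x X" "has \<Gamma> y X" "has \<Gamma> z X"
    "has \<Gamma> u (clos_ty i X R x y)" "has \<Gamma> r (R \<cdot> y \<cdot> z)"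
  shows "jeq \<Gamma> (append i X R x y z u (clos_single i X R y z r)) (clos_snoc i X R x y z u r) (clos_ty
    i X R x z)"
  unfolding clos_single_def
  by (rule jeq_transI[OF jeq_append_snoc jeq_clos_snoc_cong[OF assms(1-5) jeq_append_nil jeq_reflI]])
    (use assms has_clos_nil in blast)+

lemma has_sym_closure:
  assumes "has \<Gamma> X (U i)" "has \<Gamma> R (X \<rightarrow> X \<rightarrow> U i)"
  shows "has \<Gamma> (sym_closure i X R) (X \<rightarrow> X \<rightarrow> U i)"
  unfolding sym_closure_def
  by (rule has_binary_relation[OF assms(1)])
    (insert assms, (assumption | rule has_sum_ty has_rel[where R = R] uniformity | erule climb)+)

lemma jeq_sym_closure:
  assumes "has \<Gamma> X (U i)" "has \<Gamma> R (X \<rightarrow> X \<rightarrow> U i)" "has \<Gamma> x X" "has \<Gamma> y X"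
  shows "jeq \<Gamma> (sym_closure i X R \<cdot> x \<cdot> y) (sum_ty i (R \<cdot> x \<cdot> y) (R \<cdot> y \<cdot> x)) (U i)"
  unfolding sym_closure_def
  by (rule jeq_binary_relation[OF assms(1) _ _ assms(3,4)])
    (insert assms, (assumption | rule has_sum_ty has_rel[where R = R] uniformity | erule climb)+)

lemma has_zig:
  assumes "has \<Gamma> X (U i)" "has \<Gamma> R (X \<rightarrow> X \<rightarrow> U i)" "has \<Gamma> x X" "has \<Gamma> y X"
  shows "has \<Gamma> (zig i X R x y) (U i)"
  unfolding zig_def by (rule has_clos_ty[OF assms(1) has_sym_closure[OF assms(1,2)] assms(3,4)])

lemma has_empty_zig:
  assumes "has \<Gamma> X (U i)" "has \<Gamma> R (X \<rightarrow> X \<rightarrow> U i)" "has \<Gamma> x X"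
  shows "has \<Gamma> (empty_zig i X R x) (zig i X R x x)"
  unfolding zig_def empty_zig_def by (rule has_clos_nil[OF assms(1) has_sym_closure[OF assms(1,2)]
    assms(3)])

lemma has_zconcat:
  assumes "has \<Gamma> X (U i)" "has \<Gamma> R (X \<rightarrow> X \<rightarrow> U i)" "has \<Gamma> x X" "has \<Gamma> y X" "has \<Gamma> z X"
    "has \<Gamma> u (zig i X R x y)" "has \<Gamma> v (zig i X R y z)"
  shows "has \<Gamma> (zconcat i X R x y z u v) (zig i X R x z)"
  using has_append[OF assms(1) has_sym_closure[OF assms(1,2)] assms(3-5)] assms(6,7)
  unfolding zig_def zconcat_def .

definition single :: "nat \<Rightarrow> stm \<Rightarrow> stm \<Rightarrow> stm \<Rightarrow> stm \<Rightarrow> stm \<Rightarrow> stm" where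
  "single i X R x y r = clos_single i X (sym_closure i X R) x y r"

definition backward :: "nat \<Rightarrow> stm \<Rightarrow> stm \<Rightarrow> stm \<Rightarrow> stm \<Rightarrow> stm \<Rightarrow> stm" where
  "backward i X R x y s = single i X R x y (sum_inr i (R \<cdot> x \<cdot> y) (R \<cdot> y \<cdot> x) s)"

lemma forward_single: "forward i X R x y s = single i X R x y (sum_inl i (R \<cdot> x \<cdot> y) (R \<cdot> y \<cdot> x) s)"
  unfolding forward_def single_def ..

lemma has_single:
  assumes "has \<Gamma> X (U i)" "has \<Gamma> R (X \<rightarrow> X \<rightarrow> U i)" "has \<Gamma> x X" "has \<Gamma> y X"
    "has \<Gamma> r (sum_ty i (R \<cdot> x \<cdot> y) (R \<cdot> y \<cdot> x))"
  shows "has \<Gamma> (single i X R x y r) (zig i X R x y)"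
  unfolding single_def zig_def
  by (rule has_clos_single[OF assms(1) has_sym_closure[OF assms(1,2)] assms(3,4)
        has_conv[OF assms(5) jeq_symI[OF jeq_sym_closure[OF assms(1-4)]]]])

lemma has_forward:
  assumes "has \<Gamma> X (U i)" "has \<Gamma> R (X \<rightarrow> X \<rightarrow> U i)" "has \<Gamma> x X" "has \<Gamma> y X" "has \<Gamma> s (R \<cdot> x \<cdot> y)"
  shows "has \<Gamma> (forward i X R x y s) (zig i X R x y)"
  unfolding forward_single
  by (rule has_single[OF assms(1-4) has_sum_inl])
    (insert assms, (assumption | rule has_rel)+)

lemma has_backward:
  assumes "has \<Gamma> X (U i)" "has \<Gamma> R (X \<rightarrow> X \<rightarrow> U i)" "has \<Gamma> x X" "has \<Gamma> y X" "has \<Gamma> s (R \<cdot> y \<cdot> x)"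
  shows "has \<Gamma> (backward i X R x y s) (zig i X R x y)"
  unfolding backward_def
  by (rule has_single[OF assms(1-4) has_sum_inr])
    (insert assms, (assumption | rule has_rel)+)

text \<open>\<open>reverse_step\<close> with arbitrary summands in place of
  \<open>R \<cdot> x \<cdot> y\<close> and \<open>R \<cdot> y \<cdot> x\<close>, so that its typing
  and computation do not involve the relation.\<close>

definition swap where
  "swap i A B = sum_ind i i A B (\<Lambda> _:sum_ty i A B. sum_ty i B A)
    (\<Lambda> s:A. sum_inr i B A s) (\<Lambda> s:B. sum_inl i B A s)"

lemma reverse_step_swap: "reverse_step i R x y r = swap i (R \<cdot> x \<cdot> y) (R \<cdot> y \<cdot> x) r"
  unfolding reverse_step_def swap_def ..

context
  fixes \<Gamma> i A B
  assumes A: "has \<Gamma> A (U i)" and B: "has \<Gamma> B (U i)"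
begin

private abbreviation "C \<equiv> \<Lambda> _:sum_ty i A B. sum_ty i B A"

private lemma C: "has \<Gamma> C (sum_ty i A B \<rightarrow> U i)"
  using A B by - (assumption | rule has_family has_sum_ty uniformity | erule climb)+

private lemma CM:
  assumes "ext \<Gamma> \<Delta>" "has \<Delta> s (sum_ty i A B)"
  shows "jeq \<Delta> (C \<cdot> s) (sum_ty i B A) (U i)"
  by (rule jeq_beta_type[OF _ assms(2)]) (insert A B assms(1), (assumption | rule has_sum_ty
    uniformity | erule climb)+)

private lemma inr_fn: "has \<Gamma> (\<Lambda> s:A. sum_inr i B A s) (\<Pi> s:A. C \<cdot> sum_inl i A B s)"
  using A
proof (rule has_lam)
  fix \<Delta> x assume d: "ext \<Gamma> \<Delta>" "has \<Delta> x A"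
  show "has \<Delta> (sum_inr i B A x) (C \<cdot> sum_inl i A B x)"
    by (rule has_conv[OF has_sum_inr jeq_symI[OF CM[OF d(1) has_sum_inl]]]) (use A B d has_mono in
      blast)+
qed (insert A B, (assumption | rule uniformity | erule climb)+)

private lemma inl_fn: "has \<Gamma> (\<Lambda> s:B. sum_inl i B A s) (\<Pi> s:B. C \<cdot> sum_inr i A B s)"
  using B
proof (rule has_lam)
  fix \<Delta> x assume d: "ext \<Gamma> \<Delta>" "has \<Delta> x B"
  show "has \<Delta> (sum_inl i B A x) (C \<cdot> sum_inr i A B x)"
    by (rule has_conv[OF has_sum_inl jeq_symI[OF CM[OF d(1) has_sum_inr]]]) (use A B d has_mono in
      blast)+
qed (insert A B, (assumption | rule uniformity | erule climb)+)

lemma has_swap: "has \<Gamma> s (sum_ty i A B) \<Longrightarrow> has \<Gamma> (swap i A B s) (sum_ty i B A)"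
  unfolding swap_def by (rule has_conv[OF has_sum_ind[OF A B C inr_fn inl_fn] CM[OF has_ext[OF A]]])

lemma jeq_swap_inr:
  assumes "has \<Gamma> s B"
  shows "jeq \<Gamma> (swap i A B (sum_inr i A B s)) (sum_inl i B A s) (sum_ty i B A)"
proof -
  have "jeq \<Gamma> ((\<Lambda> s:B. sum_inl i B A s) \<cdot> s) (sum_inl i B A s) (sum_ty i B A)"
    by (rule jeq_beta[OF B assms]) (insert A B, (assumption | rule has_sum_inl uniformity | erule
      climb)+)
  then show ?thesis
    unfolding swap_def
    by (rule jeq_transI[OF jeq_convI[OF jeq_sum_inr[OF A B C inr_fn inl_fn assms] CM[OF has_ext[OF
      A] has_sum_inr[OF A B assms]]]])
qed

end

lemma zinv_clos_rec:
  "zinv i X R x y u = clos_rec i i X (sym_closure i X R) (\<lambda>a b _. zig i X R b a) (\<lambda>a. empty_zig i X R a)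
    (\<lambda>a b c _ r h. zconcat i X R c b a (clos_single i X (sym_closure i X R) c b (reverse_step i R b
      c r)) h) x y u"
  unfolding zinv_def clos_rec_def motive_def zig_def ..

lemma has_reverse_step:
  assumes "has \<Gamma> X (U i)" "has \<Gamma> R (X \<rightarrow> X \<rightarrow> U i)" "has \<Gamma> x X" "has \<Gamma> y X"
    "has \<Gamma> r (sym_closure i X R \<cdot> x \<cdot> y)"
  shows "has \<Gamma> (reverse_step i R x y r) (sym_closure i X R \<cdot> y \<cdot> x)"
  unfolding reverse_step_swap
  by (rule has_conv[OF has_swap[OF _ _ has_conv[OF assms(5) jeq_sym_closure[OF assms(1-4)]]]
        jeq_symI[OF jeq_sym_closure[OF assms(1,2,4,3)]]])
    (rule has_rel[OF assms(2,1)]; fact assms)+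

lemma has_zig_single:
  assumes "has \<Gamma> X (U i)" "has \<Gamma> R (X \<rightarrow> X \<rightarrow> U i)" "has \<Gamma> x X" "has \<Gamma> y X"
    "has \<Gamma> r (sym_closure i X R \<cdot> x \<cdot> y)"
  shows "has \<Gamma> (clos_single i X (sym_closure i X R) x y r) (zig i X R x y)"
  unfolding zig_def by (rule has_clos_single[OF assms(1) has_sym_closure[OF assms(1,2)] assms(3-5)])

lemma related_reverse_step:
  assumes t: "traversal \<phi> p q n" and "related \<phi> p q b R R'" "related \<phi> p q b x x'"
    "related \<phi> p q b y y'"
    "related \<phi> p q b r r'"
  shows "related \<phi> p q b (reverse_step i R x y r) (reverse_step i R' x' y' r')"
  unfolding reverse_step_def using assms assms(2-)[THEN related_weaken]
  by - (assumption | rule related_intros)+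

lemma related_zig:
  assumes t: "traversal \<phi> p q n" and "related \<phi> p q b X X'" "related \<phi> p q b R R'"
    "related \<phi> p q b x x'" "related \<phi> p q b y y'"
  shows "related \<phi> p q b (zig i X R x y) (zig i X' R' x' y')"
  unfolding zig_def using assms
  by - (assumption | rule related_intros related_sym_closure)+

lemma related_empty_zig:
  assumes t: "traversal \<phi> p q n" and "related \<phi> p q b X X'" "related \<phi> p q b R R'"
    "related \<phi> p q b x x'"
  shows "related \<phi> p q b (empty_zig i X R x) (empty_zig i X' R' x')"
  unfolding empty_zig_def using assms
  by - (assumption | rule related_intros related_sym_closure)+

lemma related_forward:
  assumes t: "traversal \<phi> p q n" and "related \<phi> p q b X X'" "related \<phi> p q b R R'"
    "related \<phi> p q b x x'" "related \<phi> p q b y y'" "related \<phi> p q b s s'"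
  shows "related \<phi> p q b (forward i X R x y s) (forward i X' R' x' y' s')"
  unfolding forward_def using assms
  by - (assumption | rule related_intros related_sym_closure related_clos_single)+

lemma related_zconcat:
  assumes t: "traversal \<phi> p q n" and "related \<phi> p q b X X'" "related \<phi> p q b R R'"
    "related \<phi> p q b x x'" "related \<phi> p q b y y'" "related \<phi> p q b z z'" "related \<phi> p q b u u'"
      "related \<phi> p q b v v'"
  shows "related \<phi> p q b (zconcat i X R x y z u v) (zconcat i X' R' x' y' z' u' v')"
  unfolding zconcat_def using assms
  by - (assumption | rule related_append related_sym_closure)+

lemma related_zinv:
  assumes t: "traversal \<phi> p q n" and "related \<phi> p q b X X'" "related \<phi> p q b R R'"
    "related \<phi> p q b x x'" "related \<phi> p q b y y'" "related \<phi> p q b u u'"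
  shows "related \<phi> p q b (zinv i X R x y u) (zinv i X' R' x' y' u')"
  unfolding zinv_def using assms assms(2-)[THEN related_weaken]
  by - (assumption | rule related_intros related_sym_closure related_zig related_empty_zig
    related_zconcat
    related_clos_single related_reverse_step)+

lemmas related_zig_intros = related_sym_closure related_zig related_empty_zig related_zconcat
  related_zinv
    related_clos_single related_reverse_step related_forward related_append related_clos_length
    related_all_but_first related_all_inner

lemma zinv_recursor:
  assumes "has \<Gamma> X (U i)" "has \<Gamma> R (X \<rightarrow> X \<rightarrow> U i)"
  shows "recursor \<Gamma> i i X (sym_closure i X R) (\<lambda>a b _. zig i X R b a) (\<lambda>a. empty_zig i X R a)
    (\<lambda>a b c _ r h. zconcat i X R c b a (clos_single i X (sym_closure i X R) c b (reverse_step i R b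
      c r)) h)"
  using assms has_sym_closure[OF assms]
  by unfold_locales (assumption | rule has_zig has_empty_zig has_zconcat has_zig_single
    has_reverse_step uniformity
        related_zig_intros | erule climb)+

lemma has_zinv:
  assumes "has \<Gamma> X (U i)" "has \<Gamma> R (X \<rightarrow> X \<rightarrow> U i)" "has \<Gamma> x X" "has \<Gamma> y X" "has \<Gamma> u (zig i X R x y)"
  shows "has \<Gamma> (zinv i X R x y u) (zig i X R y x)"
  unfolding zinv_clos_rec
  by (rule recursor.has_clos_rec[OF zinv_recursor[OF assms(1,2)] assms(3,4) assms(5)[unfolded zig_def]])

lemma jeq_single_cong:
  assumes "has \<Gamma> X (U i)" "has \<Gamma> R (X \<rightarrow> X \<rightarrow> U i)" "has \<Gamma> x X" "has \<Gamma> y X" "jeq \<Gamma> r r' (sum_ty i (R \<cdot>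
    x \<cdot> y) (R \<cdot> y \<cdot> x))"
  shows "jeq \<Gamma> (single i X R x y r) (single i X R x y r') (zig i X R x y)"
  unfolding single_def zig_def clos_single_def
  by (rule jeq_clos_snoc_cong[OF assms(1) has_sym_closure[OF assms(1,2)] assms(3,3,4)
        jeq_reflI[OF has_clos_nil[OF assms(1) has_sym_closure[OF assms(1,2)] assms(3)]]
        jeq_convI[OF assms(5) jeq_symI[OF jeq_sym_closure[OF assms(1-4)]]]])

text \<open>Reversal of a single step computes to the swapped step composed with the reversal of the
  empty zig-zag; the latter computes to the empty zig-zag and is absorbed by the judgmental right
  unit law. This makes the cancellation law usable in the order backward step, forward step.\<close>

lemma jeq_zinv_backward:
  assumes X: "has \<Gamma> X (U i)" and R: "has \<Gamma> R (X \<rightarrow> X \<rightarrow> U i)" and x: "has \<Gamma> x X" and y: "has \<Gamma> y X"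
    and s: "has \<Gamma> s (R \<cdot> y \<cdot> x)"
  shows "jeq \<Gamma> (zinv i X R x y (backward i X R x y s)) (forward i X R y x s) (zig i X R y x)"
proof -
  let ?S = "sym_closure i X R"
  let ?r = "sum_inr i (R \<cdot> x \<cdot> y) (R \<cdot> y \<cdot> x) s"
  let ?t = "single i X R y x (reverse_step i R x y ?r)"
  note S = has_sym_closure[OF X R]
  note Rxy = has_rel[OF R X x y] has_rel[OF R X y x]
  have r: "has \<Gamma> ?r (sum_ty i (R \<cdot> x \<cdot> y) (R \<cdot> y \<cdot> x))" by (rule has_sum_inr[OF Rxy s])
  have r': "has \<Gamma> ?r (?S \<cdot> x \<cdot> y)" by (rule has_conv[OF r jeq_symI[OF jeq_sym_closure[OF X R x y]]])
  have t: "has \<Gamma> ?t (zig i X R y x)"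
    unfolding reverse_step_swap by (rule has_single[OF X R y x has_swap[OF Rxy r]])
  note n = has_clos_nil[OF X S x]
  let ?i = "clos_rec i i X (sym_closure i X R) (\<lambda>a b _. zig i X R b a) (\<lambda>a. empty_zig i X R a)
    (\<lambda>a b c _ r h. zconcat i X R c b a (clos_single i X (sym_closure i X R) c b (reverse_step i R b
      c r)) h) x x (clos_nil i X ?S x)"
  have "jeq \<Gamma> (zinv i X R x y (backward i X R x y s)) (zconcat i X R y x x ?t ?i) (zig i X R y x)"
    using recursor.jeq_clos_rec_snoc[OF zinv_recursor[OF X R] x x y n r']
    unfolding zinv_clos_rec backward_def single_def clos_single_def .
  also have "jeq \<Gamma> (zconcat i X R y x x ?t ?i) (zconcat i X R y x x ?t (empty_zig i X R x)) (zig i X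
    R y x)"
    using jeq_append_cong[OF X S y x x t[unfolded zig_def] recursor.jeq_clos_rec_nil[OF
      zinv_recursor[OF X R] x, unfolded zig_def]
      recursor.has_clos_rec[OF zinv_recursor[OF X R] x x n, unfolded zig_def]]
    unfolding zconcat_def zig_def .
  also have "jeq \<Gamma> (zconcat i X R y x x ?t (empty_zig i X R x)) ?t (zig i X R y x)"
    using jeq_append_nil[OF X S y x t[unfolded zig_def]] unfolding zconcat_def zig_def empty_zig_def .
  also have "jeq \<Gamma> ?t (forward i X R y x s) (zig i X R y x)"
    unfolding forward_single reverse_step_swap by (rule jeq_single_cong[OF X R y x jeq_swap_inr[OF
      Rxy s]])
  finally show ?thesis .
qed

section \<open>Closure operations on inhabited types of sequences\<close>

lemma inh_clos_trans:
  assumes X: "has \<Gamma> X (U i)" and R: "has \<Gamma> R (X \<rightarrow> X \<rightarrow> U i)"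
    and x: "has \<Gamma> x X" "has \<Gamma> y X" "has \<Gamma> z X"
    and u: "inh \<Gamma> (clos_ty i X R x y)" and v: "inh \<Gamma> (clos_ty i X R y z)"
  shows "inh \<Gamma> (clos_ty i X R x z)"
proof (rule inh_obtain[OF u has_clos_ty[OF X R x(1,2)] has_uniform[OF has_clos_ty[OF X R x(1,3)]]])
  fix \<Delta> a assume d: "ext \<Gamma> \<Delta>" and a: "has \<Delta> a (clos_ty i X R x y)"
  note X' = has_mono[OF X d] and R' = has_mono[OF R d] and x' = x[THEN has_mono, OF d]
  show "inh \<Delta> (clos_ty i X R x z)"
  proof (rule inh_obtain[OF inh_mono[OF v d] has_clos_ty[OF X' R' x'(2,3)] has_uniform[OF
    has_clos_ty[OF X' R' x'(1,3)]]])
    fix \<Theta> b assume e: "ext \<Delta> \<Theta>" and b: "has \<Theta> b (clos_ty i X R y z)"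
    show "inh \<Theta> (clos_ty i X R x z)"
      by (rule has_inh[OF has_append[OF has_mono[OF X' e] has_mono[OF R' e] x'[THEN has_mono, OF e]
        has_mono[OF a e] b]])
  qed
qed

lemma inh_zig_sym:
  assumes X: "has \<Gamma> X (U i)" and R: "has \<Gamma> R (X \<rightarrow> X \<rightarrow> U i)"
    and x: "has \<Gamma> x X" "has \<Gamma> y X"
    and u: "inh \<Gamma> (zig i X R x y)"
  shows "inh \<Gamma> (zig i X R y x)"
proof (rule inh_obtain[OF u has_zig[OF X R x(1,2)] has_uniform[OF has_zig[OF X R x(2,1)]]])
  fix \<Delta> a assume d: "ext \<Gamma> \<Delta>" and a: "has \<Delta> a (zig i X R x y)"
  show "inh \<Delta> (zig i X R y x)"
    by (rule has_inh[OF has_zinv[OF has_mono[OF X d] has_mono[OF R d] x[THEN has_mono, OF d] a]])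
qed

text \<open>Embeds \<open>\<Rightarrow>\<^sup>*\<close> into
  \<open>\<Leftrightarrow>\<^sup>*\<close> by turning each step into a forward one. It is needed
  because inverses are cancelled by rewrite sequences, whereas all other laws are about zig-zags of
  rewrites.\<close>

lemma inh_zig_of_clos:
  assumes X: "has \<Gamma> X (U i)" and R: "has \<Gamma> R (X \<rightarrow> X \<rightarrow> U i)"
    and x: "has \<Gamma> x X" "has \<Gamma> y X"
    and u: "inh \<Gamma> (clos_ty i X R x y)"
  shows "inh \<Gamma> (zig i X R x y)"
proof (rule inh_obtain[OF u has_clos_ty[OF X R x(1,2)] has_uniform[OF has_zig[OF X R x(1,2)]]])
  fix \<Delta> a assume d: "ext \<Gamma> \<Delta>" and a: "has \<Delta> a (clos_ty i X R x y)"
  note XR = has_mono[OF X d] has_mono[OF R d]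
  show "inh \<Delta> (zig i X R x y)"
  proof (rule inh_clos_ind[OF XR, where M = "\<lambda>x y _. zig i X R x y" and j = i, OF _ _ _ _ x[THEN
    has_mono, OF d] a])
    show "family3 (length \<Delta>) (\<lambda>x y _. zig i X R x y)"
      using XR by - (assumption | rule uniformity related_zig_intros | erule climb)+
    fix \<Theta> x y assume e: "ext \<Delta> \<Theta>" and x: "has \<Theta> x X"
    note XR' = XR[THEN has_mono, OF e]
    show "inh \<Theta> (zig i X R x x)"
      by (rule has_inh[OF has_empty_zig[OF XR' x]])
    assume y: "has \<Theta> y X"
    show "has \<Theta> (zig i X R x y) (U i)" using has_zig[OF XR' x y] .
    fix z r assume z: "has \<Theta> z X" and r: "has \<Theta> r (R \<cdot> y \<cdot> z)" and u: "inh \<Theta> (zig i X R x y)"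
    show "inh \<Theta> (zig i X R x z)"
      by (rule inh_clos_trans[OF XR'(1) has_sym_closure[OF XR'] x y z, folded zig_def, OF u
        has_inh[OF has_forward[OF XR' y z r]]])
  qed
qed

text \<open>Leibniz equality takes the place of identity types, at the price of living one universe higher.\<close>

definition leibniz :: "nat \<Rightarrow> stm \<Rightarrow> stm \<Rightarrow> stm \<Rightarrow> stm" where
  "leibniz i X a b = (\<Pi> P:(X \<rightarrow> U i). P \<cdot> a \<rightarrow> P \<cdot> b)"

lemma related_leibniz:
  assumes t: "traversal \<phi> p q n" and "related \<phi> p q b X X'" "related \<phi> p q b x x'"
    "related \<phi> p q b y y'"
  shows "related \<phi> p q b (leibniz i X x y) (leibniz i X' x' y')"
  unfolding leibniz_def using assms assms(2-)[THEN related_weaken]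
  by - (assumption | rule related_intros)+

lemma has_leibniz:
  assumes X: "has \<Gamma> X (U i)" and x: "has \<Gamma> a X" "has \<Gamma> b X"
  shows "has \<Gamma> (leibniz i X a b) (U (Suc i))"
  unfolding leibniz_def using assms has_U'[OF X] has_cumul[OF X le_SucI[OF le_refl]]
  by - (assumption | rule has_pi has_arrow has_arrow_app[THEN has_cumul] le_SucI le_refl uniformity |
        erule climb)+

lemma jeq_arrow_app:
  assumes "has \<Gamma> P (A \<rightarrow> U j)" "jeq \<Gamma> a b A"
  shows "jeq \<Gamma> (P \<cdot> a) (P \<cdot> b) (U j)"
  by (rule jeq_app[OF jeq_reflI[OF assms(1)[unfolded arrow_def]] assms(2)])
    (rule uniformity | assumption)+

lemma inh_leibnizI:
  assumes X: "has \<Gamma> X (U i)" and a: "has \<Gamma> a X" and b: "has \<Gamma> b X"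
    and step: "\<And>\<Delta> P. ext \<Gamma> \<Delta> \<Longrightarrow> has \<Delta> P (X \<rightarrow> U i) \<Longrightarrow> inh \<Delta> (P \<cdot> a) \<Longrightarrow> inh \<Delta> (P \<cdot> b)"
  shows "inh \<Gamma> (leibniz i X a b)"
  unfolding leibniz_def
proof (rule inh_pi)
  show "has \<Gamma> (X \<rightarrow> U i) (U (Suc i))"
    by (rule has_arrow[OF has_cumul[OF X le_SucI[OF le_refl]] has_U'[OF X]])
  show "family (length \<Gamma>) (\<lambda>P. P \<cdot> a \<rightarrow> P \<cdot> b)"
    using a b by - (assumption | rule uniformity | erule climb)+
  fix \<Delta> P assume d: "ext \<Gamma> \<Delta>" and P: "has \<Delta> P (X \<rightarrow> U i)"
  show "inh \<Delta> (P \<cdot> a \<rightarrow> P \<cdot> b)"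
  proof (rule inh_arrow)
    show "has \<Delta> (P \<cdot> a) (U i)" "uniform (length \<Delta>) (P \<cdot> b)"
      using has_arrow_app[OF P has_mono[OF X d]] has_mono[OF a d] has_mono[OF b d] has_uniform by blast+
    show "inh \<Theta> (P \<cdot> b)" if "ext \<Delta> \<Theta>" "inh \<Theta> (P \<cdot> a)" for \<Theta>
      using step[OF ext_trans[OF d that(1)] has_mono[OF P that(1)] that(2)] .
  qed
qed

lemma inh_leibniz_subst:
  assumes X: "has \<Gamma> X (U i)" and x: "has \<Gamma> a X" "has \<Gamma> b X"
    and e: "inh \<Gamma> (leibniz i X a b)"
    and Q: "\<And>\<Delta> x. ext \<Gamma> \<Delta> \<Longrightarrow> has \<Delta> x X \<Longrightarrow> has \<Delta> (Q x) (U i)" and fQ: "family (length \<Gamma>) Q"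
    and q: "inh \<Gamma> (Q a)"
  shows "inh \<Gamma> (Q b)"
proof -
  note P = has_family[OF X Q fQ]
  note app = jeq_beta_type[OF X _ Q fQ]
  have "inh \<Gamma> (lam X Q \<cdot> a \<rightarrow> lam X Q \<cdot> b)"
    by (rule inh_app[OF e[unfolded leibniz_def] P]) (insert X x, (assumption | rule uniformity |
      erule climb)+)
  then have "inh \<Gamma> (lam X Q \<cdot> b)"
    by (rule inh_mp[OF _ inh_conv[OF q jeq_symI[OF app[OF x(1)]]] has_uniform[OF has_arrow_app[OF P
      X x(2)]]])
  then show ?thesis
    by (rule inh_conv[OF _ app[OF x(2)]])
qed

text \<open>\<open>append\<close> recurses on its second argument, so this unit law needs induction
  on \<open>u\<close>. It cannot be run with \<open>\<Leftrightarrow>\<^sup>*\<close> instead: the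
  step would need congruence in the left factor without a prefix, and removing that prefix is the
  very law being proved. Leibniz equality can be used below the last step directly.\<close>

lemma inh_append_left_unit:
  assumes X: "has \<Gamma> X (U i)" and R: "has \<Gamma> R (X \<rightarrow> X \<rightarrow> U i)"
    and x: "has \<Gamma> x X" "has \<Gamma> y X" "has \<Gamma> u (clos_ty i X R x y)"
  shows "inh \<Gamma> (leibniz i (clos_ty i X R x y) (append i X R x x y (clos_nil i X R x) u) u)"
proof (rule inh_clos_ind[OF X R, where j = "Suc i", OF _ _ _ _ x])
  let ?M = "\<lambda>x y u. leibniz i (clos_ty i X R x y) (append i X R x x y (clos_nil i X R x) u) u"
  show "family3 (length \<Gamma>) ?M"
    using X R by - (assumption | rule uniformity related_leibniz related_zig_intros | erule climb)+
  fix \<Delta> x y u assume d: "ext \<Gamma> \<Delta>" and x: "has \<Delta> x X"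
  note XR = has_mono[OF X d] has_mono[OF R d]
  note n = has_clos_nil[OF XR x]
  show "inh \<Delta> (?M x x (clos_nil i X R x))"
  proof (rule inh_leibnizI[OF has_clos_ty[OF XR x x] has_append[OF XR x x x n n] n])
    fix \<Theta> P assume e: "ext \<Delta> \<Theta>" and P: "has \<Theta> P (clos_ty i X R x x \<rightarrow> U i)"
      and p: "inh \<Theta> (P \<cdot> append i X R x x x (clos_nil i X R x) (clos_nil i X R x))"
    then show "inh \<Theta> (P \<cdot> clos_nil i X R x)"
      by (blast intro: inh_conv jeq_arrow_app jeq_mono[OF jeq_append_nil[OF XR x x n]])
  qed
  assume y: "has \<Delta> y X" and u: "has \<Delta> u (clos_ty i X R x y)"
  show "has \<Delta> (?M x y u) (U (Suc i))"
    by (rule has_leibniz[OF has_clos_ty[OF XR x y] has_append[OF XR x x y n u] u])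
  fix z r assume z: "has \<Delta> z X" and r: "has \<Delta> r (R \<cdot> y \<cdot> z)" and ih: "inh \<Delta> (?M x y u)"
  show "inh \<Delta> (?M x z (clos_snoc i X R x y z u r))"
  proof (rule inh_leibnizI[OF has_clos_ty[OF XR x z] has_append[OF XR x x z n] ]; (rule
    has_clos_snoc[OF XR x y z u r])?)
    fix \<Theta> P assume e: "ext \<Delta> \<Theta>" and P: "has \<Theta> P (clos_ty i X R x z \<rightarrow> U i)"
      and p: "inh \<Theta> (P \<cdot> append i X R x x z (clos_nil i X R x) (clos_snoc i X R x y z u r))"
    have p': "inh \<Theta> (P \<cdot> clos_snoc i X R x y z (append i X R x x y (clos_nil i X R x) u) r)"
      by (rule inh_conv[OF p jeq_arrow_app[OF P jeq_mono[OF jeq_append_snoc[OF XR x x y z n u r] e]]])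
    show "inh \<Theta> (P \<cdot> clos_snoc i X R x y z u r)"
      \<comment> \<open>The predicate \<open>Q\<close> puts a prefix back below the last step, so
        the induction hypothesis about the prefix applies to the whole sequence.\<close>
      by (rule inh_leibniz_subst[where Q = "\<lambda>t. P \<cdot> clos_snoc i X R x y z t r", OF _ _ _ inh_mono[OF
        ih e] _ _ p'])
        (insert XR x y z u r n P e, (assumption | rule has_clos_snoc has_clos_ty has_append
          has_arrow_app[where C = P] uniformity |
        erule climb)+)
  qed
qed

section \<open>Polygraphs in context\<close>

lemma related_rewrite_zig:
  assumes t: "traversal \<phi> p q n" and "related \<phi> p q b A A'" "related \<phi> p q b R R'"
    "related \<phi> p q b D D'"
    "related \<phi> p q b x x'" "related \<phi> p q b y y'" "related \<phi> p q b u u'" "related \<phi> p q b v v'"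
  shows "related \<phi> p q b (rewrite_zig i A R D x y u v) (rewrite_zig i A' R' D' x' y' u' v')"
  unfolding rewrite_zig_def using assms
  by - (assumption | rule related_intros related_zig_intros)+

text \<open>The data are terms and the hypotheses are merely inhabited in an arbitrary context
  \<open>\<Gamma>0\<close>; the closed theorem instantiates it with the context built from its bound
  variables and premises.\<close>

locale polygraph =
  fixes i :: nat and A R D G :: stm and \<Gamma>0 :: "tm list"
  assumes A: "has \<Gamma>0 A (U i)" and R: "has \<Gamma>0 R (A \<rightarrow> A \<rightarrow> U i)" and D: "has \<Gamma>0 D (rewrite_ty i A R)"
    and G: "has \<Gamma>0 G (A \<rightarrow> A \<rightarrow> U i)"
    and trans: "inh \<Gamma>0 (transitive A G)"
    and noeth: "inh \<Gamma>0 (noetherian i A G)"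
    and decr: "inh \<Gamma>0 (steps_decrease A R G)"
    and congr: "inh \<Gamma>0 (closed_under_congruence i A R D)"
    and canc_inv: "inh \<Gamma>0 (cancels_inverses i A R D)"
    and wb: "inh \<Gamma>0 (winkler_buchberger i A R D G)"
    and canc_empty: "inh \<Gamma>0 (cancels_empty_closed i A R D)"
begin

abbreviation "Z x y \<equiv> zig i A R x y"
abbreviation "cmp x y z u v \<equiv> zconcat i A R x y z u v"
abbreviation "eps x \<equiv> empty_zig i A R x"
abbreviation "rw x y u v \<equiv> rewrite_zig i A R D x y u v"
abbreviation "rvs x y u \<equiv> zinv i A R x y u"
abbreviation "S \<equiv> sym_closure i A R"
abbreviation "zstep x y \<equiv> sum_ty i (R \<cdot> x \<cdot> y) (R \<cdot> y \<cdot> x)"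
abbreviation "fwd x y s \<equiv> forward i A R x y s"
abbreviation "bwd x y s \<equiv> backward i A R x y s"
abbreviation "tail_below x a b w \<equiv> all_but_first i A S (\<lambda>z. G \<cdot> x \<cdot> z) a b w"
abbreviation "inner_below x a b w \<equiv> all_inner i A S (\<lambda>z. G \<cdot> x \<cdot> z) a b w"

definition obj :: "tm list \<Rightarrow> stm \<Rightarrow> bool" where
  "obj \<Gamma> x \<longleftrightarrow> ext \<Gamma>0 \<Gamma> \<and> has \<Gamma> x A"

definition arr :: "tm list \<Rightarrow> stm \<Rightarrow> stm \<Rightarrow> stm \<Rightarrow> bool" where
  "arr \<Gamma> x y u \<longleftrightarrow> obj \<Gamma> x \<and> obj \<Gamma> y \<and> has \<Gamma> u (Z x y)"

text \<open>The typing of both sides is part of the relation, so that chains of equations carry the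
  well-formedness which the next step asks for.\<close>

definition eqv :: "tm list \<Rightarrow> stm \<Rightarrow> stm \<Rightarrow> stm \<Rightarrow> stm \<Rightarrow> bool" where
  "eqv \<Gamma> x y u v \<longleftrightarrow> arr \<Gamma> x y u \<and> arr \<Gamma> x y v \<and> inh \<Gamma> (rw x y u v)"

lemma obj_mono: "obj \<Gamma> x \<Longrightarrow> ext \<Gamma> \<Delta> \<Longrightarrow> obj \<Delta> x"
  unfolding obj_def by (blast intro: ext_trans has_mono)

lemma arr_mono: "arr \<Gamma> x y u \<Longrightarrow> ext \<Gamma> \<Delta> \<Longrightarrow> arr \<Delta> x y u"
  unfolding arr_def by (blast intro: obj_mono has_mono)

lemma eqv_mono: "eqv \<Gamma> x y u v \<Longrightarrow> ext \<Gamma> \<Delta> \<Longrightarrow> eqv \<Delta> x y u v"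
  unfolding eqv_def by (blast intro: arr_mono inh_mono)

lemma base: "ext \<Gamma>0 \<Gamma> \<Longrightarrow> has \<Gamma> A (U i)" "ext \<Gamma>0 \<Gamma> \<Longrightarrow> has \<Gamma> R (A \<rightarrow> A \<rightarrow> U i)"
  "ext \<Gamma>0 \<Gamma> \<Longrightarrow> has \<Gamma> G (A \<rightarrow> A \<rightarrow> U i)" "ext \<Gamma>0 \<Gamma> \<Longrightarrow> has \<Gamma> D (rewrite_ty i A R)"
  "ext \<Gamma>0 \<Gamma> \<Longrightarrow> has \<Gamma> S (A \<rightarrow> A \<rightarrow> U i)"
  using A R G D has_sym_closure[OF A R] by (blast intro: has_mono)+

lemma objD: "obj \<Gamma> x \<Longrightarrow> ext \<Gamma>0 \<Gamma>" "obj \<Gamma> x \<Longrightarrow> has \<Gamma> x A"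
  by (auto simp: obj_def)

lemma arrD: "arr \<Gamma> x y u \<Longrightarrow> obj \<Gamma> x" "arr \<Gamma> x y u \<Longrightarrow> obj \<Gamma> y" "arr \<Gamma> x y u \<Longrightarrow> has \<Gamma> u (Z x y)"
  by (auto simp: arr_def)

lemma eqvD: "eqv \<Gamma> x y u v \<Longrightarrow> arr \<Gamma> x y u" "eqv \<Gamma> x y u v \<Longrightarrow> arr \<Gamma> x y v"
  "eqv \<Gamma> x y u v \<Longrightarrow> inh \<Gamma> (rw x y u v)"
  by (auto simp: eqv_def)

lemma has_Z: "obj \<Gamma> x \<Longrightarrow> obj \<Gamma> y \<Longrightarrow> has \<Gamma> (Z x y) (U i)"
  by (blast intro: has_zig base objD)

lemma arr_eps: "obj \<Gamma> x \<Longrightarrow> arr \<Gamma> x x (eps x)"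
  unfolding arr_def by (blast intro: has_empty_zig base objD)

lemma arr_cmp: "arr \<Gamma> x y u \<Longrightarrow> arr \<Gamma> y z v \<Longrightarrow> arr \<Gamma> x z (cmp x y z u v)"
  unfolding arr_def by (blast intro: has_zconcat base objD)

lemma arr_rvs: "arr \<Gamma> x y u \<Longrightarrow> arr \<Gamma> y x (rvs x y u)"
  unfolding arr_def by (blast intro: has_zinv base objD)

lemma arr_forward: "obj \<Gamma> x \<Longrightarrow> obj \<Gamma> y \<Longrightarrow> has \<Gamma> s (R \<cdot> x \<cdot> y) \<Longrightarrow> arr \<Gamma> x y (fwd x y s)"
  unfolding arr_def by (blast intro: has_forward base objD)

lemma arr_backward: "obj \<Gamma> x \<Longrightarrow> obj \<Gamma> y \<Longrightarrow> has \<Gamma> s (R \<cdot> y \<cdot> x) \<Longrightarrow> arr \<Gamma> x y (bwd x y s)"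
  unfolding arr_def by (blast intro: has_backward base objD)

lemma has_D:
  assumes "obj \<Gamma> x" "obj \<Gamma> y"
  shows "has \<Gamma> (D \<cdot> x \<cdot> y) (Z x y \<rightarrow> Z x y \<rightarrow> U i)"
  by (rule has_app[OF has_app[OF base(4)[OF objD(1)[OF assms(1)], unfolded rewrite_ty_def]
    objD(2)[OF assms(1)]] objD(2)[OF assms(2)]])
    (insert assms[THEN objD(2)] base[OF objD(1)[OF assms(1)]], (assumption | rule uniformity
      related_zig_intros | erule climb)+)

lemma has_rw:
  assumes "arr \<Gamma> x y u" "arr \<Gamma> x y v"
  shows "has \<Gamma> (rw x y u v) (U i)"
  unfolding rewrite_zig_def
  by (rule has_zig) (use assms in \<open>auto simp: arr_def has_Z has_D\<close>)

section \<open>Groupoid laws up to \<open>\<Leftrightarrow>\<^sup>*\<close>\<close>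

lemma eqv_refl:
  assumes "arr \<Gamma> x y u"
  shows "eqv \<Gamma> x y u u"
proof -
  have "inh \<Gamma> (rw x y u u)"
    unfolding rewrite_zig_def
    by (rule has_inh, rule has_empty_zig) (use assms in \<open>auto simp: arr_def has_Z has_D\<close>)
  then show ?thesis using assms by (simp add: eqv_def)
qed

lemma eqv_trans [trans]:
  assumes "eqv \<Gamma> x y u v" "eqv \<Gamma> x y v w"
  shows "eqv \<Gamma> x y u w"
proof -
  have o: "obj \<Gamma> x" "obj \<Gamma> y" using assms by (auto simp: eqv_def arr_def)
  have "inh \<Gamma> (rw x y u w)"
    unfolding rewrite_zig_def zig_def[of _ "Z x y"]
    by (rule inh_clos_trans[OF has_Z[OF o] has_sym_closure[OF has_Z[OF o] has_D[OF o]], where y = v])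
      (use assms in \<open>auto simp: eqv_def arr_def rewrite_zig_def zig_def[of _ "Z x y"]\<close>)
  then show ?thesis using assms by (simp add: eqv_def)
qed

lemma eqv_sym:
  assumes "eqv \<Gamma> x y u v"
  shows "eqv \<Gamma> x y v u"
proof -
  have o: "obj \<Gamma> x" "obj \<Gamma> y" using assms by (auto simp: eqv_def arr_def)
  have "inh \<Gamma> (rw x y v u)"
    unfolding rewrite_zig_def
    by (rule inh_zig_sym[OF has_Z[OF o] has_D[OF o]])
      (use assms in \<open>auto simp: eqv_def arr_def rewrite_zig_def\<close>)
  then show ?thesis using assms by (simp add: eqv_def)
qed

lemma jeq_rw:
  assumes "arr \<Gamma> x y u" "jeq \<Gamma> v v' (Z x y)"
  shows "jeq \<Gamma> (rw x y u v) (rw x y u v') (U i)"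
proof -
  have o: "obj \<Gamma> x" "obj \<Gamma> y" using assms by (auto simp: arr_def)
  note c = has_cst[OF has_ctx[OF has_Z[OF o]], of "KClos i", simplified const_ty.simps arrow_def]
  note * = has_Z[OF o] has_sym_closure[OF has_Z[OF o] has_D[OF o], unfolded arrow_def] arrD(3)[OF
    assms(1)]
  show ?thesis
    unfolding rewrite_zig_def zig_def[of _ "Z x y"] clos_ty_def[of _ "Z x y"]
    by (rule jeq_app[OF jeq_reflI[OF has_app[OF has_app[OF has_app[OF c *(1)] *(2)] *(3)]] assms(2)])
      (insert *, (assumption | rule uniformity | erule climb)+)
qed

lemma eqv_jeq:
  assumes "arr \<Gamma> x y u" "arr \<Gamma> x y v" "jeq \<Gamma> u v (Z x y)"
  shows "eqv \<Gamma> x y u v"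
  using assms inh_conv[OF eqvD(3)[OF eqv_refl[OF assms(1)]] jeq_rw[OF assms(1,3)]] by (simp add:
    eqv_def)

lemma eqv_cmp_eps:
  assumes "arr \<Gamma> x y u"
  shows "eqv \<Gamma> x y (cmp x y y u (eps y)) u"
proof (rule eqv_jeq)
  show "arr \<Gamma> x y (cmp x y y u (eps y))" using arr_cmp[OF assms arr_eps[OF arrD(2)[OF assms]]] .
  show "jeq \<Gamma> (cmp x y y u (eps y)) u (Z x y)"
    unfolding zconcat_def zig_def empty_zig_def
    by (rule jeq_append_nil) (use assms base in \<open>auto simp: arr_def obj_def zig_def\<close>)
qed (rule assms)

lemma eqv_whisker:
  assumes w: "eqv \<Gamma> y y' w w'" and u: "arr \<Gamma> x y u" and v: "arr \<Gamma> y' z v"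
  shows "eqv \<Gamma> x z (cmp x y' z (cmp x y y' u w) v) (cmp x y' z (cmp x y y' u w') v)"
proof -
  have e: "ext \<Gamma>0 \<Gamma>" by (rule objD[OF arrD(1)[OF u]])
  note b = base[OF e] and o = objD(2)[OF arrD(1)[OF u]] objD(2)[OF arrD(2)[OF u]]
    objD(2)[OF arrD(2)[OF eqvD(1)[OF w]]] objD(2)[OF arrD(2)[OF v]]
    arrD(3)[OF u] arrD(3)[OF eqvD(1)[OF w]] arrD(3)[OF eqvD(2)[OF w]] arrD(3)[OF v]
  note a = inh_app[OF inh_app[OF inh_app[OF inh_app[OF inh_app[OF inh_app[OF inh_app[OF inh_app[OF
      inh_mono[OF congr e, unfolded closed_under_congruence_def] o(1)] o(2)] o(3)] o(4)] o(5)] o(6)]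
        o(7)] o(8)]
  have "inh \<Gamma> (rw y y' w w' \<rightarrow> rw x z (cmp x y' z (cmp x y y' u w) v) (cmp x y' z (cmp x y y' u w') v))"
    by (rule a) (insert b o, (assumption | rule uniformity related_zig_intros related_rewrite_zig |
      erule climb)+)
  moreover have arr: "arr \<Gamma> x z (cmp x y' z (cmp x y y' u w) v)" "arr \<Gamma> x z (cmp x y' z (cmp x y y'
    u w') v)"
    by (intro arr_cmp u v eqvD[OF w])+
  ultimately have "inh \<Gamma> (rw x z (cmp x y' z (cmp x y y' u w) v) (cmp x y' z (cmp x y y' u w') v))"
    by (rule inh_mp[OF _ eqvD(3)[OF w] has_uniform[OF has_rw]])
  then show ?thesis using arr by (simp add: eqv_def)
qed

text \<open>With the empty zig-zag as outer right factor, the two-sided congruence loses that factor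
  by the judgmental right unit law.\<close>

lemma eqv_cmp_right:
  assumes u: "arr \<Gamma> x y u" and v: "eqv \<Gamma> y z v v'"
  shows "eqv \<Gamma> x z (cmp x y z u v) (cmp x y z u v')"
proof -
  have "arr \<Gamma> z z (eps z)" by (intro arr_eps arrD(2)[OF eqvD(1)[OF v]])
  note w = eqv_whisker[OF v u this]
  have "eqv \<Gamma> x z (cmp x y z u v) (cmp x z z (cmp x y z u v) (eps z))"
    by (intro eqv_sym[OF eqv_cmp_eps] arr_cmp u eqvD[OF v])
  also note w
  also have "eqv \<Gamma> x z (cmp x z z (cmp x y z u v') (eps z)) (cmp x y z u v')"
    by (intro eqv_cmp_eps arr_cmp u eqvD[OF v])
  finally show ?thesis .
qed

text \<open>Obtained by substituting along Leibniz equality inside the composite, hence without any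
  congruence in the left factor. It removes the empty prefix that \<open>eqv_whisker\<close> leaves
  behind.\<close>

lemma eqv_cmp_eps_left:
  assumes u: "arr \<Gamma> x y u" and v: "arr \<Gamma> y z v"
  shows "eqv \<Gamma> x z (cmp x y z (cmp x x y (eps x) u) v) (cmp x y z u v)"
proof -
  let ?e = "cmp x x y (eps x) u"
  let ?c = "cmp x y z ?e v"
  have e: "arr \<Gamma> x y ?e" and c: "arr \<Gamma> x z ?c" by (intro arr_cmp arr_eps u v arrD(1)[OF u])+
  have ext: "ext \<Gamma>0 \<Gamma>" by (rule objD[OF arrD(1)[OF u]])
  note b = base[OF ext]
  have l: "inh \<Gamma> (leibniz i (Z x y) ?e u)"
    using inh_append_left_unit[OF b(1,5)] u unfolding arr_def obj_def zig_def zconcat_def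
      empty_zig_def by blast
  have "inh \<Gamma> (rw x z ?c (cmp x y z u v))"
  proof (rule inh_leibniz_subst[where Q = "\<lambda>t. rw x z ?c (cmp x y z t v)", OF _ _ _ l])
    show "inh \<Gamma> (rw x z ?c ?c)" using eqvD(3)[OF eqv_refl[OF c]] .
    show "family (length \<Gamma>) (\<lambda>t. rw x z ?c (cmp x y z t v))"
      using b arrD(3)[OF u] arrD(3)[OF v] objD(2)[OF arrD(1)[OF u]] objD(2)[OF arrD(2)[OF u]]
        objD(2)[OF arrD(2)[OF v]]
      by - (assumption | rule uniformity related_rewrite_zig related_zig_intros | erule climb)+
    fix \<Delta> t assume d: "ext \<Gamma> \<Delta>" "has \<Delta> t (Z x y)"
    then have "arr \<Delta> x y t" using arrD(1,2)[OF arr_mono[OF u d(1)]] by (simp add: arr_def)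
    then show "has \<Delta> (rw x z ?c (cmp x y z t v)) (U i)"
      by (intro has_rw arr_cmp arr_mono[OF v d(1)] arr_mono[OF c d(1)])
  qed (use u e in \<open>auto simp: arr_def has_Z\<close>)
  then show ?thesis using c arr_cmp[OF u v] by (simp add: eqv_def)
qed

lemma eqv_eps_cmp:
  assumes u: "arr \<Gamma> x y u"
  shows "eqv \<Gamma> x y (cmp x x y (eps x) u) u"
proof -
  have o: "arr \<Gamma> y y (eps y)" "arr \<Gamma> x y (cmp x x y (eps x) u)" by (intro arr_eps arr_cmp u arrD[OF u])+
  show ?thesis
    using eqv_trans[OF eqv_trans[OF eqv_sym[OF eqv_cmp_eps[OF o(2)]] eqv_cmp_eps_left[OF u o(1)]]
      eqv_cmp_eps[OF u]] .
qed

text \<open>The left factor is changed behind an empty prefix, which \<open>eqv_cmp_eps_left\<close>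
  inserts before and deletes after; the right factor needs no such detour.\<close>

lemma eqv_cmp:
  assumes u: "eqv \<Gamma> x y u u'" and v: "eqv \<Gamma> y z v v'"
  shows "eqv \<Gamma> x z (cmp x y z u v) (cmp x y z u' v')"
proof -
  have o: "arr \<Gamma> x x (eps x)" by (intro arr_eps arrD(1)[OF eqvD(1)[OF u]])
  note a = eqvD(1,2)[OF u] eqvD(1,2)[OF v]
  have "eqv \<Gamma> x z (cmp x y z u v) (cmp x y z (cmp x x y (eps x) u) v)"
    using eqv_sym[OF eqv_cmp_eps_left[OF a(1,3)]] .
  also have "eqv \<Gamma> x z \<dots> (cmp x y z (cmp x x y (eps x) u') v)"
    by (rule eqv_whisker[OF u o a(3)])
  also have "eqv \<Gamma> x z \<dots> (cmp x y z u' v)"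
    by (rule eqv_cmp_eps_left[OF a(2,3)])
  also have "eqv \<Gamma> x z \<dots> (cmp x y z u' v')"
    by (rule eqv_cmp_right[OF a(2) v])
  finally show ?thesis .
qed

lemma has_step:
  assumes "obj \<Gamma> x" "obj \<Gamma> y"
  shows "has \<Gamma> (R \<cdot> x \<cdot> y) (U i)"
  using assms by (auto simp: obj_def intro!: has_rel base)

lemma arr_single:
  assumes "obj \<Gamma> x" "obj \<Gamma> y" "has \<Gamma> r (zstep x y)"
  shows "arr \<Gamma> x y (single i A R x y r)"
  using assms by (auto simp: arr_def obj_def intro!: has_single base)

definition zsnoc :: "stm \<Rightarrow> stm \<Rightarrow> stm \<Rightarrow> stm \<Rightarrow> stm \<Rightarrow> stm" where
  "zsnoc x y z u r = clos_snoc i A S x y z u r"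

lemma has_sym_step:
  assumes "obj \<Gamma> x" "obj \<Gamma> y" "has \<Gamma> r (zstep x y)"
  shows "has \<Gamma> r (S \<cdot> x \<cdot> y)"
  by (rule has_conv[OF assms(3) jeq_symI[OF jeq_sym_closure]]) (use assms in \<open>auto simp: obj_def base\<close>)

lemma arr_zsnoc:
  assumes u: "arr \<Gamma> x y u" and z: "obj \<Gamma> z" and r: "has \<Gamma> r (zstep y z)"
  shows "arr \<Gamma> x z (zsnoc x y z u r)"
  using u z has_sym_step[OF arrD(2)[OF u] z r]
  unfolding arr_def obj_def zsnoc_def zig_def by (auto intro!: has_clos_snoc base)

lemma eqv_zsnoc:
  assumes u: "arr \<Gamma> x y u" and z: "obj \<Gamma> z" and r: "has \<Gamma> r (zstep y z)"
  shows "eqv \<Gamma> x z (zsnoc x y z u r) (cmp x y z u (single i A R y z r))"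
proof (rule eqv_sym[OF eqv_jeq])
  show "arr \<Gamma> x z (cmp x y z u (single i A R y z r))"
    by (intro arr_cmp[OF u] arr_single arrD(2)[OF u] z r)
  show "jeq \<Gamma> (cmp x y z u (single i A R y z r)) (zsnoc x y z u r) (Z x z)"
    unfolding zconcat_def zsnoc_def single_def zig_def
    by (rule jeq_append_single)
      (use u z has_sym_step[OF arrD(2)[OF u] z r] in \<open>auto simp: arr_def obj_def base zig_def\<close>)
qed (rule arr_zsnoc[OF u z r])

lemma zig_induct:
  assumes M: "\<And>\<Delta> x y u. ext \<Gamma> \<Delta> \<Longrightarrow> arr \<Delta> x y u \<Longrightarrow> has \<Delta> (M x y u) (U i)"
    and fM: "family3 (length \<Gamma>) M"
    and n: "\<And>\<Delta> x. ext \<Gamma> \<Delta> \<Longrightarrow> obj \<Delta> x \<Longrightarrow> inh \<Delta> (M x x (eps x))"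
    and s: "\<And>\<Delta> x y z u r. ext \<Gamma> \<Delta> \<Longrightarrow> arr \<Delta> x y u \<Longrightarrow> obj \<Delta> z \<Longrightarrow>
      has \<Delta> r (zstep y z) \<Longrightarrow> inh \<Delta> (M x y u) \<Longrightarrow> inh \<Delta> (M x z (zsnoc x y z u r))"
    and u: "arr \<Gamma> x y u"
  shows "inh \<Gamma> (M x y u)"
proof -
  have e: "ext \<Gamma>0 \<Gamma>" by (rule objD[OF arrD(1)[OF u]])
  have o: "obj \<Delta> x" if "ext \<Gamma> \<Delta>" "has \<Delta> x A" for \<Delta> x
    using ext_trans[OF e that(1)] that(2) by (simp add: obj_def)
  show ?thesis
  proof (rule inh_clos_ind[OF base(1)[OF e] base(5)[OF e] M fM])
    show "ext \<Gamma> \<Delta> \<Longrightarrow> ext \<Gamma> \<Delta>" for \<Delta> .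
    show "arr \<Delta> x y u" if "ext \<Gamma> \<Delta>" "has \<Delta> x A" "has \<Delta> y A" "has \<Delta> u (clos_ty i A S x y)" for \<Delta> x y u
      using that o by (simp add: arr_def zig_def)
    show "inh \<Delta> (M x x (clos_nil i A S x))" if "ext \<Gamma> \<Delta>" "has \<Delta> x A" for \<Delta> x
      using n that o by (simp add: empty_zig_def)
    show "inh \<Delta> (M x z (clos_snoc i A S x y z u r))" if "ext \<Gamma> \<Delta>" "has \<Delta> x A" "has \<Delta> y A" "has \<Delta> z A"
      "has \<Delta> u (clos_ty i A S x y)" "has \<Delta> r (S \<cdot> y \<cdot> z)" "inh \<Delta> (M x y u)" for \<Delta> x y z u r
    proof (rule s[unfolded zsnoc_def, OF that(1) _ _ _ that(7)])
      show "arr \<Delta> x y u" "obj \<Delta> z" using that o by (simp_all add: arr_def zig_def)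
      show "has \<Delta> r (zstep y z)"
        by (rule has_conv[OF that(6) jeq_sym_closure]) (use that o in \<open>auto simp: obj_def base\<close>)
    qed
  qed (use u in \<open>auto simp: arr_def obj_def zig_def\<close>)
qed

lemma eqv_cmp_zsnoc:
  assumes u: "arr \<Gamma> x y u" and v: "arr \<Gamma> y z v" and c: "obj \<Gamma> c"
    and r: "has \<Gamma> r (zstep z c)"
  shows "eqv \<Gamma> x c (cmp x y c u (zsnoc y z c v r)) (zsnoc x z c (cmp x y z u v) r)"
proof (rule eqv_jeq)
  show "arr \<Gamma> x c (cmp x y c u (zsnoc y z c v r))" "arr \<Gamma> x c (zsnoc x z c (cmp x y z u v) r)"
    by (intro arr_cmp arr_zsnoc u v c r)+
  show "jeq \<Gamma> (cmp x y c u (zsnoc y z c v r)) (zsnoc x z c (cmp x y z u v) r) (Z x c)"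
    unfolding zconcat_def zsnoc_def zig_def
    by (rule jeq_append_snoc)
      (use u v c has_sym_step[OF arrD(2)[OF v] c r] in \<open>auto simp: arr_def obj_def base zig_def\<close>)
qed

text \<open>Both bracketings compute on \<open>w\<close>, hence induction on \<open>w\<close>. Its
  source varies in the motive, so \<open>v\<close>, which ends there, is quantified inside;
  \<open>u\<close> stays fixed.\<close>

lemma eqv_assoc:
  assumes u: "arr \<Gamma> x y u" and v: "arr \<Gamma> y z v" and w: "arr \<Gamma> z z' w"
  shows "eqv \<Gamma> x z' (cmp x z z' (cmp x y z u v) w) (cmp x y z' u (cmp y z z' v w))"
proof -
  let ?T = "\<lambda>a b w v. rw x b (cmp x a b (cmp x y a u v) w) (cmp x y b u (cmp y a b v w))"
  let ?M = "\<lambda>a b w. \<Pi> v:Z y a. ?T a b w v"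
  have e: "ext \<Gamma>0 \<Gamma>" by (rule objD[OF arrD(1)[OF u]])
  note facts = base[OF e] arrD(3)[OF u] objD(2)[OF arrD(1)[OF u]] objD(2)[OF arrD(2)[OF u]]
  have T: "has \<Delta> (?T a b w v) (U i)" if "ext \<Gamma> \<Delta>" "arr \<Delta> a b w" "arr \<Delta> y a v" for \<Delta> a b w v
    by (intro has_rw arr_cmp arr_mono[OF u that(1)] that)
  have fam: "family (length \<Delta>) (?T a b w)" if d: "ext \<Gamma> \<Delta>" and w: "arr \<Delta> a b w" for \<Delta> a b w
    using facts d arrD(3)[OF w] objD(2)[OF arrD(1)[OF w]] objD(2)[OF arrD(2)[OF w]]
    by - (assumption | rule uniformity related_rewrite_zig related_zig_intros | erule climb)+
  have "inh \<Gamma> (?M z z' w)"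
  proof (rule zig_induct[where M = ?M, OF _ _ _ _ w])
    show "family3 (length \<Gamma>) ?M"
      using facts by - (assumption | rule uniformity related_rewrite_zig related_zig_intros | erule
        climb)+
    fix \<Delta> a assume d: "ext \<Gamma> \<Delta>"
    note u' = arr_mono[OF u d]
    {
      fix b w assume w: "arr \<Delta> a b w"
      show "has \<Delta> (?M a b w) (U i)"
      proof (rule has_pi[OF has_Z[OF arrD(2)[OF u'] arrD(1)[OF w]] _ fam[OF d w]])
        fix \<Theta> v assume d': "ext \<Delta> \<Theta>" and v: "has \<Theta> v (Z y a)"
        have "arr \<Theta> y a v"
          using arrD(2)[OF arr_mono[OF u' d']] arrD(1)[OF arr_mono[OF w d']] v by (simp add: arr_def)
        then show "has \<Theta> (?T a b w v) (U i)"
          by (rule T[OF ext_trans[OF d d'] arr_mono[OF w d']])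
      qed
    }
    {
      assume a: "obj \<Delta> a"
      show "inh \<Delta> (?M a a (eps a))"
      proof (rule inh_pi[OF has_Z[OF arrD(2)[OF u'] a] fam[OF d arr_eps[OF a]]])
        fix \<Theta> v assume d': "ext \<Delta> \<Theta>" and v: "has \<Theta> v (Z y a)"
        have v: "arr \<Theta> y a v" using arrD(2)[OF arr_mono[OF u' d']] obj_mono[OF a d'] v by (simp add:
          arr_def)
        note u'' = arr_mono[OF u' d']
        have "eqv \<Theta> x a (cmp x a a (cmp x y a u v) (eps a)) (cmp x y a u v)"
          by (intro eqv_cmp_eps arr_cmp u'' v)
        also have "eqv \<Theta> x a \<dots> (cmp x y a u (cmp y a a v (eps a)))"
          by (intro eqv_cmp_right u'' eqv_sym[OF eqv_cmp_eps] v)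
        finally show "inh \<Theta> (?T a a (eps a) v)" by (rule eqvD)
      qed
    }
    fix b c w r assume w: "arr \<Delta> a b w" and c: "obj \<Delta> c" and r: "has \<Delta> r (zstep b c)"
      and ih: "inh \<Delta> (?M a b w)"
    show "inh \<Delta> (?M a c (zsnoc a b c w r))"
    proof (rule inh_pi[OF has_Z[OF arrD(2)[OF u'] arrD(1)[OF w]] fam[OF d arr_zsnoc[OF w c r]]])
      fix \<Theta> v assume d': "ext \<Delta> \<Theta>" and v: "has \<Theta> v (Z y a)"
      note u'' = arr_mono[OF u' d'] and w' = arr_mono[OF w d'] and c' = obj_mono[OF c d'] and r' =
        has_mono[OF r d']
      have v': "arr \<Theta> y a v" using arrD(2)[OF u''] arrD(1)[OF w'] v by (simp add: arr_def)
      let ?r = "single i A R b c r"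
      have s: "arr \<Theta> b c ?r" by (intro arr_single arrD(2)[OF w'] c' r')
      have ih': "eqv \<Theta> x b (cmp x a b (cmp x y a u v) w) (cmp x y b u (cmp y a b v w))"
        unfolding eqv_def
        by (intro conjI arr_cmp u'' v' w' inh_app[OF inh_mono[OF ih d'] v fam[OF ext_trans[OF d d']
          w']])
      have "eqv \<Theta> x c (cmp x a c (cmp x y a u v) (zsnoc a b c w r)) (zsnoc x b c (cmp x a b (cmp x y
        a u v) w) r)"
        by (intro eqv_cmp_zsnoc arr_cmp u'' v' w' c' r')
      also have "eqv \<Theta> x c \<dots> (cmp x b c (cmp x a b (cmp x y a u v) w) ?r)"
        by (intro eqv_zsnoc arr_cmp u'' v' w' c' r')
      also have "eqv \<Theta> x c \<dots> (cmp x b c (cmp x y b u (cmp y a b v w)) ?r)"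
        by (rule eqv_cmp[OF ih' eqv_refl[OF s]])
      also have "eqv \<Theta> x c \<dots> (zsnoc x b c (cmp x y b u (cmp y a b v w)) r)"
        by (intro eqv_sym[OF eqv_zsnoc] arr_cmp u'' v' w' c' r')
      also have "eqv \<Theta> x c \<dots> (cmp x y c u (zsnoc y b c (cmp y a b v w) r))"
        by (intro eqv_sym[OF eqv_cmp_zsnoc] arr_cmp u'' v' w' c' r')
      also have "eqv \<Theta> x c \<dots> (cmp x y c u (cmp y a c v (zsnoc a b c w r)))"
        by (intro eqv_cmp_right u'' eqv_sym[OF eqv_cmp_zsnoc] v' w' c' r')
      finally show "inh \<Theta> (?T a c (zsnoc a b c w r) v)" by (rule eqvD)
    qed
  qed
  note * = inh_app[OF this arrD(3)[OF v] fam[OF ext_refl[OF has_ctx[OF arrD(3)[OF u]]] w]]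
  show ?thesis
    unfolding eqv_def by (intro conjI arr_cmp u v w *)
qed

lemma eqv_cmp_rvs:
  assumes u: "arr \<Gamma> x y u"
  shows "eqv \<Gamma> x x (cmp x y x u (rvs x y u)) (eps x)"
proof -
  have e: "ext \<Gamma>0 \<Gamma>" by (rule objD[OF arrD(1)[OF u]])
  note o = arrD(1)[OF u] arrD(2)[OF u]
  note a = inh_app[OF inh_app[OF inh_app[OF inh_mono[OF canc_inv e, unfolded cancels_inverses_def
    rewrite_seq_def]
      objD(2)[OF o(1)]] objD(2)[OF o(2)]] arrD(3)[OF u]]
  have "inh \<Gamma> (clos_ty i (Z x x) (D \<cdot> x \<cdot> x) (cmp x y x u (rvs x y u)) (eps x))"
    by (rule a) (insert base[OF e] o[THEN objD(2)] arrD(3)[OF u], (assumption | rule uniformity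
      related_zig_intros | erule climb)+)
  moreover have arr: "arr \<Gamma> x x (cmp x y x u (rvs x y u))" "arr \<Gamma> x x (eps x)"
    by (intro arr_cmp arr_rvs arr_eps u o)+
  ultimately have "inh \<Gamma> (rw x x (cmp x y x u (rvs x y u)) (eps x))"
    unfolding rewrite_zig_def
    by (intro inh_zig_of_clos[OF has_Z[OF o(1,1)] has_D[OF o(1,1)]] arrD(3))
  then show ?thesis using arr by (simp add: eqv_def)
qed

text \<open>Composing with the reversal of \<open>w\<close> on the right needs only that
  \<open>w\<close> followed by its reversal is trivial, the order which
  \<open>cancels_inverses\<close> provides.\<close>

lemma eqv_cancel_right:
  assumes u: "arr \<Gamma> x y u" and v: "arr \<Gamma> x y v" and w: "arr \<Gamma> y z w"
    and e: "eqv \<Gamma> x z (cmp x y z u w) (cmp x y z v w)"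
  shows "eqv \<Gamma> x y u v"
proof -
  let ?w = "rvs y z w"
  have w': "arr \<Gamma> z y ?w" by (intro arr_rvs w)
  have *: "eqv \<Gamma> x y t (cmp x z y (cmp x y z t w) ?w)" if t: "arr \<Gamma> x y t" for t
    using eqv_trans[OF eqv_trans[OF eqv_sym[OF eqv_cmp_eps[OF t]] eqv_cmp_right[OF t eqv_sym[OF
      eqv_cmp_rvs[OF w]]]]
        eqv_sym[OF eqv_assoc[OF t w w']]] .
  show ?thesis
    using eqv_trans[OF eqv_trans[OF *[OF u] eqv_cmp[OF e eqv_refl[OF w']]] eqv_sym[OF *[OF v]]] .
qed

text \<open>The cancellation law puts the reversal second. Since reversing a backward step gives the
  forward step judgmentally, the law is applied to \<open>bwd y x s\<close>.\<close>

lemma eqv_backward_forward: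
  assumes x: "obj \<Gamma> x" and y: "obj \<Gamma> y" and s: "has \<Gamma> s (R \<cdot> x \<cdot> y)"
  shows "eqv \<Gamma> y y (cmp y x y (bwd y x s) (fwd x y s)) (eps y)"
proof -
  have b: "arr \<Gamma> y x (bwd y x s)" by (intro arr_backward x y s)
  have "eqv \<Gamma> x y (fwd x y s) (rvs y x (bwd y x s))"
    by (rule eqv_sym[OF eqv_jeq[OF arr_rvs[OF b] arr_forward[OF x y s]]], rule jeq_zinv_backward)
      (use x y s in \<open>auto simp: obj_def base\<close>)
  then show ?thesis
    using eqv_trans[OF eqv_cmp_right[OF b] eqv_cmp_rvs[OF b]] by blast
qed

end

section \<open>Descending paths\<close>

context polygraph
begin

lemma related_base:
  assumes "traversal \<phi> p q (length \<Gamma>0)"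
  shows "related \<phi> p q b A A" "related \<phi> p q b R R" "related \<phi> p q b D D" "related \<phi> p q b G G"
  using related_has[OF assms] A R D G by blast+

lemma related_Z:
  assumes "traversal \<phi> p q (length \<Gamma>0)"
  shows "related \<phi> p q b x x' \<Longrightarrow> related \<phi> p q b y y' \<Longrightarrow> related \<phi> p q b (Z x y) (Z x' y')"
    and "related \<phi> p q b x x' \<Longrightarrow> related \<phi> p q b (eps x) (eps x')"
    and "related \<phi> p q b x x' \<Longrightarrow> related \<phi> p q b y y' \<Longrightarrow> related \<phi> p q b z z' \<Longrightarrow>
      related \<phi> p q b u u' \<Longrightarrow> related \<phi> p q b v v' \<Longrightarrow> related \<phi> p q b (cmp x y z u v) (cmp x' y' z' u'
        v')"
    and "related \<phi> p q b x x' \<Longrightarrow> related \<phi> p q b y y' \<Longrightarrow> related \<phi> p q b r r' \<Longrightarrow>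
      related \<phi> p q b (fwd x y r) (fwd x' y' r')"
    and "related \<phi> p q b x x' \<Longrightarrow> related \<phi> p q b y y' \<Longrightarrow> related \<phi> p q b u u' \<Longrightarrow> related \<phi> p q b v v' \<Longrightarrow>
      related \<phi> p q b (rw x y u v) (rw x' y' u' v')"
    and "related \<phi> p q b x x' \<Longrightarrow> related \<phi> p q b y y' \<Longrightarrow> related \<phi> p q b z z' \<Longrightarrow>
      related \<phi> p q b u u' \<Longrightarrow> related \<phi> p q b r r' \<Longrightarrow> related \<phi> p q b (zsnoc x y z u r) (zsnoc x' y'
        z' u' r')"
  using assms related_base[OF assms] unfolding zsnoc_def
  by - (assumption | rule related_intros related_zig_intros related_rewrite_zig)+

definition opp :: stm where
  "opp = (\<Lambda> a:A. \<Lambda> b:A. R \<cdot> b \<cdot> a)"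

lemma has_opp: "ext \<Gamma>0 \<Gamma> \<Longrightarrow> has \<Gamma> opp (A \<rightarrow> A \<rightarrow> U i)"
  unfolding opp_def
  by (rule has_binary_relation[OF base(1)])
   (insert base[of \<Gamma>], (assumption | rule has_rel[where R = R] base uniformity | erule climb)+)

lemma jeq_opp:
  assumes "obj \<Gamma> x" "obj \<Gamma> y"
  shows "jeq \<Gamma> (opp \<cdot> x \<cdot> y) (R \<cdot> y \<cdot> x) (U i)"
  unfolding opp_def
  by (rule jeq_binary_relation[OF base(1)[OF objD(1)[OF assms(1)]]])
   (insert assms[THEN objD(2)] base[OF objD(1)[OF assms(1)]], (assumption | rule has_rel[where R =
     R] uniformity | erule climb)+)

text \<open>Reversing the relation makes the inductive family of sequences grow at the source.\<close>

definition down :: "stm \<Rightarrow> stm \<Rightarrow> stm" where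
  "down x z = clos_ty i A opp z x"

definition dnil :: "stm \<Rightarrow> stm" where
  "dnil x = clos_nil i A opp x"

definition dcons :: "stm \<Rightarrow> stm \<Rightarrow> stm \<Rightarrow> stm \<Rightarrow> stm \<Rightarrow> stm" where
  "dcons x y z s p = clos_snoc i A opp z y x p s"

text \<open>The recursion has the target as its first index and the source as its second, because
  \<open>down x z\<close> is a sequence of reversed steps from \<open>z\<close> to \<open>x\<close>;
  each new step is put in front of the zig-zag.\<close>

definition path :: "stm \<Rightarrow> stm \<Rightarrow> stm \<Rightarrow> stm" where
  "path x z p = clos_rec i i A opp (\<lambda>z x _. Z x z) eps (\<lambda>z y x _ s h. cmp x y z (fwd x y s) h) z x p"

definition dn :: "tm list \<Rightarrow> stm \<Rightarrow> stm \<Rightarrow> stm \<Rightarrow> bool" where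
  "dn \<Gamma> x z p \<longleftrightarrow> obj \<Gamma> x \<and> obj \<Gamma> z \<and> has \<Gamma> p (down x z)"

lemma related_opp: "traversal \<phi> p q (length \<Gamma>0) \<Longrightarrow> related \<phi> p q b opp opp"
  by (rule related_has[OF _ has_opp[OF ext_refl[OF has_ctx[OF A]]]])

lemma related_down:
  assumes "traversal \<phi> p q (length \<Gamma>0)"
  shows "related \<phi> p q b x x' \<Longrightarrow> related \<phi> p q b y y' \<Longrightarrow> related \<phi> p q b (down x y) (down x' y')"
    and "related \<phi> p q b x x' \<Longrightarrow> related \<phi> p q b (dnil x) (dnil x')"
    and "related \<phi> p q b x x' \<Longrightarrow> related \<phi> p q b y y' \<Longrightarrow> related \<phi> p q b z z' \<Longrightarrow>
      related \<phi> p q b s s' \<Longrightarrow> related \<phi> p q b u u' \<Longrightarrow> related \<phi> p q b (dcons x y z s u) (dcons x' y'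
        z' s' u')"
    and "related \<phi> p q b x x' \<Longrightarrow> related \<phi> p q b y y' \<Longrightarrow> related \<phi> p q b u u' \<Longrightarrow>
      related \<phi> p q b (path x y u) (path x' y' u')"
  using assms related_base[OF assms] related_opp[OF assms]
  unfolding down_def dnil_def dcons_def path_def clos_rec_def motive_def
  by - (assumption | rule related_intros related_Z | erule related_weaken)+

lemma path_step:
  assumes "ext \<Gamma>0 \<Gamma>" "has \<Gamma> x A" "has \<Gamma> y A" "has \<Gamma> z A" "has \<Gamma> s (opp \<cdot> y \<cdot> x)" "has \<Gamma> h (Z y z)"
  shows "has \<Gamma> (cmp x y z (fwd x y s) h) (Z x z)"
proof -
  have o: "obj \<Gamma> x" "obj \<Gamma> y" "obj \<Gamma> z" using assms by (simp_all add: obj_def)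
  have "has \<Gamma> s (R \<cdot> x \<cdot> y)" by (rule has_conv[OF assms(5) jeq_opp[OF o(2,1)]])
  moreover have "arr \<Gamma> y z h" using o assms by (simp add: arr_def)
  ultimately show ?thesis using o by (intro arrD(3)[OF arr_cmp] arr_forward)
qed

lemma path_recursor:
  assumes "ext \<Gamma>0 \<Gamma>"
  shows "recursor \<Gamma> i i A opp (\<lambda>z x _. Z x z) eps (\<lambda>z y x _ s h. cmp x y z (fwd x y s) h)"
  using assms base[OF assms] has_opp[OF assms]
  by unfold_locales (assumption | rule path_step has_zig has_empty_zig uniformity related_Z | erule
    climb)+

lemma objI: "ext \<Gamma>0 \<Gamma> \<Longrightarrow> has \<Gamma> x A \<Longrightarrow> obj \<Gamma> x"
  by (simp add: obj_def)

lemma dnD: "dn \<Gamma> x z p \<Longrightarrow> obj \<Gamma> x" "dn \<Gamma> x z p \<Longrightarrow> obj \<Gamma> z" "dn \<Gamma> x z p \<Longrightarrow> has \<Gamma> p (down x z)"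
  by (auto simp: dn_def)

lemma dn_mono: "dn \<Gamma> x y p \<Longrightarrow> ext \<Gamma> \<Delta> \<Longrightarrow> dn \<Delta> x y p"
  unfolding dn_def by (blast intro: obj_mono has_mono)

lemma has_down: "obj \<Gamma> x \<Longrightarrow> obj \<Gamma> z \<Longrightarrow> has \<Gamma> (down x z) (U i)"
  unfolding down_def by (intro has_clos_ty base has_opp objD)

lemma dn_nil: "obj \<Gamma> x \<Longrightarrow> dn \<Gamma> x x (dnil x)"
  unfolding dn_def down_def dnil_def by (intro conjI has_clos_nil base has_opp objD)

lemma has_opp_step:
  assumes "obj \<Gamma> x" "obj \<Gamma> y" "has \<Gamma> s (R \<cdot> x \<cdot> y)"
  shows "has \<Gamma> s (opp \<cdot> y \<cdot> x)"
  by (rule has_conv[OF assms(3) jeq_symI[OF jeq_opp[OF assms(2,1)]]])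

lemma dn_cons: "obj \<Gamma> x \<Longrightarrow> has \<Gamma> s (R \<cdot> x \<cdot> y) \<Longrightarrow> dn \<Gamma> y z p \<Longrightarrow> dn \<Gamma> x z (dcons x y z s p)"
  unfolding dn_def down_def dcons_def
  by (auto intro!: has_clos_snoc base has_opp has_opp_step dest: objD)

lemma arr_path: "dn \<Gamma> x z p \<Longrightarrow> arr \<Gamma> x z (path x z p)"
  unfolding arr_def dn_def down_def path_def
  by (auto intro!: recursor.has_clos_rec[OF path_recursor] dest: objD)

lemma jeq_path_nil:
  assumes "obj \<Gamma> x"
  shows "jeq \<Gamma> (path x x (dnil x)) (eps x) (Z x x)"
  unfolding path_def dnil_def
  by (rule recursor.jeq_clos_rec_nil[OF path_recursor[OF objD(1)[OF assms]] objD(2)[OF assms]])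

lemma eqv_path_nil: "obj \<Gamma> x \<Longrightarrow> eqv \<Gamma> x x (path x x (dnil x)) (eps x)"
  by (intro eqv_jeq arr_path dn_nil arr_eps jeq_path_nil)

lemma eqv_path_cons:
  assumes x: "obj \<Gamma> x" and s: "has \<Gamma> s (R \<cdot> x \<cdot> y)" and p: "dn \<Gamma> y z p"
  shows "eqv \<Gamma> x z (path x z (dcons x y z s p)) (cmp x y z (fwd x y s) (path y z p))"
proof (rule eqv_jeq)
  show "arr \<Gamma> x z (path x z (dcons x y z s p))" "arr \<Gamma> x z (cmp x y z (fwd x y s) (path y z p))"
    by (intro arr_path dn_cons x s p arr_cmp arr_forward dnD(1)[OF p])+
  show "jeq \<Gamma> (path x z (dcons x y z s p)) (cmp x y z (fwd x y s) (path y z p)) (Z x z)"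
    unfolding path_def dcons_def
    using x p has_opp_step[OF x dnD(1)[OF p] s]
    by (intro recursor.jeq_clos_rec_snoc[OF path_recursor]) (auto simp: dn_def down_def obj_def)
qed

text \<open>Induction that peels off the first step. The swapped order of arguments in
  \<open>fM\<close> is that of the underlying family, where the target comes first.\<close>

lemma down_induct:
  assumes M: "\<And>\<Delta> x z p. ext \<Gamma> \<Delta> \<Longrightarrow> dn \<Delta> x z p \<Longrightarrow> has \<Delta> (M x z p) (U i)"
    and fM: "family3 (length \<Gamma>) (\<lambda>z x p. M x z p)"
    and n: "\<And>\<Delta> x. ext \<Gamma> \<Delta> \<Longrightarrow> obj \<Delta> x \<Longrightarrow> inh \<Delta> (M x x (dnil x))"
    and s: "\<And>\<Delta> x y z s p. ext \<Gamma> \<Delta> \<Longrightarrow> obj \<Delta> x \<Longrightarrow> has \<Delta> s (R \<cdot> x \<cdot> y) \<Longrightarrow> dn \<Delta> y z p \<Longrightarrow>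
      inh \<Delta> (M y z p) \<Longrightarrow> inh \<Delta> (M x z (dcons x y z s p))"
    and p: "dn \<Gamma> x z p"
  shows "inh \<Gamma> (M x z p)"
proof -
  have e: "ext \<Gamma>0 \<Gamma>" by (rule objD[OF dnD(1)[OF p]])
  have o: "obj \<Delta> x" if "ext \<Gamma> \<Delta>" "has \<Delta> x A" for \<Delta> x
    using ext_trans[OF e that(1)] that(2) by (simp add: obj_def)
  show ?thesis
  proof (rule inh_clos_ind[where M = "\<lambda>z x p. M x z p", OF base(1)[OF e] has_opp[OF e] M fM])
    show "ext \<Gamma> \<Delta> \<Longrightarrow> ext \<Gamma> \<Delta>" for \<Delta> .
    show "dn \<Delta> x z p" if "ext \<Gamma> \<Delta>" "has \<Delta> z A" "has \<Delta> x A" "has \<Delta> p (clos_ty i A opp z x)" for \<Delta> x z p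
      using that o by (simp add: dn_def down_def)
    show "inh \<Delta> (M x x (clos_nil i A opp x))" if "ext \<Gamma> \<Delta>" "has \<Delta> x A" for \<Delta> x
      using n that o by (simp add: dnil_def)
    show "inh \<Delta> (M x z (clos_snoc i A opp z y x p s))" if "ext \<Gamma> \<Delta>" "has \<Delta> z A" "has \<Delta> y A" "has \<Delta> x A"
      "has \<Delta> p (clos_ty i A opp z y)" "has \<Delta> s (opp \<cdot> y \<cdot> x)" "inh \<Delta> (M y z p)" for \<Delta> x y z p s
    proof (rule s[unfolded dcons_def, OF that(1) _ _ _ that(7)])
      show "obj \<Delta> x" "dn \<Delta> y z p" using that o by (simp_all add: dn_def down_def)
      show "has \<Delta> s (R \<cdot> x \<cdot> y)" by (rule has_conv[OF that(6) jeq_opp]) (use that o in auto)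
    qed
  qed (use p in \<open>auto simp: dn_def obj_def down_def\<close>)
qed

section \<open>Quantifiers over objects, zig-zags and descending paths\<close>

lemma has_pi_obj:
  assumes "ext \<Gamma>0 \<Gamma>" "\<And>\<Delta> x. ext \<Gamma> \<Delta> \<Longrightarrow> has \<Delta> x A \<Longrightarrow> obj \<Delta> x \<Longrightarrow> has \<Delta> (B x) (U i)" "family (length \<Gamma>) B"
  shows "has \<Gamma> (pi A B) (U i)"
  by (rule has_pi[OF base(1)[OF assms(1)] _ assms(3)]) (rule assms(2), auto intro: objI ext_trans[OF
    assms(1)])

lemma has_pi_arr:
  assumes "obj \<Gamma> x" "obj \<Gamma> y"
    "\<And>\<Delta> u. ext \<Gamma> \<Delta> \<Longrightarrow> has \<Delta> u (Z x y) \<Longrightarrow> arr \<Delta> x y u \<Longrightarrow> has \<Delta> (B u) (U i)" "family (length \<Gamma>) B"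
  shows "has \<Gamma> (pi (Z x y) B) (U i)"
  by (rule has_pi[OF has_Z[OF assms(1,2)] _ assms(4)]) (rule assms(3), auto simp: arr_def intro:
    obj_mono assms(1,2))

lemma has_pi_down:
  assumes "obj \<Gamma> x" "obj \<Gamma> y"
    "\<And>\<Delta> p. ext \<Gamma> \<Delta> \<Longrightarrow> has \<Delta> p (down x y) \<Longrightarrow> dn \<Delta> x y p \<Longrightarrow> has \<Delta> (B p) (U i)" "family (length \<Gamma>) B"
  shows "has \<Gamma> (pi (down x y) B) (U i)"
  by (rule has_pi[OF has_down[OF assms(1,2)] _ assms(4)]) (rule assms(3), auto simp: dn_def intro:
    obj_mono assms(1,2))

lemma has_sigma_obj:
  assumes "ext \<Gamma>0 \<Gamma>" "\<And>\<Delta> x. ext \<Gamma> \<Delta> \<Longrightarrow> has \<Delta> x A \<Longrightarrow> obj \<Delta> x \<Longrightarrow> has \<Delta> (B x) (U i)" "family (length \<Gamma>) B"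
  shows "has \<Gamma> (sigma_ty i A (lam A B)) (U i)"
  by (rule has_sigma_ty[OF base(1)[OF assms(1)] _ assms(3)]) (rule assms(2), auto intro: objI
    ext_trans[OF assms(1)])

lemma has_sigma_down:
  assumes "obj \<Gamma> x" "obj \<Gamma> y"
    "\<And>\<Delta> p. ext \<Gamma> \<Delta> \<Longrightarrow> has \<Delta> p (down x y) \<Longrightarrow> dn \<Delta> x y p \<Longrightarrow> has \<Delta> (B p) (U i)" "family (length \<Gamma>) B"
  shows "has \<Gamma> (sigma_ty i (down x y) (lam (down x y) B)) (U i)"
  by (rule has_sigma_ty[OF has_down[OF assms(1,2)] _ assms(4)]) (rule assms(3), auto simp: dn_def
    intro: obj_mono assms(1,2))

lemma inh_pi_obj:
  assumes "ext \<Gamma>0 \<Gamma>" "\<And>\<Delta> x. ext \<Gamma> \<Delta> \<Longrightarrow> has \<Delta> x A \<Longrightarrow> obj \<Delta> x \<Longrightarrow> inh \<Delta> (B x)" "family (length \<Gamma>) B"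
  shows "inh \<Gamma> (pi A B)"
  by (rule inh_pi[OF base(1)[OF assms(1)] assms(3)]) (rule assms(2), auto intro: objI ext_trans[OF
    assms(1)])

lemma inh_pi_arr:
  assumes "obj \<Gamma> x" "obj \<Gamma> y"
    "\<And>\<Delta> u. ext \<Gamma> \<Delta> \<Longrightarrow> has \<Delta> u (Z x y) \<Longrightarrow> arr \<Delta> x y u \<Longrightarrow> inh \<Delta> (B u)" "family (length \<Gamma>) B"
  shows "inh \<Gamma> (pi (Z x y) B)"
  by (rule inh_pi[OF has_Z[OF assms(1,2)] assms(4)]) (rule assms(3), auto simp: arr_def intro:
    obj_mono assms(1,2))

lemma inh_pi_down:
  assumes "obj \<Gamma> x" "obj \<Gamma> y"
    "\<And>\<Delta> p. ext \<Gamma> \<Delta> \<Longrightarrow> has \<Delta> p (down x y) \<Longrightarrow> dn \<Delta> x y p \<Longrightarrow> inh \<Delta> (B p)" "family (length \<Gamma>) B"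
  shows "inh \<Gamma> (pi (down x y) B)"
  by (rule inh_pi[OF has_down[OF assms(1,2)] assms(4)]) (rule assms(3), auto simp: dn_def intro:
    obj_mono assms(1,2))

lemmas path_uniformity = uniformity related_Z related_down related_base

lemmas path_climb = obj_mono[rotated] arr_mono[rotated] dn_mono[rotated] climb

lemmas formation = has_pi_obj has_pi_arr has_pi_down has_sigma_obj has_sigma_down has_rw arr_cmp
  arr_path arr_eps

text \<open>The completed square is data: an object \<open>d\<close>, two descending legs and a
  rewrite zig-zag. Allowing arbitrary zig-zags \<open>u\<close> and \<open>v\<close> lets one type
  express both confluence, with two descending paths, and valleys, with \<open>v\<close>
  empty.\<close>

definition join :: "stm \<Rightarrow> stm \<Rightarrow> stm \<Rightarrow> stm \<Rightarrow> stm \<Rightarrow> stm" where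
  "join x y z u v = sigma_ty i A (\<Lambda> d:A. sigma_ty i (down y d) (\<Lambda> l:down y d. sigma_ty i (down z d)
    (\<Lambda> r:down z d.
     rw x d (cmp x y d u (path y d l)) (cmp x z d v (path z d r)))))"

lemma related_join:
  assumes "traversal \<phi> p q (length \<Gamma>0)"
  shows "related \<phi> p q b x x' \<Longrightarrow> related \<phi> p q b y y' \<Longrightarrow> related \<phi> p q b z z' \<Longrightarrow>
      related \<phi> p q b u u' \<Longrightarrow> related \<phi> p q b v v' \<Longrightarrow> related \<phi> p q b (join x y z u v) (join x' y' z'
        u' v')"
  using assms related_base[OF assms] unfolding join_def
  by - (assumption | rule related_intros related_Z related_down | erule related_weaken)+

lemma has_join:
  assumes "arr \<Gamma> x y u" "arr \<Gamma> x z v"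
  shows "has \<Gamma> (join x y z u v) (U i)"
  using assms arrD[OF assms(1)] arrD[OF assms(2)] objD[OF arrD(1)[OF assms(1)]] objD[OF arrD(2)[OF
    assms(1)]] objD[OF arrD(2)[OF assms(2)]]
  unfolding join_def
  by - (assumption | rule formation path_uniformity | erule path_climb)+

lemma inh_sigma_downI:
  assumes p: "dn \<Gamma> x y p"
    and B: "\<And>\<Delta> p. ext \<Gamma> \<Delta> \<Longrightarrow> has \<Delta> p (down x y) \<Longrightarrow> dn \<Delta> x y p \<Longrightarrow> has \<Delta> (B p) (U i)"
    and fB: "family (length \<Gamma>) B" and b: "inh \<Gamma> (B p)"
  shows "inh \<Gamma> (sigma_ty i (down x y) (lam (down x y) B))"
  by (rule inh_sigmaI[OF has_down[OF dnD(1,2)[OF p]] _ fB dnD(3)[OF p] b])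
    (rule B, auto simp: dn_def intro: obj_mono dnD[OF p])

lemma inh_sigma_downE:
  assumes p: "inh \<Gamma> (sigma_ty i (down x y) (lam (down x y) B))" and x: "obj \<Gamma> x" "obj \<Gamma> y"
    and B: "\<And>\<Delta> p. ext \<Gamma> \<Delta> \<Longrightarrow> has \<Delta> p (down x y) \<Longrightarrow> dn \<Delta> x y p \<Longrightarrow> has \<Delta> (B p) (U i)"
    and fB: "family (length \<Gamma>) B" and T: "has \<Gamma> T (U j)"
    and t: "\<And>\<Delta> p. ext \<Gamma> \<Delta> \<Longrightarrow> dn \<Delta> x y p \<Longrightarrow> inh \<Delta> (B p) \<Longrightarrow> inh \<Delta> T"
  shows "inh \<Gamma> T"
proof (rule inh_sigmaE[OF p T has_down[OF x] _ fB])
  show "has \<Delta> (B p) (U i)" if "ext \<Gamma> \<Delta>" "has \<Delta> p (down x y)" for \<Delta> p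
    by (rule B) (use that in \<open>auto simp: dn_def intro: obj_mono x\<close>)
  show "inh \<Delta> T" if "ext \<Gamma> \<Delta>" "has \<Delta> p (down x y)" "inh \<Delta> (B p)" for \<Delta> p
    by (rule t) (use that in \<open>auto simp: dn_def intro: obj_mono x\<close>)
qed

lemma joinI:
  assumes u: "arr \<Gamma> x y u" and v: "arr \<Gamma> x z v" and l: "dn \<Gamma> y d l" and r: "dn \<Gamma> z d r"
    and e: "eqv \<Gamma> x d (cmp x y d u (path y d l)) (cmp x z d v (path z d r))"
  shows "inh \<Gamma> (join x y z u v)"
proof -
  note facts = u v l r arrD[OF u] arrD[OF v] dnD[OF l] dnD[OF r]
    objD[OF arrD(1)[OF u]] objD[OF arrD(2)[OF u]] objD[OF arrD(2)[OF v]] objD[OF dnD(2)[OF l]]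
  let ?B3 = "\<lambda>d l r. rw x d (cmp x y d u (path y d l)) (cmp x z d v (path z d r))"
  let ?B2 = "\<lambda>d l. sigma_ty i (down z d) (lam (down z d) (?B3 d l))"
  let ?B1 = "\<lambda>d. sigma_ty i (down y d) (lam (down y d) (?B2 d))"
  have "inh \<Gamma> (?B2 d l)"
    by (rule inh_sigma_downI[where B = "?B3 d l", OF r _ _ eqvD(3)[OF e]]) (insert facts,
      (assumption | rule formation path_uniformity | erule path_climb)+)
  then have "inh \<Gamma> (?B1 d)"
    by (rule inh_sigma_downI[where B = "?B2 d", OF l, rotated -1]) (insert facts, (assumption | rule
      formation path_uniformity | erule path_climb)+)
  then show ?thesis
    unfolding join_def
    by (rule inh_sigmaI[where B = ?B1, OF base(1)[OF objD(1)[OF arrD(1)[OF u]]] _ _ objD(2)[OF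
      dnD(2)[OF l]], rotated -1])
      (insert facts, (assumption | rule objI formation path_uniformity | erule path_climb)+)
qed

lemma joinE:
  assumes j: "inh \<Gamma> (join x y z u v)" and u: "arr \<Gamma> x y u" and v: "arr \<Gamma> x z v" and T: "has \<Gamma> T (U j)"
    and t: "\<And>\<Delta> d l r. ext \<Gamma> \<Delta> \<Longrightarrow> dn \<Delta> y d l \<Longrightarrow> dn \<Delta> z d r \<Longrightarrow>
      eqv \<Delta> x d (cmp x y d u (path y d l)) (cmp x z d v (path z d r)) \<Longrightarrow> inh \<Delta> T"
  shows "inh \<Gamma> T"
proof -
  let ?B3 = "\<lambda>d l r. rw x d (cmp x y d u (path y d l)) (cmp x z d v (path z d r))"
  let ?B2 = "\<lambda>d l. sigma_ty i (down z d) (lam (down z d) (?B3 d l))"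
  let ?B1 = "\<lambda>d. sigma_ty i (down y d) (lam (down y d) (?B2 d))"
  note facts = u v arrD[OF u] arrD[OF v] objD[OF arrD(1)[OF u]] objD[OF arrD(2)[OF u]] objD[OF
    arrD(2)[OF v]]
  have B3: "has \<Delta> (?B3 d l r) (U i)" if "ext \<Gamma> \<Delta>" "dn \<Delta> y d l" "dn \<Delta> z d r" for \<Delta> d l r
    by (intro has_rw arr_cmp arr_path arr_mono[OF u that(1)] arr_mono[OF v that(1)] that)
  have B2: "has \<Delta> (?B2 d l) (U i)" "family (length \<Delta>) (?B3 d l)" if "ext \<Gamma> \<Delta>" "dn \<Delta> y d l" for \<Delta> d l
    using facts that dnD[OF that(2)] objD[OF dnD(2)[OF that(2)]] by - (assumption | rule formation
      path_uniformity | erule path_climb)+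
  have B1: "has \<Delta> (?B1 d) (U i)" "family (length \<Delta>) (?B2 d)" if "ext \<Gamma> \<Delta>" "obj \<Delta> d" for \<Delta> d
    using facts that objD[OF that(2)] by - (assumption | rule formation path_uniformity | erule
      path_climb)+
  show ?thesis
  proof (rule inh_sigmaE[OF j[unfolded join_def] T base(1)[OF facts(9)]])
    show "family (length \<Gamma>) ?B1" using facts by - (assumption | rule formation path_uniformity |
      erule path_climb)+
    have o: "obj \<Delta> d" if "ext \<Gamma> \<Delta>" "has \<Delta> d A" for \<Delta> d
      using that facts by (auto simp: obj_def intro: ext_trans)
    then show "has \<Delta> (?B1 d) (U i)" if "ext \<Gamma> \<Delta>" "has \<Delta> d A" for \<Delta> d
      using B1 that by blast
    fix \<Delta> d assume d: "ext \<Gamma> \<Delta>" "has \<Delta> d A" and i: "inh \<Delta> (?B1 d)"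
    note d' = o[OF d]
    show "inh \<Delta> T"
    proof (rule inh_sigma_downE[OF i _ d' _ B1(2)[OF d(1) d'] has_mono[OF T d(1)]])
      show "obj \<Delta> y" by (rule obj_mono[OF arrD(2)[OF u] d(1)])
      show "has \<Theta> (?B2 d l) (U i)" if "ext \<Delta> \<Theta>" "dn \<Theta> y d l" for \<Theta> l
        using B2(1)[OF ext_trans[OF d(1) that(1)] that(2)] .
      fix \<Theta> l assume e: "ext \<Delta> \<Theta>" and l: "dn \<Theta> y d l" and i: "inh \<Theta> (?B2 d l)"
      note e' = ext_trans[OF d(1) e]
      show "inh \<Theta> T"
      proof (rule inh_sigma_downE[OF i _ dnD(2)[OF l] _ B2(2)[OF e' l] has_mono[OF T e']])
        show "obj \<Theta> z" by (rule obj_mono[OF arrD(2)[OF v] e'])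
        show "has \<Theta>' (?B3 d l r) (U i)" if "ext \<Theta> \<Theta>'" "dn \<Theta>' z d r" for \<Theta>' r
          using B3[OF ext_trans[OF e' that(1)] dn_mono[OF l that(1)] that(2)] .
        fix \<Theta>' r assume f: "ext \<Theta> \<Theta>'" and r: "dn \<Theta>' z d r" and i: "inh \<Theta>' (?B3 d l r)"
        note f' = ext_trans[OF e' f] and l' = dn_mono[OF l f]
        show "inh \<Theta>' T"
        proof (rule t[OF f' l' r])
          show "eqv \<Theta>' x d (cmp x y d u (path y d l)) (cmp x z d v (path z d r))"
            unfolding eqv_def using i
            by (intro conjI arr_cmp arr_path arr_mono[OF u f'] arr_mono[OF v f'] l' r)
        qed
      qed
    qed
  qed
qed

text \<open>Concatenation in elimination form: all that matters is some descending path whose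
  zig-zag is equal to the composite, so no operation on \<open>down\<close> with its own computation
  rules is set up. In the induction on \<open>p\<close> its end varies, hence \<open>q\<close> is
  quantified in the motive; the final target \<open>z\<close> is fixed.\<close>

lemma down_concat:
  assumes p: "dn \<Gamma> x y p" and q: "dn \<Gamma> y z q" and T: "has \<Gamma> T (U j)"
    and t: "\<And>\<Delta> m. ext \<Gamma> \<Delta> \<Longrightarrow> dn \<Delta> x z m \<Longrightarrow> eqv \<Delta> x z (path x z m) (cmp x y z (path x y p) (path y z
      q)) \<Longrightarrow> inh \<Delta> T"
  shows "inh \<Gamma> T"
proof -
  let ?E = "\<lambda>x y p q m. rw x z (path x z m) (cmp x y z (path x y p) (path y z q))"
  let ?S = "\<lambda>x y p q. sigma_ty i (down x z) (\<Lambda> m:down x z. ?E x y p q m)"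
  let ?M = "\<lambda>x y p. \<Pi> q:down y z. ?S x y p q"
  have e: "ext \<Gamma>0 \<Gamma>" by (rule objD[OF dnD(1)[OF p]])
  note facts = e dnD(2)[OF q] objD(2)[OF dnD(2)[OF q]]
  have E: "has \<Delta> (?E x y p q m) (U i)" if "ext \<Gamma> \<Delta>" "dn \<Delta> x y p" "dn \<Delta> y z q" "dn \<Delta> x z m" for \<Delta> x y
    p q m
    by (intro has_rw arr_cmp arr_path that)
  have fE: "family (length \<Delta>) (?E x y p q)" if d: "ext \<Gamma> \<Delta>" and p: "dn \<Delta> x y p" and q: "dn \<Delta> y z q"
    for \<Delta> x y p q
    using facts d dnD(3)[OF p] objD(2)[OF dnD(1)[OF p]] objD(2)[OF dnD(2)[OF p]] dnD(3)[OF q] by -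
      (assumption | rule formation path_uniformity | erule path_climb)+
  have fS: "family (length \<Delta>) (?S x y p)" if d: "ext \<Gamma> \<Delta>" and p: "dn \<Delta> x y p" for \<Delta> x y p
    using facts d dnD(3)[OF p] objD(2)[OF dnD(1)[OF p]] objD(2)[OF dnD(2)[OF p]] by - (assumption |
      rule formation path_uniformity | erule path_climb)+
  have "inh \<Gamma> (?M x y p)"
  proof (rule down_induct[where M = ?M, OF _ _ _ _ p])
    show "family3 (length \<Gamma>) (\<lambda>y x p. ?M x y p)" using facts by - (assumption | rule formation
      path_uniformity | erule path_climb)+
    show "has \<Delta> (?M x y p) (U i)" if "ext \<Gamma> \<Delta>" "dn \<Delta> x y p" for \<Delta> x y p
      using facts that dnD[OF that(2)] objD[OF dnD(1)[OF that(2)]] objD[OF dnD(2)[OF that(2)]] by -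
        (assumption | rule formation path_uniformity | erule path_climb)+
    fix \<Delta> x assume d: "ext \<Gamma> \<Delta>" and x: "obj \<Delta> x"
    show "inh \<Delta> (?M x x (dnil x))"
    proof (rule inh_pi_down[OF x obj_mono[OF dnD(2)[OF q] d] _ fS[OF d dn_nil[OF x]]])
      fix \<Theta> q assume e: "ext \<Delta> \<Theta>" and q: "dn \<Theta> x z q"
      note de = ext_trans[OF d e] and x' = obj_mono[OF x e]
      have "eqv \<Theta> x z (cmp x x z (path x x (dnil x)) (path x z q)) (cmp x x z (eps x) (path x z q))"
        by (intro eqv_cmp eqv_path_nil eqv_refl arr_path x' q)
      also have "eqv \<Theta> x z \<dots> (path x z q)" by (intro eqv_eps_cmp arr_path q)
      finally have "inh \<Theta> (?E x x (dnil x) q q)" by (intro eqvD(3)[OF eqv_sym])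
      then show "inh \<Theta> (?S x x (dnil x) q)"
        by (rule inh_sigma_downI[where B = "?E x x (dnil x) q", OF q E fE[OF de dn_nil[OF x'] q],
          rotated -1])
          (auto intro: ext_trans[OF de] dn_nil obj_mono[OF x'] dn_mono[OF q])
    qed
    fix y w s p assume s: "has \<Delta> s (R \<cdot> x \<cdot> w)" and p: "dn \<Delta> w y p" and ih: "inh \<Delta> (?M w y p)"
    note c = dn_cons[OF x s p]
    show "inh \<Delta> (?M x y (dcons x w y s p))"
    proof (rule inh_pi_down[OF dnD(2)[OF p] obj_mono[OF dnD(2)[OF q] d] _ fS[OF d c]])
      fix \<Theta> q assume e: "ext \<Delta> \<Theta>" and q: "dn \<Theta> y z q"
      note de = ext_trans[OF d e] and x' = obj_mono[OF x e] and p' = dn_mono[OF p e] and c' =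
        dn_mono[OF c e]
      have i: "inh \<Theta> (?S w y p q)"
        by (rule inh_app[OF inh_mono[OF ih e] dnD(3)[OF q] fS[OF de p']])
      have St: "has \<Theta> (?S x y (dcons x w y s p) q) (U i)"
        by (rule has_sigma_down[OF x' dnD(2)[OF q] E fE[OF de c' q]])
         (auto intro: ext_trans[OF de] dn_mono[OF c'] dn_mono[OF q])
      show "inh \<Theta> (?S x y (dcons x w y s p) q)"
      proof (rule inh_sigma_downE[OF i dnD(1)[OF p'] dnD(2)[OF q] _ fE[OF de p' q] St])
        show "has \<Theta>' (?E w y p q m) (U i)" if "ext \<Theta> \<Theta>'" "dn \<Theta>' w z m" for \<Theta>' m
          by (rule E[OF ext_trans[OF de that(1)] dn_mono[OF p' that(1)] dn_mono[OF q that(1)] that(2)])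
        fix \<Theta>' m assume f: "ext \<Theta> \<Theta>'" and m: "dn \<Theta>' w z m" and i: "inh \<Theta>' (?E w y p q m)"
        note def = ext_trans[OF de f] and x'' = obj_mono[OF x' f] and s'' = has_mono[OF s
          ext_trans[OF e f]]
          and p'' = dn_mono[OF p' f] and q'' = dn_mono[OF q f] and c'' = dn_mono[OF c' f]
        let ?s = "fwd x w s"
        have a: "arr \<Theta>' x w ?s" by (intro arr_forward x'' s'' dnD(1)[OF m])
        \<comment> \<open>The concatenation for the longer path: its first step \<open>s\<close>,
          followed by the path \<open>m\<close> supplied by the induction hypothesis.\<close>
        have m': "dn \<Theta>' x z (dcons x w z s m)" by (rule dn_cons[OF x'' s'' m])
        have i': "eqv \<Theta>' w z (path w z m) (cmp w y z (path w y p) (path y z q))"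
          unfolding eqv_def using i by (intro conjI arr_path arr_cmp m p'' q'')
        have "eqv \<Theta>' x z (path x z (dcons x w z s m)) (cmp x w z ?s (path w z m))"
          by (rule eqv_path_cons[OF x'' s'' m])
        also have "eqv \<Theta>' x z \<dots> (cmp x w z ?s (cmp w y z (path w y p) (path y z q)))"
          by (rule eqv_cmp_right[OF a i'])
        also have "eqv \<Theta>' x z \<dots> (cmp x y z (cmp x w y ?s (path w y p)) (path y z q))"
          by (intro eqv_sym[OF eqv_assoc] a arr_path p'' q'')
        also have "eqv \<Theta>' x z \<dots> (cmp x y z (path x y (dcons x w y s p)) (path y z q))"
          by (intro eqv_cmp eqv_refl arr_path q'' eqv_sym[OF eqv_path_cons] x'' s'' p'')
        finally have "inh \<Theta>' (?E x y (dcons x w y s p) q (dcons x w z s m))" by (rule eqvD(3))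
        then show "inh \<Theta>' (?S x y (dcons x w y s p) q)"
          by (rule inh_sigma_downI[where B = "?E x y (dcons x w y s p) q", OF m' E fE[OF def c''
            q''], rotated -1])
           (auto intro: ext_trans[OF def] dn_mono[OF c''] dn_mono[OF q''])
      qed
    qed
  qed
  note i = inh_app[OF this dnD(3)[OF q] fS[OF ext_refl[OF has_ctx[OF T]] p]]
  show ?thesis
  proof (rule inh_sigma_downE[OF i dnD(1)[OF p] dnD(2)[OF q] _ fE[OF ext_refl[OF has_ctx[OF T]] p q] T])
    show "has \<Delta> (?E x y p q m) (U i)" if "ext \<Gamma> \<Delta>" "dn \<Delta> x z m" for \<Delta> m
      by (rule E[OF that(1) dn_mono[OF p that(1)] dn_mono[OF q that(1)] that(2)])
    show "inh \<Delta> T" if "ext \<Gamma> \<Delta>" "dn \<Delta> x z m" "inh \<Delta> (?E x y p q m)" for \<Delta> m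
      by (rule t[OF that(1,2)], unfold eqv_def)
        (intro conjI that arr_path arr_cmp dn_mono[OF p that(1)] dn_mono[OF q that(1)])
  qed
qed

end

section \<open>The Noetherian order\<close>

context polygraph
begin

lemma has_G: "obj \<Gamma> x \<Longrightarrow> obj \<Gamma> y \<Longrightarrow> has \<Gamma> (G \<cdot> x \<cdot> y) (U i)"
  by (rule has_rel) (auto simp: obj_def intro: base)

lemma gt_trans:
  assumes "inh \<Gamma> (G \<cdot> x \<cdot> y)" "inh \<Gamma> (G \<cdot> y \<cdot> z)" and o: "obj \<Gamma> x" "obj \<Gamma> y" "obj \<Gamma> z"
  shows "inh \<Gamma> (G \<cdot> x \<cdot> z)"
proof -
  note e = objD(1)[OF o(1)]
  note a = inh_app[OF inh_app[OF inh_app[OF inh_mono[OF trans e, unfolded transitive_def] objD(2)[OF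
    o(1)]] objD(2)[OF o(2)]] objD(2)[OF o(3)]]
  have "inh \<Gamma> (G \<cdot> x \<cdot> y \<rightarrow> G \<cdot> y \<cdot> z \<rightarrow> G \<cdot> x \<cdot> z)"
    by (rule a) (insert base[OF e] o[THEN objD(2)], (assumption | rule uniformity | erule climb)+)
  then show ?thesis
    using assms has_uniform[OF has_arrow[OF has_G has_G]] has_uniform[OF has_G] by (blast intro: inh_mp)
qed

lemma step_gt:
  assumes o: "obj \<Gamma> x" "obj \<Gamma> y" and s: "has \<Gamma> s (R \<cdot> x \<cdot> y)"
  shows "inh \<Gamma> (G \<cdot> x \<cdot> y)"
proof -
  note e = objD(1)[OF o(1)]
  note a = inh_app[OF inh_app[OF inh_mono[OF decr e, unfolded steps_decrease_def] objD(2)[OF o(1)]]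
    objD(2)[OF o(2)]]
  have "inh \<Gamma> (R \<cdot> x \<cdot> y \<rightarrow> G \<cdot> x \<cdot> y)"
    by (rule a) (insert base[OF e] o[THEN objD(2)], (assumption | rule uniformity | erule climb)+)
  then show ?thesis
    by (rule inh_mp[OF _ has_inh[OF s] has_uniform[OF has_G[OF o]]])
qed

text \<open>Accessibility is given for the reverse of \<open>G\<close>, coded as an object-level
  abstraction; beta conversion restores the order \<open>G \<cdot> a \<cdot> x\<close> in the
  induction hypothesis.\<close>

lemma noetherian_induct:
  assumes M: "\<And>\<Delta> a. ext \<Gamma> \<Delta> \<Longrightarrow> obj \<Delta> a \<Longrightarrow> has \<Delta> (M a) (U i)"
    and fM: "family (length \<Gamma>) M"
    and s: "\<And>\<Delta> a. ext \<Gamma> \<Delta> \<Longrightarrow> obj \<Delta> a \<Longrightarrow>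
      (\<And>\<Theta> x. ext \<Delta> \<Theta> \<Longrightarrow> obj \<Theta> x \<Longrightarrow> inh \<Theta> (G \<cdot> a \<cdot> x) \<Longrightarrow> inh \<Theta> (M x)) \<Longrightarrow> inh \<Delta> (M a)"
    and a: "obj \<Gamma> a"
  shows "inh \<Gamma> (M a)"
proof -
  let ?L = "\<Lambda> x:A. \<Lambda> y:A. G \<cdot> y \<cdot> x"
  have L: "has \<Gamma> ?L (A \<rightarrow> A \<rightarrow> U i)" if "ext \<Gamma>0 \<Gamma>" for \<Gamma>
    by (rule has_binary_relation[OF base(1)[OF that]]) (insert that base[OF that], (assumption |
      rule has_rel[where R = G] uniformity | erule climb)+)
  have jL: "jeq \<Delta> (?L \<cdot> x \<cdot> y) (G \<cdot> y \<cdot> x) (U i)" if "obj \<Delta> x" "obj \<Delta> y" for \<Delta> x y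
    by (rule jeq_binary_relation[OF base(1)[OF objD(1)[OF that(1)]] _ _ objD(2)[OF that(1)]
      objD(2)[OF that(2)]])
      (insert that[THEN objD(2)] base[OF objD(1)[OF that(1)]], (assumption | rule has_rel[where R =
        G] uniformity | erule climb)+)
  note e = objD[OF a]
  have o: "obj \<Delta> x" if "ext \<Gamma> \<Delta>" "has \<Delta> x A" for \<Delta> x
    using ext_trans[OF e(1) that(1)] that(2) by (simp add: obj_def)
  have acc: "inh \<Gamma> (acc_ty i A ?L a)"
    by (rule inh_app[OF inh_mono[OF noeth e(1), unfolded noetherian_def wellfounded_def] e(2)])
     (insert base[OF e(1)] L[OF e(1)], (assumption | rule uniformity | erule climb)+)
  show ?thesis
  proof (rule inh_acc_ind[OF base(1)[OF e(1)] L[OF e(1)] _ fM _ e(2) acc])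
    show "has \<Delta> (M a) (U i)" if "ext \<Gamma> \<Delta>" "has \<Delta> a A" for \<Delta> a using M o that by blast
    fix \<Delta> a assume d: "ext \<Gamma> \<Delta>" and a: "has \<Delta> a A"
      and ih: "\<And>\<Theta> x. ext \<Delta> \<Theta> \<Longrightarrow> has \<Theta> x A \<Longrightarrow> inh \<Theta> (?L \<cdot> x \<cdot> a) \<Longrightarrow> inh \<Theta> (M x)"
    note a' = o[OF d a]
    show "inh \<Delta> (M a)"
    proof (rule s[OF d a'])
      fix \<Theta> x assume f: "ext \<Delta> \<Theta>" and x: "obj \<Theta> x" and g: "inh \<Theta> (G \<cdot> a \<cdot> x)"
      show "inh \<Theta> (M x)"
        by (rule ih[OF f objD(2)[OF x] inh_conv[OF g jeq_symI[OF jL[OF x obj_mono[OF a' f]]]]])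
    qed
  qed
qed

text \<open>Keeping \<open>G \<cdot> x \<cdot> y\<close> as a premise inside the motive makes the
  empty path an identity implication; each step is then absorbed by transitivity.\<close>

lemma gt_down:
  assumes x: "obj \<Gamma> x" and p: "dn \<Gamma> y z p" and g: "inh \<Gamma> (G \<cdot> x \<cdot> y)"
  shows "inh \<Gamma> (G \<cdot> x \<cdot> z)"
proof -
  let ?M = "\<lambda>y z p. G \<cdot> x \<cdot> y \<rightarrow> G \<cdot> x \<cdot> z"
  have "inh \<Gamma> (?M y z p)"
  proof (rule down_induct[where M = ?M, OF _ _ _ _ p])
    show "family3 (length \<Gamma>) (\<lambda>z y p. ?M y z p)"
      using objD[OF x] base[OF objD(1)[OF x]] by - (assumption | rule uniformity | erule climb)+
    fix \<Delta> y assume d: "ext \<Gamma> \<Delta>"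
    note x' = obj_mono[OF x d]
    show "has \<Delta> (?M y z p) (U i)" if "dn \<Delta> y z p" for z p
      by (intro has_arrow has_G x' dnD[OF that])
    assume y: "obj \<Delta> y"
    show "inh \<Delta> (?M y y (dnil y))"
      by (rule inh_arrow[OF has_G[OF x' y] has_uniform[OF has_G[OF x' y]]])
    fix w z s p assume s: "has \<Delta> s (R \<cdot> y \<cdot> w)" and p: "dn \<Delta> w z p" and ih: "inh \<Delta> (?M w z p)"
    show "inh \<Delta> (?M y z (dcons y w z s p))"
    proof (rule inh_arrow[OF has_G[OF x' y] has_uniform[OF has_G[OF x' dnD(2)[OF p]]]])
      fix \<Theta> assume e: "ext \<Delta> \<Theta>" and g: "inh \<Theta> (G \<cdot> x \<cdot> y)"
      note x'' = obj_mono[OF x' e] and y'' = obj_mono[OF y e] and p'' = dn_mono[OF p e]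
      have "inh \<Theta> (G \<cdot> x \<cdot> w)"
        by (rule gt_trans[OF g step_gt[OF y'' dnD(1)[OF p''] has_mono[OF s e]] x'' y'' dnD(1)[OF p'']])
      then show "inh \<Theta> (G \<cdot> x \<cdot> z)"
        by (rule inh_mp[OF inh_mono[OF ih e] _ has_uniform[OF has_G[OF x'' dnD(2)[OF p'']]]])
    qed
  qed
  then show ?thesis
    by (rule inh_mp[OF _ g has_uniform[OF has_G[OF x dnD(2)[OF p]]]])
qed

section \<open>Confluence\<close>

definition conf :: "stm \<Rightarrow> stm" where
  "conf x = (\<Pi> y:A. \<Pi> z:A. \<Pi> p:down x y. \<Pi> q:down x z. join x y z (path x y p) (path x z q))"

lemma related_conf:
  assumes "traversal \<phi> p q (length \<Gamma>0)"
  shows "related \<phi> p q b x x' \<Longrightarrow> related \<phi> p q b (conf x) (conf x')"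
  using assms related_base[OF assms] unfolding conf_def
  by - (assumption | rule related_intros related_Z related_down related_join | erule related_weaken)+

lemma has_conf: "obj \<Gamma> x \<Longrightarrow> has \<Gamma> (conf x) (U i)"
  using objD[of \<Gamma> x] unfolding conf_def
  by - (assumption | rule has_join formation path_uniformity related_join | erule path_climb)+

lemma confI:
  assumes x: "obj \<Gamma> x"
    and j: "\<And>\<Delta> y z p q. ext \<Gamma> \<Delta> \<Longrightarrow> dn \<Delta> x y p \<Longrightarrow> dn \<Delta> x z q \<Longrightarrow> inh \<Delta> (join x y z (path x y p) (path x z
      q))"
  shows "inh \<Gamma> (conf x)"
  using x objD[OF x] unfolding conf_def
  by - (assumption | rule j inh_pi_obj inh_pi_down formation path_uniformity related_join | erule
        path_climb)+

lemma confD: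
  assumes c: "inh \<Gamma> (conf x)" and p: "dn \<Gamma> x y p" and q: "dn \<Gamma> x z q"
  shows "inh \<Gamma> (join x y z (path x y p) (path x z q))"
proof -
  note a = inh_app[OF inh_app[OF inh_app[OF inh_app[OF c[unfolded conf_def]
      objD(2)[OF dnD(2)[OF p]]] objD(2)[OF dnD(2)[OF q]]] dnD(3)[OF p]] dnD(3)[OF q]]
  show ?thesis
    by (rule a) (insert p q dnD(3)[OF p] objD[OF dnD(1)[OF p]] objD(2)[OF dnD(2)[OF p]] objD(2)[OF
      dnD(2)[OF q]], (assumption | rule formation path_uniformity related_join | erule path_climb)+)
qed

text \<open>The equation \<open>w = r \<cdot> l\<^sup>-\<^sup>1\<close> is stated without inverses, as a joining of \<open>w\<close> and the empty
  zig-zag.\<close>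

abbreviation "valley a b w \<equiv> join a b a w (eps a)"

lemma valley_nil:
  assumes "obj \<Gamma> a"
  shows "inh \<Gamma> (valley a a (eps a))"
  by (rule joinI[OF arr_eps[OF assms] arr_eps[OF assms] dn_nil[OF assms] dn_nil[OF assms]])
    (intro eqv_refl arr_cmp arr_eps arr_path dn_nil assms)

text \<open>Brings the two inner factors of a product of two composites next to each other, where a
  square or a cancellation can be applied to them.\<close>

lemma eqv_assoc4:
  assumes a: "arr \<Gamma> x y a" and b: "arr \<Gamma> y z b" and c: "arr \<Gamma> z t c" and d: "arr \<Gamma> t r d"
  shows "eqv \<Gamma> x r (cmp x z r (cmp x y z a b) (cmp z t r c d)) (cmp x y r a (cmp y t r (cmp y z t b
    c) d))"
proof -
  have "eqv \<Gamma> x r (cmp x z r (cmp x y z a b) (cmp z t r c d)) (cmp x y r a (cmp y z r b (cmp z t r c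
    d)))"
    by (intro eqv_assoc arr_cmp a b c d)
  also have "eqv \<Gamma> x r \<dots> (cmp x y r a (cmp y t r (cmp y z t b c) d))"
    by (intro eqv_cmp_right a eqv_sym[OF eqv_assoc] b c d)
  finally show ?thesis .
qed

text \<open>If the new step leads from \<open>b\<close> to \<open>c\<close>, confluence at
  \<open>b\<close> closes it against the right leg of the old valley, and the left leg is prolonged
  accordingly. If it leads from \<open>c\<close> to \<open>b\<close>, it is put in front of the
  right leg.\<close>

lemma valley_step:
  assumes w: "arr \<Gamma> a b w" and v: "inh \<Gamma> (valley a b w)" and cb: "inh \<Gamma> (conf b)" and c: "obj \<Gamma> c"
    and r: "has \<Gamma> r (zstep b c)"
  shows "inh \<Gamma> (valley a c (zsnoc a b c w r))"
proof -
  note a = arrD(1)[OF w] and b = arrD(2)[OF w]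
  note T = has_join[OF arr_zsnoc[OF w c r] arr_eps[OF a]]
  show ?thesis
  proof (rule joinE[OF v w arr_eps[OF a] T])
    fix \<Delta> d l p assume dd: "ext \<Gamma> \<Delta>" and l: "dn \<Delta> b d l" and p: "dn \<Delta> a d p"
      and e: "eqv \<Delta> a d (cmp a b d w (path b d l)) (cmp a a d (eps a) (path a d p))"
    note a' = obj_mono[OF a dd] and b' = obj_mono[OF b dd] and c' = obj_mono[OF c dd] and w' =
      arr_mono[OF w dd]
    have T': "has \<Theta> (valley a c (zsnoc a b c w r)) (U i)" if "ext \<Delta> \<Theta>"
        "has \<Theta> r (zstep b c)" for \<Theta> r
      by (intro has_join arr_zsnoc arr_eps arr_mono[OF w'] obj_mono[OF a'] obj_mono[OF c'] that)
    show "inh \<Delta> (valley a c (zsnoc a b c w r))"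
    proof (rule inh_sum_elim[where M = "\<lambda>r. valley a c (zsnoc a b c w r)", OF has_step[OF b' c']
      has_step[OF c' b'] has_mono[OF r dd] T'])
      show "family (length \<Delta>) (\<lambda>r. valley a c (zsnoc a b c w r))"
        using objD[OF a'] objD[OF b'] objD[OF c'] arrD(3)[OF w'] by - (assumption | rule formation
          path_uniformity related_join | erule path_climb)+
      fix \<Theta> s assume f: "ext \<Delta> \<Theta>"
      note a'' = obj_mono[OF a' f] and b'' = obj_mono[OF b' f] and c'' = obj_mono[OF c' f] and w'' =
        arr_mono[OF w' f]
        and l'' = dn_mono[OF l f] and p'' = dn_mono[OF p f] and e'' = eqv_mono[OF e f]
      {
        assume s: "has \<Theta> s (R \<cdot> b \<cdot> c)"
        show "inh \<Theta> (valley a c (zsnoc a b c w (sum_inl i (R \<cdot> b \<cdot> c) (R \<cdot> c \<cdot> b) s)))"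
        proof -
          let ?s = "fwd b c s" and ?n = "dcons b c c s (dnil c)" and ?r = "sum_inl i (R \<cdot> b \<cdot> c) (R
            \<cdot> c \<cdot> b) s"
          have r: "has \<Theta> ?r (zstep b c)"
            by (intro has_sum_inl has_step b'' c'' s)
          \<comment> \<open>The forward step as a descending path of one step, the form in which
            confluence accepts it.\<close>
          have n: "dn \<Theta> b c ?n" by (intro dn_cons dn_nil b'' c'' s)
          have fs: "arr \<Theta> b c ?s" by (intro arr_forward b'' c'' s)
          have en: "eqv \<Theta> b c (path b c ?n) ?s"
            using eqv_trans[OF eqv_path_cons[OF b'' s dn_nil[OF c'']]
                eqv_trans[OF eqv_cmp_right[OF fs eqv_path_nil[OF c'']] eqv_cmp_eps[OF fs]]] .
          note T = T'[OF f r]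
          show ?thesis
          \<comment> \<open>Confluence at \<open>b\<close> between the old right leg
            \<open>l\<close> and the new step yields the meeting object \<open>e\<close>. The new
            right leg is \<open>r'\<close>; the new left leg is \<open>p\<close> followed by
            \<open>l'\<close>.\<close>
          proof (rule joinE[OF confD[OF inh_mono[OF cb ext_trans[OF dd f]] l'' n] arr_path[OF l'']
            arr_path[OF n] T])
            fix \<Xi> e l' r' assume g: "ext \<Theta> \<Xi>" and l': "dn \<Xi> d e l'" and r': "dn \<Xi> c e r'"
              and j: "eqv \<Xi> b e (cmp b d e (path b d l) (path d e l')) (cmp b c e (path b c ?n)
                (path c e r'))"
            show "inh \<Xi> (valley a c (zsnoc a b c w ?r))"
            proof (rule down_concat[OF dn_mono[OF p'' g] l' has_mono[OF T g]])
              fix \<Xi>' m assume h: "ext \<Xi> \<Xi>'" and m: "dn \<Xi>' a e m"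
                and em: "eqv \<Xi>' a e (path a e m) (cmp a d e (path a d p) (path d e l'))"
              note gh = ext_trans[OF g h]
              note arrs = arr_mono[OF w'' gh] arr_mono[OF fs gh] arr_path[OF dn_mono[OF r' h]]
                arr_path[OF dn_mono[OF l'' gh]]
                arr_path[OF dn_mono[OF l' h]] arr_path[OF dn_mono[OF p'' gh]] arr_eps[OF obj_mono[OF
                  a'' gh]]
              have "eqv \<Xi>' a e (cmp a c e (zsnoc a b c w ?r) (path c e r')) (cmp a c e (cmp a b c w
                ?s) (path c e r'))"
                unfolding forward_single
                by (intro eqv_cmp eqv_zsnoc eqv_refl arrs obj_mono[OF c'' gh] has_mono[OF r gh])
              also have "eqv \<Xi>' a e \<dots> (cmp a b e w (cmp b c e ?s (path c e r')))"
                by (intro eqv_assoc arrs)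
              also have "eqv \<Xi>' a e \<dots> (cmp a b e w (cmp b c e (path b c ?n) (path c e r')))"
                by (intro eqv_cmp eqv_refl arrs eqv_sym[OF eqv_mono[OF en gh]])
              also have "eqv \<Xi>' a e \<dots> (cmp a b e w (cmp b d e (path b d l) (path d e l')))"
                by (intro eqv_cmp eqv_refl arrs eqv_sym[OF eqv_mono[OF j h]])
              also have "eqv \<Xi>' a e \<dots> (cmp a d e (cmp a b d w (path b d l)) (path d e l'))"
                by (intro eqv_sym[OF eqv_assoc] arrs)
              also have "eqv \<Xi>' a e \<dots> (cmp a d e (cmp a a d (eps a) (path a d p)) (path d e l'))"
                by (intro eqv_cmp eqv_refl arrs eqv_mono[OF e'' gh])
              also have "eqv \<Xi>' a e \<dots> (cmp a a e (eps a) (cmp a d e (path a d p) (path d e l')))"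
                by (intro eqv_assoc arrs)
              also have "eqv \<Xi>' a e \<dots> (cmp a a e (eps a) (path a e m))"
                by (intro eqv_cmp_right arrs eqv_sym[OF em])
              finally show "inh \<Xi>' (valley a c (zsnoc a b c w ?r))"
                by (rule joinI[OF arr_zsnoc[OF arrs(1) obj_mono[OF c'' gh] has_mono[OF r gh]]
                  arrs(7) dn_mono[OF r' h] m])
            qed
          qed
        qed
      }
      {
        assume s: "has \<Theta> s (R \<cdot> c \<cdot> b)"
        show "inh \<Theta> (valley a c (zsnoc a b c w (sum_inr i (R \<cdot> b \<cdot> c) (R \<cdot> c \<cdot> b) s)))"
        proof -
          let ?s = "fwd c b s" and ?b = "bwd b c s" and ?r = "sum_inr i (R \<cdot> b \<cdot> c) (R \<cdot> c \<cdot> b) s"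
          have r: "has \<Theta> ?r (zstep b c)"
            by (intro has_sum_inr has_step b'' c'' s)
          \<comment> \<open>The new right leg starts with the step back to \<open>b\<close>;
            together with the backward step at the end of the zig-zag it cancels, so the meeting
            object stays \<open>d\<close>.\<close>
          have n: "dn \<Theta> c d (dcons c b d s l)" by (intro dn_cons c'' s l'')
          note arrs = w'' arr_path[OF l''] arr_forward[OF c'' b'' s] arr_backward[OF b'' c'' s]
          have "eqv \<Theta> a d (cmp a c d (zsnoc a b c w ?r) (path c d (dcons c b d s l)))
              (cmp a c d (cmp a b c w ?b) (cmp c b d ?s (path b d l)))"
            unfolding backward_def
            by (intro eqv_cmp eqv_zsnoc eqv_path_cons w'' c'' r s l'')
          also have "eqv \<Theta> a d \<dots> (cmp a b d w (cmp b b d (cmp b c b ?b ?s) (path b d l)))"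
            by (intro eqv_assoc4 arrs)
          also have "eqv \<Theta> a d \<dots> (cmp a b d w (cmp b b d (eps b) (path b d l)))"
            by (intro eqv_cmp eqv_refl arrs eqv_backward_forward b'' c'' s)
          also have "eqv \<Theta> a d \<dots> (cmp a b d w (path b d l))"
            by (intro eqv_cmp_right arrs eqv_eps_cmp)
          also note e''
          finally show ?thesis
            by (rule joinI[OF arr_zsnoc[OF w'' c'' r] arr_eps[OF a''] n p''])
        qed
      }
    qed
  qed
qed

lemma related_all:
  assumes "traversal \<phi> p q (length \<Gamma>0)"
  shows "related \<phi> p q b x x' \<Longrightarrow> related \<phi> p q b a a' \<Longrightarrow> related \<phi> p q b c c' \<Longrightarrow> related \<phi> p q b w w' \<Longrightarrow>
      related \<phi> p q b (tail_below x a c w) (tail_below x' a' c' w')"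
    and "related \<phi> p q b x x' \<Longrightarrow> related \<phi> p q b a a' \<Longrightarrow> related \<phi> p q b c c' \<Longrightarrow> related \<phi> p q b w w' \<Longrightarrow>
      related \<phi> p q b (inner_below x a c w) (inner_below x' a' c' w')"
  using assms related_base[OF assms]
  by - (assumption | rule related_intros related_zig_intros | erule related_weaken)+

lemma family_G:
  assumes "obj \<Gamma> x"
  shows "family (length \<Gamma>) (\<lambda>a. G \<cdot> x \<cdot> a)"
  using objD(2)[OF assms] base(3)[OF objD(1)[OF assms]] by - (assumption | rule uniformity | erule
    climb)+

lemma has_all_but_first_G:
  assumes x: "obj \<Gamma> x" and w: "arr \<Gamma> a b w"
  shows "has \<Gamma> (tail_below x a b w) (U i)"
  by (rule has_all_but_first[OF base(1,5) _ family_G[OF x]])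
    (use x w in \<open>auto simp: arr_def obj_def zig_def intro!: has_rel base intro: has_mono ext_trans\<close>)

lemma has_all_inner_G:
  assumes x: "obj \<Gamma> x" and w: "arr \<Gamma> a b w"
  shows "has \<Gamma> (inner_below x a b w) (U i)"
  by (rule has_all_inner[OF base(1,5) _ family_G[OF x]])
    (use x w in \<open>auto simp: arr_def obj_def zig_def intro!: has_rel base intro: has_mono ext_trans\<close>)

lemma all_but_first_zsnoc:
  assumes x: "obj \<Gamma> x" and w: "arr \<Gamma> a b w" and c: "obj \<Gamma> c" and r: "has \<Gamma> r (zstep b c)"
    and h: "inh \<Gamma> (tail_below x a c (zsnoc a b c w r))"
  shows "inh \<Gamma> (tail_below x a b w)" "inh \<Gamma> (G \<cdot> x \<cdot> c)"
proof -
  let ?B = "tail_below x a b w"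
  have "jeq \<Gamma> (tail_below x a c (zsnoc a b c w r)) (sigma_ty i ?B (\<Lambda> _:?B. G \<cdot> x \<cdot> c)) (U i)"
    unfolding zsnoc_def
    by (rule jeq_all_but_first_snoc[OF base(1,5) _ family_G[OF x]])
     (use x w c has_sym_step[OF arrD(2)[OF w] c r] in \<open>auto simp: arr_def obj_def zig_def intro!:
       has_rel base intro: has_mono ext_trans\<close>)
  note s = inh_conv[OF h this]
  have f: "family (length \<Gamma>) (\<lambda>_. G \<cdot> x \<cdot> c)"
    using has_G[OF x c] by - (rule familyI, rule related_has)
  note e = inh_sigmaE[OF s _ has_all_but_first_G[OF x w] _ f]
  show "inh \<Gamma> ?B"
    by (rule e[OF has_all_but_first_G[OF x w]]) (auto intro: has_mono[OF has_G[OF x c]] has_inh)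
  show "inh \<Gamma> (G \<cdot> x \<cdot> c)"
    by (rule e[OF has_G[OF x c]]) (auto intro: has_mono[OF has_G[OF x c]])
qed

lemma all_inner_zsnoc:
  assumes x: "obj \<Gamma> x" and w: "arr \<Gamma> a b w" and c: "obj \<Gamma> c" and r: "has \<Gamma> r (zstep b c)"
    and h: "inh \<Gamma> (inner_below x a c (zsnoc a b c w r))"
  shows "inh \<Gamma> (tail_below x a b w)"
proof (rule inh_conv[OF h])
  show "jeq \<Gamma> (inner_below x a c (zsnoc a b c w r)) (tail_below x a b w) (U i)"
    unfolding zsnoc_def
    by (rule jeq_all_inner_snoc[OF base(1,5) _ family_G[OF x]])
     (use x w c has_sym_step[OF arrD(2)[OF w] c r] in \<open>auto simp: arr_def obj_def zig_def intro!:
       has_rel base intro: has_mono ext_trans\<close>)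
qed

lemma inh_arrow2:
  assumes P: "has \<Gamma> P (U i)" and Q: "has \<Gamma> Q (U i)" and T: "has \<Gamma> T (U i)"
    and t: "\<And>\<Delta>. ext \<Gamma> \<Delta> \<Longrightarrow> inh \<Delta> P \<Longrightarrow> inh \<Delta> Q \<Longrightarrow> inh \<Delta> T"
  shows "inh \<Gamma> (P \<rightarrow> Q \<rightarrow> T)"
proof (rule inh_arrow[OF P has_uniform[OF has_arrow[OF Q T]]])
  fix \<Delta> assume d: "ext \<Gamma> \<Delta>" "inh \<Delta> P"
  show "inh \<Delta> (Q \<rightarrow> T)"
    by (rule inh_arrow[OF has_mono[OF Q d(1)] has_uniform[OF has_mono[OF T d(1)]]])
      (rule t[OF ext_trans[OF d(1)] inh_mono[OF d(2)]])
qed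

lemma inh_mp2:
  assumes "inh \<Gamma> (P \<rightarrow> Q \<rightarrow> T)" "inh \<Gamma> P" "inh \<Gamma> Q" "has \<Gamma> Q (U i)" "has \<Gamma> T (U i)"
  shows "inh \<Gamma> T"
  by (rule inh_mp[OF inh_mp[OF assms(1,2) has_uniform[OF has_arrow[OF assms(4,5)]]] assms(3)
    has_uniform[OF assms(5)]])

text \<open>Induction on \<open>w\<close>: the valley of a prefix is extended by
  \<open>valley_step\<close>, which needs confluence at the last object of the prefix. That object
  lies below \<open>x\<close>, by \<open>g\<close> if the prefix is empty and by
  \<open>tail_below\<close> otherwise.\<close>

lemma all_but_first_valley:
  assumes x: "obj \<Gamma> x"
    and c: "\<And>\<Delta> b. ext \<Gamma> \<Delta> \<Longrightarrow> obj \<Delta> b \<Longrightarrow> inh \<Delta> (G \<cdot> x \<cdot> b) \<Longrightarrow> inh \<Delta> (conf b)"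
    and w: "arr \<Gamma> a b w" and g: "inh \<Gamma> (G \<cdot> x \<cdot> a)" and h: "inh \<Gamma> (tail_below x a b w)"
  shows "inh \<Gamma> (G \<cdot> x \<cdot> b)" "inh \<Gamma> (valley a b w)"
proof -
  let ?H = "\<lambda>a b w. tail_below x a b w"
  note e = objD(1)[OF x]
  note facts = e objD(2)[OF x]
  have H: "has \<Delta> (?H a b w) (U i)" if "ext \<Gamma> \<Delta>" "arr \<Delta> a b w" for \<Delta> a b w
    by (rule has_all_but_first_G[OF obj_mono[OF x that(1)] that(2)])
  have G: "has \<Delta> (G \<cdot> x \<cdot> b) (U i)" if "ext \<Gamma> \<Delta>" "obj \<Delta> b" for \<Delta> b
    by (rule has_G[OF obj_mono[OF x that(1)] that(2)])
  have V: "has \<Delta> (valley a b w) (U i)" if "arr \<Delta> a b w" for \<Delta> a b w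
    by (intro has_join arr_eps that arrD(1)[OF that])
  let ?M = "\<lambda>T a b w. G \<cdot> x \<cdot> a \<rightarrow> ?H a b w \<rightarrow> T a b w"
  note mp = inh_mp2[OF _ _ _ H]
  note imp = inh_arrow2[OF G H]
  \<comment> \<open>Proved for all extensions and all zig-zags, not just for \<open>w\<close>, since
    the valley induction uses it at each prefix.\<close>
  have last: "inh \<Delta> (G \<cdot> x \<cdot> b)" if "ext \<Gamma> \<Delta>" "arr \<Delta> a b w" "inh \<Delta> (G \<cdot> x \<cdot> a)" "inh \<Delta> (?H a b w)"
    for \<Delta> a b w
  proof (rule mp[OF _ that(3,4,1,2) G[OF that(1) arrD(2)[OF that(2)]]])
    show "inh \<Delta> (?M (\<lambda>_ b _. G \<cdot> x \<cdot> b) a b w)"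
    proof (rule zig_induct[where M = "?M (\<lambda>_ b _. G \<cdot> x \<cdot> b)", OF _ _ _ _ that(2)])
      show "family3 (length \<Delta>) (?M (\<lambda>_ b _. G \<cdot> x \<cdot> b))"
        using facts ext_trans[OF e that(1)] that(1) by - (assumption | rule formation
          path_uniformity related_all | erule path_climb)+
      show "has \<Theta> (?M (\<lambda>_ b _. G \<cdot> x \<cdot> b) a b w) (U i)" if "ext \<Delta> \<Theta>" "arr \<Theta> a b w" for \<Theta> a b w
        using ext_trans[OF \<open>ext \<Gamma> \<Delta>\<close> that(1)] that(2) arrD(1,2)[OF that(2)] by (intro has_arrow G H)
      fix \<Theta> a assume d: "ext \<Delta> \<Theta>"
      note d = ext_trans[OF that(1) d]
      show "inh \<Theta> (?M (\<lambda>_ b _. G \<cdot> x \<cdot> b) a a (eps a))" if "obj \<Theta> a"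
        by (rule imp[OF d that d arr_eps[OF that] G[OF d that]])
      fix b c w r assume *: "arr \<Theta> a b w" "obj \<Theta> c" "has \<Theta> r (zstep b c)"
      show "inh \<Theta> (?M (\<lambda>_ b _. G \<cdot> x \<cdot> b) a c (zsnoc a b c w r))"
        by (rule imp[OF d arrD(1)[OF *(1)] d arr_zsnoc[OF *] G[OF d *(2)]],
          rule all_but_first_zsnoc(2)[OF obj_mono[OF x ext_trans[OF d]] arr_mono[OF *(1)]
            obj_mono[OF *(2)] has_mono[OF *(3)]])
    qed
  qed
  show "inh \<Gamma> (G \<cdot> x \<cdot> b)" by (rule last[OF has_ext[OF base(1)[OF e]] w g h])
  have "inh \<Gamma> (?M valley a b w)"
  proof (rule zig_induct[where M = "?M valley", OF _ _ _ _ w])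
    show "family3 (length \<Gamma>) (?M valley)"
      using facts by - (assumption | rule formation path_uniformity related_all related_join | erule
        path_climb)+
    show "has \<Theta> (?M valley a b w) (U i)" if "ext \<Gamma> \<Theta>" "arr \<Theta> a b w" for \<Theta> a b w
      using that arrD(1,2)[OF that(2)] by (intro has_arrow G H V)
    fix \<Theta> a assume d: "ext \<Gamma> \<Theta>"
    show "inh \<Theta> (?M valley a a (eps a))" if "obj \<Theta> a"
      by (rule imp[OF d that d arr_eps[OF that] V[OF arr_eps[OF that]]], rule valley_nil[OF
        obj_mono[OF that]])
    fix b c w r assume *: "arr \<Theta> a b w" "obj \<Theta> c" "has \<Theta> r (zstep b c)" and ih:
      "inh \<Theta> (?M valley a b w)"
    show "inh \<Theta> (?M valley a c (zsnoc a b c w r))"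
    proof (rule imp[OF d arrD(1)[OF *(1)] d arr_zsnoc[OF *] V[OF arr_zsnoc[OF *]]])
      fix \<Xi> assume f: "ext \<Theta> \<Xi>" and g: "inh \<Xi> (G \<cdot> x \<cdot> a)" and h: "inh \<Xi> (?H a c (zsnoc a b c w r))"
      note ** = arr_mono[OF *(1) f] obj_mono[OF *(2) f] has_mono[OF *(3) f]
      note df = ext_trans[OF d f]
      have h': "inh \<Xi> (?H a b w)" by (rule all_but_first_zsnoc(1)[OF obj_mono[OF x df] ** h])
      show "inh \<Xi> (valley a c (zsnoc a b c w r))"
        by (rule valley_step[OF **(1) mp[OF inh_mono[OF ih f] g h' df **(1) V[OF **(1)]]
              \<open>\<And>\<Delta> b. ext \<Gamma> \<Delta> \<Longrightarrow> obj \<Delta> b \<Longrightarrow> inh \<Delta> (G \<cdot> x \<cdot> b) \<Longrightarrow> inh \<Delta> (conf b)\<close>[OF df arrD(2)[OF **(1)]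
                last[OF df **(1) g h']] **(2,3)])
    qed
  qed
  then show "inh \<Gamma> (valley a b w)"
    by (rule mp[OF _ g h has_ext[OF base(1)[OF e]] w V[OF w]])
qed

text \<open>The inner condition on an extended zig-zag is \<open>tail_below\<close> for its prefix,
  so the prefix has a valley and only the last step is left. Adding it needs confluence at the end
  of the prefix, not at the final object, about which the inner condition says nothing.\<close>

lemma all_inner_valley:
  assumes x: "obj \<Gamma> x"
    and c: "\<And>\<Delta> b. ext \<Gamma> \<Delta> \<Longrightarrow> obj \<Delta> b \<Longrightarrow> inh \<Delta> (G \<cdot> x \<cdot> b) \<Longrightarrow> inh \<Delta> (conf b)"
    and w: "arr \<Gamma> a b w" and g: "inh \<Gamma> (G \<cdot> x \<cdot> a)" and h: "inh \<Gamma> (inner_below x a b w)"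
  shows "inh \<Gamma> (valley a b w)"
proof -
  let ?H = "\<lambda>a b w. inner_below x a b w"
  note e = objD(1)[OF x]
  note facts = e objD(2)[OF x]
  have H: "has \<Delta> (?H a b w) (U i)" if "ext \<Gamma> \<Delta>" "arr \<Delta> a b w" for \<Delta> a b w
    by (rule has_all_inner_G[OF obj_mono[OF x that(1)] that(2)])
  have G: "has \<Delta> (G \<cdot> x \<cdot> b) (U i)" if "ext \<Gamma> \<Delta>" "obj \<Delta> b" for \<Delta> b
    by (rule has_G[OF obj_mono[OF x that(1)] that(2)])
  have V: "has \<Delta> (valley a b w) (U i)" if "arr \<Delta> a b w" for \<Delta> a b w
    by (intro has_join arr_eps that arrD(1)[OF that])
  let ?M = "\<lambda>a b w. G \<cdot> x \<cdot> a \<rightarrow> ?H a b w \<rightarrow> valley a b w"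
  note imp = inh_arrow2[OF G H]
  have "inh \<Gamma> (?M a b w)"
  proof (rule zig_induct[where M = ?M, OF _ _ _ _ w])
    show "family3 (length \<Gamma>) ?M"
      using facts by - (assumption | rule formation path_uniformity related_all related_join | erule
        path_climb)+
    show "has \<Theta> (?M a b w) (U i)" if "ext \<Gamma> \<Theta>" "arr \<Theta> a b w" for \<Theta> a b w
      using that arrD(1,2)[OF that(2)] by (intro has_arrow G H V)
    fix \<Theta> a assume d: "ext \<Gamma> \<Theta>"
    show "inh \<Theta> (?M a a (eps a))" if "obj \<Theta> a"
      by (rule imp[OF d that d arr_eps[OF that] V[OF arr_eps[OF that]]], rule valley_nil[OF
        obj_mono[OF that]])
    fix b c w r assume *: "arr \<Theta> a b w" "obj \<Theta> c" "has \<Theta> r (zstep b c)"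
    show "inh \<Theta> (?M a c (zsnoc a b c w r))"
    proof (rule imp[OF d arrD(1)[OF *(1)] d arr_zsnoc[OF *] V[OF arr_zsnoc[OF *]]])
      fix \<Xi> assume f: "ext \<Theta> \<Xi>" and g: "inh \<Xi> (G \<cdot> x \<cdot> a)" and h: "inh \<Xi> (?H a c (zsnoc a b c w r))"
      note ** = arr_mono[OF *(1) f] obj_mono[OF *(2) f] has_mono[OF *(3) f]
      note df = ext_trans[OF d f]
      have c': "inh \<Delta> (conf b)" if "ext \<Xi> \<Delta>" "obj \<Delta> b" "inh \<Delta> (G \<cdot> x \<cdot> b)" for \<Delta> b
        by (rule assms(2)[OF ext_trans[OF df that(1)] that(2,3)])
      have h': "inh \<Xi> (tail_below x a b w)" by (rule all_inner_zsnoc[OF obj_mono[OF x df] ** h])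
      note v = all_but_first_valley[OF obj_mono[OF x df] c' **(1) g h']
      show "inh \<Xi> (valley a c (zsnoc a b c w r))"
        by (rule valley_step[OF **(1) v(2) c'[OF has_ext[OF **(3)] arrD(2)[OF **(1)] v(1)] **(2,3)])
    qed
  qed
  then show ?thesis
    by (rule inh_mp2[OF _ g h has_all_inner_G[OF x w] V[OF w]])
qed

end

context polygraph
begin

lemma winkler_buchbergerE:
  assumes x: "obj \<Gamma> x" and y: "obj \<Gamma> y" and z: "obj \<Gamma> z" and s: "has \<Gamma> s (R \<cdot> x \<cdot> y)" and t:
    "has \<Gamma> t (R \<cdot> x \<cdot> z)"
    and T: "has \<Gamma> T (U j)"
    and w: "\<And>\<Delta> u. ext \<Gamma> \<Delta> \<Longrightarrow> arr \<Delta> y z u \<Longrightarrow> inh \<Delta> (inner_below x y z u) \<Longrightarrow>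
      eqv \<Delta> y z (cmp y x z (rvs x y (fwd x y s)) (fwd x z t)) u \<Longrightarrow> inh \<Delta> T"
  shows "inh \<Gamma> T"
proof -
  let ?c = "cmp y x z (rvs x y (fwd x y s)) (fwd x z t)"
  let ?I = "\<lambda>u. inner_below x y z u"
  let ?B = "\<lambda>u. sigma_ty i (?I u) (\<Lambda> _:?I u. rw y z ?c u)"
  note e = objD(1)[OF x]
  note facts = x y z e objD(2)[OF x] objD(2)[OF y] objD(2)[OF z] base[OF e] s t
  have c: "arr \<Gamma> y z ?c" by (intro arr_cmp arr_rvs arr_forward x y z s t)
  note a = inh_app[OF inh_app[OF inh_app[OF inh_app[OF inh_app[OF inh_mono[OF wb e, unfolded
    winkler_buchberger_def]
    objD(2)[OF x]] objD(2)[OF y]] objD(2)[OF z]] s] t]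
  have B: "inh \<Gamma> (sigma_ty i (Z y z) (\<Lambda> u:Z y z. ?B u))"
    by (rule a) (insert facts, (assumption | rule uniformity related_rewrite_zig related_zig_intros
      | erule climb)+)
  have arr: "arr \<Delta> y z u" if "ext \<Gamma> \<Delta>" "has \<Delta> u (Z y z)" for \<Delta> u
    using that obj_mono[OF y that(1)] obj_mono[OF z that(1)] by (simp add: arr_def)
  have I: "has \<Delta> (?I u) (U i)" if "ext \<Gamma> \<Delta>" "arr \<Delta> y z u" for \<Delta> u
    by (rule has_all_inner_G[OF obj_mono[OF x that(1)] that(2)])
  have rw: "has \<Delta> (rw y z ?c u) (U i)" if "ext \<Gamma> \<Delta>" "arr \<Delta> y z u" for \<Delta> u
    by (rule has_rw[OF arr_mono[OF c that(1)] that(2)])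
  have fam: "family (length \<Delta>) (\<lambda>_. rw y z ?c u)" if "ext \<Gamma> \<Delta>" "arr \<Delta> y z u" for \<Delta> u
    using rw[OF that] by - (rule familyI, rule related_has)
  have Bt: "has \<Delta> (?B u) (U i)" if "ext \<Gamma> \<Delta>" "arr \<Delta> y z u" for \<Delta> u
    by (rule has_sigma_ty[OF I[OF that] has_mono[OF rw[OF that]] fam[OF that]])
  show ?thesis
  proof (rule inh_sigmaE[OF B T has_Z[OF y z]])
    show "family (length \<Gamma>) ?B" using facts by - (assumption | rule uniformity related_rewrite_zig
      related_zig_intros | erule climb)+
    show "has \<Delta> (?B u) (U i)" if "ext \<Gamma> \<Delta>" "has \<Delta> u (Z y z)" for \<Delta> u by (rule Bt[OF that(1) arr[OF
      that]])
    fix \<Delta> u assume d: "ext \<Gamma> \<Delta>" "has \<Delta> u (Z y z)" and i: "inh \<Delta> (?B u)"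
    note u = arr[OF d]
    show "inh \<Delta> T"
    proof (rule inh_sigmaE[OF i has_mono[OF T d(1)] I[OF d(1) u] has_mono[OF rw[OF d(1) u]] fam[OF
      d(1) u]])
      fix \<Theta> h assume f: "ext \<Delta> \<Theta>" and h: "has \<Theta> h (?I u)" and r: "inh \<Theta> (rw y z ?c u)"
      show "inh \<Theta> T"
        by (rule w[OF ext_trans[OF d(1) f] arr_mono[OF u f] has_inh[OF h]], unfold eqv_def)
          (intro conjI arr_mono[OF c ext_trans[OF d(1) f]] arr_mono[OF u f] r)
    qed
  qed
qed

text \<open>The Newman square: a local peak is closed by a valley through objects below \<open>x\<close>, and the
  remaining two gaps by confluence at the two successors of \<open>x\<close>.\<close>

lemma newman_square:
  assumes x: "obj \<Gamma> x"
    and c: "\<And>\<Delta> b. ext \<Gamma> \<Delta> \<Longrightarrow> obj \<Delta> b \<Longrightarrow> inh \<Delta> (G \<cdot> x \<cdot> b) \<Longrightarrow> inh \<Delta> (conf b)"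
    and s: "has \<Gamma> s (R \<cdot> x \<cdot> w)" and p: "dn \<Gamma> w y p" and t: "has \<Gamma> t (R \<cdot> x \<cdot> v)" and q: "dn \<Gamma> v z q"
  shows "inh \<Gamma> (join x y z (path x y (dcons x w y s p)) (path x z (dcons x v z t q)))" (is "inh \<Gamma> ?J")
proof -
  note w = dnD(1)[OF p] and v = dnD(1)[OF q]
  note sp = dn_cons[OF x s p] and tq = dn_cons[OF x t q]
  note J = has_join[OF arr_path[OF sp] arr_path[OF tq]]
  note gw = step_gt[OF x w s] and gv = step_gt[OF x v t]
  show ?thesis
  proof (rule winkler_buchbergerE[OF x w v s t J])
    fix \<Delta>1 u assume d1: "ext \<Gamma> \<Delta>1" and u: "arr \<Delta>1 w v u" and i: "inh \<Delta>1 (inner_below x w v u)"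
      and eu: "eqv \<Delta>1 w v (cmp w x v (rvs x w (fwd x w s)) (fwd x v t)) u"
    have val: "inh \<Delta>1 (valley w v u)"
      by (rule all_inner_valley[OF obj_mono[OF x d1] c[OF ext_trans[OF d1]] u inh_mono[OF gw d1] i])
    show "inh \<Delta>1 ?J"
    proof (rule joinE[OF val u arr_eps[OF obj_mono[OF w d1]] has_mono[OF J d1]])
      fix \<Delta>2 d l r assume d2: "ext \<Delta>1 \<Delta>2" and l: "dn \<Delta>2 v d l" and r: "dn \<Delta>2 w d r"
        and el: "eqv \<Delta>2 w d (cmp w v d u (path v d l)) (cmp w w d (eps w) (path w d r))"
      note d12 = ext_trans[OF d1 d2]
      note p2 = dn_mono[OF p d12]
      show "inh \<Delta>2 ?J"
      \<comment> \<open>Confluence at \<open>w\<close> between the given path \<open>p\<close> and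
        the leg \<open>r\<close> of the valley.\<close>
      proof (rule joinE[OF confD[OF c[OF d12 dnD(1)[OF p2] inh_mono[OF gw d12]] p2 r] arr_path[OF
        p2] arr_path[OF r] has_mono[OF J d12]])
        fix \<Delta>3 e l1 r1 assume d3: "ext \<Delta>2 \<Delta>3" and l1: "dn \<Delta>3 y e l1" and r1: "dn \<Delta>3 d e r1"
          and e1: "eqv \<Delta>3 w e (cmp w y e (path w y p) (path y e l1)) (cmp w d e (path w d r) (path d
            e r1))"
        note d13 = ext_trans[OF d12 d3]
        show "inh \<Delta>3 ?J"
        \<comment> \<open>The other leg \<open>l\<close> is prolonged by \<open>r1\<close>, so that
          the remaining gap is a span of descending paths at \<open>v\<close>.\<close>
        proof (rule down_concat[OF dn_mono[OF l d3] r1 has_mono[OF J d13]])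
          fix \<Delta>4 m assume d4: "ext \<Delta>3 \<Delta>4" and m: "dn \<Delta>4 v e m"
            and em: "eqv \<Delta>4 v e (path v e m) (cmp v d e (path v d l) (path d e r1))"
          note d14 = ext_trans[OF d13 d4]
          note q4 = dn_mono[OF q d14]
          show "inh \<Delta>4 ?J"
          \<comment> \<open>Confluence at \<open>v\<close> between this prolonged leg
            \<open>m\<close> and the given path \<open>q\<close>.\<close>
          proof (rule joinE[OF confD[OF c[OF d14 dnD(1)[OF q4] inh_mono[OF gv d14]] m q4]
            arr_path[OF m] arr_path[OF q4] has_mono[OF J d14]])
            fix \<Delta>5 f r2 l2 assume d5: "ext \<Delta>4 \<Delta>5" and r2: "dn \<Delta>5 e f r2" and l2: "dn \<Delta>5 z f l2"
              and e2: "eqv \<Delta>5 v f (cmp v e f (path v e m) (path e f r2)) (cmp v z f (path v z q)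
                (path z f l2))"
            note d15 = ext_trans[OF d14 d5] and d35 = ext_trans[OF d4 d5]
            show "inh \<Delta>5 ?J"
            \<comment> \<open>The leg from \<open>y\<close> to the final meeting object
              \<open>f\<close> runs through \<open>e\<close>; the leg from \<open>z\<close> is
              \<open>l2\<close>.\<close>
            proof (rule down_concat[OF dn_mono[OF l1 d35] r2 has_mono[OF J d15]])
              fix \<Delta> n assume d6: "ext \<Delta>5 \<Delta>" and n: "dn \<Delta> y f n"
                and en: "eqv \<Delta> y f (path y f n) (cmp y e f (path y e l1) (path e f r2))"
              note d56 = ext_trans[OF d5 d6] and d36 = ext_trans[OF d35 d6] and d16 = ext_trans[OF
                d15 d6]
              note d26 = ext_trans[OF d3 d36] note du = ext_trans[OF d2 d26]
              let ?s = "fwd x w s" and ?t = "fwd x v t"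
              let ?p = "path w y p" and ?q = "path v z q" and ?l = "path v d l" and ?r = "path w d r"
              let ?l1 = "path y e l1" and ?r1 = "path d e r1" and ?l2 = "path z f l2" and ?r2 =
                "path e f r2" and ?m = "path v e m"
              note x' = obj_mono[OF x d16] and w' = obj_mono[OF w d16] and v' = obj_mono[OF v d16]
              note s' = has_mono[OF s d16] and t' = has_mono[OF t d16]
              note arrs = arr_forward[OF x' w' s'] arr_forward[OF x' v' t'] dn_mono[OF p d16, THEN
                arr_path]
                dn_mono[OF q d16, THEN arr_path] dn_mono[OF l d26, THEN arr_path] dn_mono[OF r d26,
                  THEN arr_path]
                dn_mono[OF l1 d36, THEN arr_path] dn_mono[OF r1 d36, THEN arr_path] dn_mono[OF l2
                  d6, THEN arr_path]
                dn_mono[OF r2 d6, THEN arr_path] dn_mono[OF m d56, THEN arr_path] arr_mono[OF u du]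
              note sp' = dn_mono[OF sp d16] and tq' = dn_mono[OF tq d16]
              \<comment> \<open>The Winkler-Buchberger equation as a square at \<open>x\<close>: the
                valley expresses \<open>?r\<close> through \<open>u\<close>, which is replaced by
                the peak, and the step \<open>s\<close> cancels against its reversal.\<close>
              have peak: "eqv \<Delta> x d (cmp x w d ?s ?r) (cmp x v d ?t ?l)"
              proof -
                have "eqv \<Delta> x d (cmp x w d ?s ?r) (cmp x w d ?s (cmp w w d (eps w) ?r))"
                  by (intro eqv_cmp_right arrs eqv_sym[OF eqv_eps_cmp])
                also have "eqv \<Delta> x d \<dots> (cmp x w d ?s (cmp w v d u ?l))"
                  by (intro eqv_cmp_right arrs eqv_sym[OF eqv_mono[OF el d26]])
                also have "eqv \<Delta> x d \<dots> (cmp x w d ?s (cmp w v d (cmp w x v (rvs x w ?s) ?t) ?l))"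
                  by (intro eqv_cmp eqv_refl arrs eqv_sym[OF eqv_mono[OF eu du]])
                also have "eqv \<Delta> x d \<dots> (cmp x x d (cmp x w x ?s (rvs x w ?s)) (cmp x v d ?t ?l))"
                  by (intro eqv_sym[OF eqv_assoc4] arr_rvs arrs)
                also have "eqv \<Delta> x d \<dots> (cmp x x d (eps x) (cmp x v d ?t ?l))"
                  by (intro eqv_cmp eqv_cmp_rvs eqv_refl arr_cmp arrs)
                also have "eqv \<Delta> x d \<dots> (cmp x v d ?t ?l)"
                  by (intro eqv_eps_cmp arr_cmp arrs)
                finally show ?thesis .
              qed
              have "eqv \<Delta> x f (cmp x y f (path x y (dcons x w y s p)) (path y f n)) (cmp x y f (cmp
                x w y ?s ?p) (cmp y e f ?l1 ?r2))"
                by (intro eqv_cmp eqv_path_cons en x' s' dn_mono[OF p d16])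
              also have "eqv \<Delta> x f \<dots> (cmp x w f ?s (cmp w e f (cmp w y e ?p ?l1) ?r2))"
                by (intro eqv_assoc4 arrs)
              also have "eqv \<Delta> x f \<dots> (cmp x w f ?s (cmp w e f (cmp w d e ?r ?r1) ?r2))"
                by (intro eqv_cmp eqv_refl arrs eqv_mono[OF e1 d36])
              also have "eqv \<Delta> x f \<dots> (cmp x d f (cmp x w d ?s ?r) (cmp d e f ?r1 ?r2))"
                by (intro eqv_sym[OF eqv_assoc4] arrs)
              also have "eqv \<Delta> x f \<dots> (cmp x d f (cmp x v d ?t ?l) (cmp d e f ?r1 ?r2))"
                by (intro eqv_cmp peak eqv_refl arr_cmp arrs)
              also have "eqv \<Delta> x f \<dots> (cmp x v f ?t (cmp v e f (cmp v d e ?l ?r1) ?r2))"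
                by (intro eqv_assoc4 arrs)
              also have "eqv \<Delta> x f \<dots> (cmp x v f ?t (cmp v e f ?m ?r2))"
                by (intro eqv_cmp eqv_refl arrs eqv_sym[OF eqv_mono[OF em d56]])
              also have "eqv \<Delta> x f \<dots> (cmp x v f ?t (cmp v z f ?q ?l2))"
                by (intro eqv_cmp eqv_refl arrs eqv_mono[OF e2 d6])
              also have "eqv \<Delta> x f \<dots> (cmp x z f (cmp x v z ?t ?q) ?l2)"
                by (intro eqv_sym[OF eqv_assoc] arrs)
              also have "eqv \<Delta> x f \<dots> (cmp x z f (path x z (dcons x v z t q)) ?l2)"
                by (intro eqv_cmp eqv_refl arrs eqv_sym[OF eqv_path_cons] x' t' dn_mono[OF q d16])
              finally show "inh \<Delta> ?J"
                by (rule joinI[OF arr_path[OF sp'] arr_path[OF tq'] n dn_mono[OF l2 d6]])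
            qed
          qed
        qed
      qed
    qed
  qed
qed

lemma join_nil_left:
  assumes q: "dn \<Gamma> x z q"
  shows "inh \<Gamma> (join x x z (path x x (dnil x)) (path x z q))" "inh \<Gamma> (join x z x (path x z q) (path
    x x (dnil x)))"
proof -
  note x = dnD(1)[OF q] and z = dnD(2)[OF q]
  have e: "eqv \<Gamma> x z (cmp x x z (path x x (dnil x)) (path x z q)) (cmp x z z (path x z q) (path z z
    (dnil z)))"
  proof -
    have "eqv \<Gamma> x z (cmp x x z (path x x (dnil x)) (path x z q)) (cmp x x z (eps x) (path x z q))"
      by (intro eqv_cmp eqv_path_nil eqv_refl arr_path x q)
    also have "eqv \<Gamma> x z \<dots> (path x z q)" by (intro eqv_eps_cmp arr_path q)
    also have "eqv \<Gamma> x z \<dots> (cmp x z z (path x z q) (eps z))" by (intro eqv_sym[OF eqv_cmp_eps]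
      arr_path q)
    also have "eqv \<Gamma> x z \<dots> (cmp x z z (path x z q) (path z z (dnil z)))"
      by (intro eqv_cmp_right arr_path q eqv_sym[OF eqv_path_nil] z)
    finally show ?thesis .
  qed
  show "inh \<Gamma> (join x x z (path x x (dnil x)) (path x z q))"
    by (rule joinI[OF arr_path[OF dn_nil[OF x]] arr_path[OF q] q dn_nil[OF z] e])
  show "inh \<Gamma> (join x z x (path x z q) (path x x (dnil x)))"
    by (rule joinI[OF arr_path[OF q] arr_path[OF dn_nil[OF x]] dn_nil[OF z] q eqv_sym[OF e]])
qed

text \<open>The Noetherian induction hypothesis as a type. It can thus stand as a premise inside
  motives for descending paths, where the source \<open>x\<close> varies and a hypothesis about one
  fixed \<open>x\<close> would be of no use.\<close>

definition below :: "(stm \<Rightarrow> stm) \<Rightarrow> stm \<Rightarrow> stm" where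
  "below P x = (\<Pi> b:A. G \<cdot> x \<cdot> b \<rightarrow> P b)"

lemma related_below:
  assumes "traversal \<phi> p q (length \<Gamma>0)" "related \<phi> p q b x x'"
    "\<And>c c'. related \<phi> p q True c c' \<Longrightarrow> related \<phi> p q True (P c) (P c')"
  shows "related \<phi> p q b (below P x) (below P x')"
  using assms related_base[OF assms(1)] unfolding below_def
  by - (assumption | rule related_intros | erule related_weaken)+

lemma family_below:
  assumes x: "obj \<Gamma> x" and "\<And>\<Delta>. ext \<Gamma>0 \<Delta> \<Longrightarrow> family (length \<Delta>) P"
  shows "family (length \<Gamma>) (\<lambda>b. G \<cdot> x \<cdot> b \<rightarrow> P b)"
  using objD[OF x] base[OF objD(1)[OF x]] assms(2)[OF objD(1)[OF x]]
  by - (assumption | rule uniformity | erule (1) family_related | erule climb)+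

lemma has_below:
  assumes x: "obj \<Gamma> x" and f: "\<And>\<Delta>. ext \<Gamma>0 \<Delta> \<Longrightarrow> family (length \<Delta>) P"
    and P: "\<And>\<Delta> b. obj \<Delta> b \<Longrightarrow> has \<Delta> (P b) (U i)"
  shows "has \<Gamma> (below P x) (U i)"
  unfolding below_def
  by (rule has_pi_obj[OF objD(1)[OF x] _ family_below[OF x f]]) (intro has_arrow has_G P obj_mono[OF
    x], assumption)

lemma belowI:
  assumes x: "obj \<Gamma> x" and f: "\<And>\<Delta>. ext \<Gamma>0 \<Delta> \<Longrightarrow> family (length \<Delta>) P"
    and P: "\<And>\<Delta> b. obj \<Delta> b \<Longrightarrow> has \<Delta> (P b) (U i)"
    and h: "\<And>\<Delta> b. ext \<Gamma> \<Delta> \<Longrightarrow> obj \<Delta> b \<Longrightarrow> inh \<Delta> (G \<cdot> x \<cdot> b) \<Longrightarrow> inh \<Delta> (P b)"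
  shows "inh \<Gamma> (below P x)"
  unfolding below_def
proof (rule inh_pi_obj[OF objD(1)[OF x] _ family_below[OF x f]])
  fix \<Delta> b assume d: "ext \<Gamma> \<Delta>" and b: "obj \<Delta> b"
  show "inh \<Delta> (G \<cdot> x \<cdot> b \<rightarrow> P b)"
    by (rule inh_arrow[OF has_G[OF obj_mono[OF x d] b] has_uniform[OF P[OF b]]])
      (rule h[OF ext_trans[OF d] obj_mono[OF b]])
qed

lemma belowD:
  assumes x: "obj \<Gamma> x" and f: "\<And>\<Delta>. ext \<Gamma>0 \<Delta> \<Longrightarrow> family (length \<Delta>) P"
    and P: "\<And>\<Delta> b. obj \<Delta> b \<Longrightarrow> has \<Delta> (P b) (U i)"
    and h: "inh \<Gamma> (below P x)" and b: "obj \<Gamma> b" "inh \<Gamma> (G \<cdot> x \<cdot> b)"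
  shows "inh \<Gamma> (P b)"
  by (rule inh_mp[OF inh_app[OF h[unfolded below_def] objD(2)[OF b(1)] family_below[OF x f]] b(2)
    has_uniform[OF P[OF b(1)]]])

lemma family_conf: "ext \<Gamma>0 \<Gamma> \<Longrightarrow> family (length \<Gamma>) conf"
  by - (rule familyI, (assumption | rule related_conf | erule climb)+)

lemmas conf_below = has_below[OF _ family_conf has_conf] belowI[OF _ family_conf has_conf] belowD[OF
  _ family_conf has_conf]

lemma newman_square_below:
  assumes x: "obj \<Gamma> x" and c: "inh \<Gamma> (below conf x)"
    and "has \<Gamma> s (R \<cdot> x \<cdot> w)" "dn \<Gamma> w y p" "has \<Gamma> t (R \<cdot> x \<cdot> v)" "dn \<Gamma> v z q"
  shows "inh \<Gamma> (join x y z (path x y (dcons x w y s p)) (path x z (dcons x v z t q)))"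
proof (rule newman_square[OF x _ assms(3-6)])
  show "inh \<Delta> (conf b)" if "ext \<Gamma> \<Delta>" "obj \<Delta> b" "inh \<Delta> (G \<cdot> x \<cdot> b)" for \<Delta> b
    by (rule conf_below(3)[OF obj_mono[OF x that(1)] _ _ inh_mono[OF c that(1)] that(2,3)])
qed

text \<open>Two nonempty paths form a Newman square, so \<open>down_induct\<close> on
  \<open>q\<close> serves as a case distinction. Because it varies the source, the first step of the
  other path, its target, the rest of that path and the hypothesis below \<open>x\<close> are all
  quantified in the motive.\<close>

lemma conf_step_cons:
  assumes x: "obj \<Gamma> x" and c: "inh \<Gamma> (below conf x)" and s: "has \<Gamma> s (R \<cdot> x \<cdot> w)" and p:
    "dn \<Gamma> w y p" and q: "dn \<Gamma> x z q"
  shows "inh \<Gamma> (join x y z (path x y (dcons x w y s p)) (path x z q))"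
proof -
  let ?M = "\<lambda>x z q. \<Pi> w:A. \<Pi> s:R \<cdot> x \<cdot> w. \<Pi> p:down w y. below conf x \<rightarrow> join x y z (path x y (dcons x
    w y s p)) (path x z q)"
  note e = objD(1)[OF x] and y = dnD(2)[OF p]
  have J: "has \<Delta> (join x y z (path x y (dcons x w y s p)) (path x z q)) (U i)"
    if "has \<Delta> s (R \<cdot> x \<cdot> w)" "dn \<Delta> w y p" "dn \<Delta> x z q" for \<Delta> x z q w s p
    by (intro has_join arr_path dn_cons dnD(1)[OF that(3)] that)
  have M: "inh \<Gamma> (?M x z q)"
  proof (rule down_induct[where M = ?M, OF _ _ _ _ q])
    show "family3 (length \<Gamma>) (\<lambda>z x q. ?M x z q)"
      using e y objD[OF y] by - (assumption | rule formation path_uniformity related_below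
        related_conf related_join | erule
        path_climb)+
    fix \<Delta> x assume d: "ext \<Gamma> \<Delta>"
    note y' = obj_mono[OF y d]
    note facts = d ext_trans[OF e d] y' objD(2)[OF y']
    show "has \<Delta> (?M x z q) (U i)" if q: "dn \<Delta> x z q" for z q
      using facts q dnD[OF q] objD(2)[OF dnD(1)[OF q]] objD(2)[OF dnD(2)[OF q]]
      by - (assumption | rule has_pi[OF has_step] has_arrow conf_below(1) J formation path_uniformity
        related_below related_conf related_join | erule path_climb)+
    assume x: "obj \<Delta> x"
    show "inh \<Delta> (?M x x (dnil x))"
      using facts x objD(2)[OF x]
      by - (assumption | rule inh_pi_obj inh_pi[OF has_step] inh_pi_down inh_arrow conf_below(1) J
        join_nil_left(2)[OF dn_cons] formation path_uniformity related_below related_conf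
        related_join | erule path_climb)+
    fix v z t q assume t: "has \<Delta> t (R \<cdot> x \<cdot> v)" and q: "dn \<Delta> v z q"
    show "inh \<Delta> (?M x z (dcons x v z t q))"
      using facts x objD(2)[OF x] t q dnD(3)[OF q] objD(2)[OF dnD(1)[OF q]] objD(2)[OF dnD(2)[OF q]]
      by - (assumption | rule inh_pi_obj inh_pi[OF has_step] inh_pi_down inh_arrow conf_below(1) J
        newman_square_below formation path_uniformity related_below related_conf related_join |
        erule path_climb)+
  qed
  note a = inh_mp[OF inh_app[OF inh_app[OF inh_app[OF M objD(2)[OF dnD(1)[OF p]]] s] dnD(3)[OF p]] c]
  show ?thesis
    by (rule a)
      (insert x y p q s e objD(2)[OF x] objD(2)[OF y] dnD(3)[OF p] dnD(3)[OF q] objD(2)[OF dnD(1)[OF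
        p]] objD(2)[OF dnD(2)[OF q]],
        (assumption | rule formation path_uniformity related_below related_conf related_join | erule
        path_climb)+)
qed

text \<open>The same case distinction for the first path: an empty one is joined with
  \<open>q\<close> along \<open>q\<close> itself, a nonempty one is handled by
  \<open>conf_step_cons\<close>.\<close>

lemma conf_step:
  assumes p: "dn \<Gamma> x y p" and q: "dn \<Gamma> x z q" and c: "inh \<Gamma> (below conf x)"
  shows "inh \<Gamma> (join x y z (path x y p) (path x z q))"
proof -
  let ?M = "\<lambda>x y p. \<Pi> z:A. \<Pi> q:down x z. below conf x \<rightarrow> join x y z (path x y p) (path x z q)"
  note x = dnD(1)[OF p]
  note e = objD(1)[OF x]
  have J: "has \<Delta> (join x y z (path x y p) (path x z q)) (U i)" if "dn \<Delta> x y p" "dn \<Delta> x z q" for \<Delta> x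
    y z p q
    by (intro has_join arr_path that)
  have M: "inh \<Gamma> (?M x y p)"
  proof (rule down_induct[where M = ?M, OF _ _ _ _ p])
    show "family3 (length \<Gamma>) (\<lambda>y x p. ?M x y p)"
      using e by - (assumption | rule formation path_uniformity related_below related_conf
        related_join | erule
        path_climb)+
    fix \<Delta> x assume d: "ext \<Gamma> \<Delta>"
    note facts = d ext_trans[OF e d]
    show "has \<Delta> (?M x y p) (U i)" if p: "dn \<Delta> x y p" for y p
      using facts p dnD[OF p] objD(2)[OF dnD(1)[OF p]] objD(2)[OF dnD(2)[OF p]]
      by - (assumption | rule has_arrow conf_below(1) J formation path_uniformity related_below
        related_conf related_join | erule path_climb)+
    assume x: "obj \<Delta> x"
    show "inh \<Delta> (?M x x (dnil x))"
      using facts x objD(2)[OF x] dn_nil[OF x]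
      by - (assumption | rule inh_pi_obj inh_pi_down inh_arrow conf_below(1) J join_nil_left(1)
        formation
        path_uniformity related_below related_conf related_join | erule path_climb)+
    fix w y s p assume s: "has \<Delta> s (R \<cdot> x \<cdot> w)" and p: "dn \<Delta> w y p"
    show "inh \<Delta> (?M x y (dcons x w y s p))"
      using facts x objD(2)[OF x] s p dnD(3)[OF p] objD(2)[OF dnD(1)[OF p]] objD(2)[OF dnD(2)[OF p]]
      by - (assumption | rule inh_pi_obj inh_pi_down inh_arrow conf_below(1) J[OF dn_cons]
        conf_step_cons
        formation path_uniformity related_below related_conf related_join | erule path_climb)+
  qed
  note a = inh_mp[OF inh_app[OF inh_app[OF M objD(2)[OF dnD(2)[OF q]]] dnD(3)[OF q]] c]
  show ?thesis
    by (rule a)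
      (insert x p q e objD(2)[OF x] dnD(3)[OF p] dnD(3)[OF q] objD(2)[OF dnD(2)[OF p]] objD(2)[OF
        dnD(2)[OF q]],
        (assumption | rule formation path_uniformity related_below related_conf related_join | erule
        path_climb)+)
qed

lemma confluent:
  assumes x: "obj \<Gamma> x"
  shows "inh \<Gamma> (conf x)"
proof (rule noetherian_induct[where M = conf, OF has_conf family_conf[OF objD(1)[OF x]] _ x])
  fix \<Delta> a assume d: "ext \<Gamma> \<Delta>" and a: "obj \<Delta> a"
    and ih: "\<And>\<Theta> x. ext \<Delta> \<Theta> \<Longrightarrow> obj \<Theta> x \<Longrightarrow> inh \<Theta> (G \<cdot> a \<cdot> x) \<Longrightarrow> inh \<Theta> (conf x)"
  \<comment> \<open>Internalises the induction hypothesis, which so far is a statement of the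
    metalogic.\<close>
  have b: "inh \<Delta> (below conf a)" by (rule conf_below(2)[OF a]) (assumption | rule ih)+
  show "inh \<Delta> (conf a)" by (rule confI[OF a conf_step[OF _ _ inh_mono[OF b]]])
qed

end

section \<open>Parallel descending paths are equal\<close>

lemma has_id_ty:
  assumes "has \<Gamma> X (U i)" "has \<Gamma> a X" "has \<Gamma> b X"
  shows "has \<Gamma> (id_ty i X a b) (U i)"
proof -
  note c = has_cst[OF has_ctx[OF assms(1)], of "KId i", simplified const_ty.simps arrow_def]
  show ?thesis
    unfolding id_ty_def
    by (rule has_app[OF has_app[OF has_app[OF c assms(1)] assms(2)] assms(3)]) (insert assms,
      (assumption | rule uniformity | erule climb)+)
qed

lemma inh_id_jeq:
  assumes X: "has \<Gamma> X (U i)" and b: "has \<Gamma> b X" and e: "jeq \<Gamma> a b X"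
  shows "inh \<Gamma> (id_ty i X a b)"
proof -
  note c = inh_cst[OF has_ctx[OF X], of "KRefl i", simplified const_ty.simps arrow_def]
  note d = has_cst[OF has_ctx[OF X], of "KId i", simplified const_ty.simps arrow_def]
  have r: "inh \<Gamma> (id_ty i X b b)"
    by (rule inh_app[OF inh_app[OF c X] b]) (insert X b, (assumption | rule uniformity | erule climb)+)
  have "jeq \<Gamma> (id_ty i X b b) (id_ty i X a b) (U i)"
    unfolding id_ty_def
    by (rule jeq_app[OF jeq_app[OF jeq_reflI[OF has_app[OF d X]] jeq_symI[OF e]] jeq_reflI[OF b]])
      (insert X b, (assumption | rule uniformity | erule climb)+)
  then show ?thesis by (rule inh_conv[OF r])
qed

lemma inh_sum_left:
  assumes A: "has \<Gamma> A (U i)" and B: "has \<Gamma> B (U i)" and a: "inh \<Gamma> A"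
  shows "inh \<Gamma> (sum_ty i A B)"
  by (rule inh_obtain[OF a A has_uniform[OF has_sum_ty[OF A B]]])
    (rule has_inh[OF has_sum_inl[OF has_mono[OF A] has_mono[OF B]]])

lemma inh_sum_right:
  assumes A: "has \<Gamma> A (U i)" and B: "has \<Gamma> B (U i)" and b: "inh \<Gamma> B"
  shows "inh \<Gamma> (sum_ty i A B)"
  by (rule inh_obtain[OF b B has_uniform[OF has_sum_ty[OF A B]]])
    (rule has_inh[OF has_sum_inr[OF has_mono[OF A] has_mono[OF B]]])

lemma inh_sumE:
  assumes A: "has \<Gamma> A (U i)" and B: "has \<Gamma> B (U i)" and T: "has \<Gamma> T (U j)"
    and s: "inh \<Gamma> (sum_ty i A B)"
    and l: "\<And>\<Delta>. ext \<Gamma> \<Delta> \<Longrightarrow> inh \<Delta> A \<Longrightarrow> inh \<Delta> T"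
    and r: "\<And>\<Delta>. ext \<Gamma> \<Delta> \<Longrightarrow> inh \<Delta> B \<Longrightarrow> inh \<Delta> T"
  shows "inh \<Gamma> T"
proof (rule inh_obtain[OF s has_sum_ty[OF A B] has_uniform[OF T]])
  fix \<Delta> a assume d: "ext \<Gamma> \<Delta>" and a: "has \<Delta> a (sum_ty i A B)"
  have f: "family (length \<Delta>) (\<lambda>_. T)"
    using has_mono[OF T d] by - (rule familyI, rule related_has)
  show "inh \<Delta> T"
    by (rule inh_sum_elim[where M = "\<lambda>_. T", OF has_mono[OF A d] has_mono[OF B d] a has_mono[OF
      has_mono[OF T d]] f])
      (assumption | (rule l[OF ext_trans[OF d] has_inh], assumption, assumption)
        | (rule r[OF ext_trans[OF d] has_inh], assumption, assumption))+
qed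

context polygraph
begin

definition uniq :: "stm \<Rightarrow> stm" where
  "uniq x = (\<Pi> z:A. \<Pi> p:down x z. \<Pi> q:down x z. rw x z (path x z p) (path x z q))"

lemma related_uniq:
  assumes "traversal \<phi> p q (length \<Gamma>0)"
  shows "related \<phi> p q b x x' \<Longrightarrow> related \<phi> p q b (uniq x) (uniq x')"
  using assms related_base[OF assms] unfolding uniq_def
  by - (assumption | rule related_intros related_Z related_down | erule related_weaken)+

lemma has_uniq: "obj \<Gamma> x \<Longrightarrow> has \<Gamma> (uniq x) (U i)"
  using objD[of \<Gamma> x] unfolding uniq_def
  by - (assumption | rule formation path_uniformity | erule path_climb)+

lemma family_uniq: "ext \<Gamma>0 \<Gamma> \<Longrightarrow> family (length \<Gamma>) uniq"
  by - (rule familyI, (assumption | rule related_uniq | erule climb)+)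

lemmas uniq_below = has_below[OF _ family_uniq has_uniq] belowI[OF _ family_uniq has_uniq] belowD[OF
  _ family_uniq has_uniq]

lemma uniqI:
  assumes x: "obj \<Gamma> x"
    and j: "\<And>\<Delta> z p q. ext \<Gamma> \<Delta> \<Longrightarrow> dn \<Delta> x z p \<Longrightarrow> dn \<Delta> x z q \<Longrightarrow> inh \<Delta> (rw x z (path x z p) (path x z q))"
  shows "inh \<Gamma> (uniq x)"
  using x objD[OF x] unfolding uniq_def
  by - (assumption | rule j inh_pi_obj inh_pi_down formation path_uniformity | erule path_climb)+

lemma uniqD:
  assumes c: "inh \<Gamma> (uniq x)" and p: "dn \<Gamma> x z p" and q: "dn \<Gamma> x z q"
  shows "eqv \<Gamma> x z (path x z p) (path x z q)"
proof -
  note a = inh_app[OF inh_app[OF inh_app[OF c[unfolded uniq_def] objD(2)[OF dnD(2)[OF p]]] dnD(3)[OF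
    p]] dnD(3)[OF q]]
  have "inh \<Gamma> (rw x z (path x z p) (path x z q))"
    by (rule a) (insert p q dnD(3)[OF p] objD[OF dnD(1)[OF p]] objD(2)[OF dnD(2)[OF p]], (assumption
      | rule formation path_uniformity | erule path_climb)+)
  then show ?thesis using p q by (simp add: eqv_def arr_path)
qed

abbreviation "no_steps x z u \<equiv> id_ty 0 nat_ty (clos_length i A S x z u) nat_zero"

lemma has_no_steps:
  assumes u: "arr \<Gamma> x z u"
  shows "has \<Gamma> (no_steps x z u) (U 0)"
proof -
  note n = has_nat[OF arrD(3)[OF u]]
  show ?thesis
    by (rule has_id_ty[OF n(1) _ n(2)], rule has_clos_length) (use u in \<open>auto simp: arr_def obj_def
      zig_def intro: base\<close>)
qed

text \<open>Without K, a closed path with no steps need not be the empty path: it may be the empty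
  path transported along a loop. The second alternative therefore records only the length, which is
  what \<open>cancels_empty_closed\<close> consumes; in the first, the initial step and
  \<open>gt_down\<close> give the strict inequality.\<close>

lemma down_cases:
  assumes p: "dn \<Gamma> x z p"
  shows "inh \<Gamma> (sum_ty i (G \<cdot> x \<cdot> z) (no_steps x z (path x z p)))"
proof (rule down_induct[OF _ _ _ _ p, where M = "\<lambda>x z p. sum_ty i (G \<cdot> x \<cdot> z) (no_steps x z (path x
  z p))"])
  note e = objD(1)[OF dnD(1)[OF p]]
  show "family3 (length \<Gamma>) (\<lambda>z x p. sum_ty i (G \<cdot> x \<cdot> z) (no_steps x z (path x z p)))"
    using e base[OF e] by - (assumption | rule formation path_uniformity related_clos_length | erule
      path_climb)+
  have n: "has \<Delta> (no_steps x z (path x z p)) (U i)" if "dn \<Delta> x z p" for \<Delta> x z p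
    by (rule has_cumul[OF has_no_steps[OF arr_path[OF that]] le0])
  show "has \<Delta> (sum_ty i (G \<cdot> x \<cdot> z) (no_steps x z (path x z p))) (U i)" if "dn \<Delta> x z p" for \<Delta> x z p
    by (rule has_sum_ty[OF has_G[OF dnD(1,2)[OF that]] n[OF that]])
  fix \<Delta> x assume x: "obj \<Delta> x"
  have "inh \<Delta> (no_steps x x (path x x (dnil x)))"
    by (rule inh_id_jeq[OF has_nat(1,2)[OF objD(2)[OF x]]], rule jeq_clos_length_nil)
      (use x jeq_path_nil[OF x] arr_path[OF dn_nil[OF x]] in \<open>auto simp: arr_def obj_def zig_def
        empty_zig_def intro: base\<close>)
  then show "inh \<Delta> (sum_ty i (G \<cdot> x \<cdot> x) (no_steps x x (path x x (dnil x))))"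
    by (rule inh_sum_right[OF has_G[OF x x] n[OF dn_nil[OF x]]])
  fix y z s p assume s: "has \<Delta> s (R \<cdot> x \<cdot> y)" and p: "dn \<Delta> y z p"
  have "inh \<Delta> (G \<cdot> x \<cdot> z)"
    by (rule gt_down[OF x p step_gt[OF x dnD(1)[OF p] s]])
  then show "inh \<Delta> (sum_ty i (G \<cdot> x \<cdot> z) (no_steps x z (path x z (dcons x y z s p))))"
    by (rule inh_sum_left[OF has_G[OF x dnD(2)[OF p]] n[OF dn_cons[OF x s p]]])
qed

lemma eqv_no_steps:
  assumes u: "arr \<Gamma> x x u" and n: "inh \<Gamma> (no_steps x x u)"
  shows "eqv \<Gamma> x x u (eps x)"
proof -
  note x = arrD(1)[OF u]
  note e = objD[OF x]
  note a = inh_mp[OF inh_app[OF inh_app[OF inh_mono[OF canc_empty e(1), unfolded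
    cancels_empty_closed_def] e(2)] arrD(3)[OF u]] n]
  have "inh \<Gamma> (rw x x u (eps x))"
    by (rule a) (insert base[OF e(1)] e arrD(3)[OF u], (assumption | rule uniformity
      related_clos_length related_zig_intros related_rewrite_zig |
        erule climb)+)
  then show ?thesis using u arr_eps[OF x] by (simp add: eqv_def)
qed

text \<open>In the case \<open>G \<cdot> x \<cdot> x\<close> no contradiction is derived: the
  induction hypothesis applies to \<open>x\<close> itself and yields the claim. Otherwise
  \<open>q\<close> has length zero and cancels.\<close>

lemma uniq_nil:
  assumes x: "obj \<Gamma> x" and q: "dn \<Gamma> x x q" and c: "inh \<Gamma> (below uniq x)"
  shows "inh \<Gamma> (rw x x (path x x (dnil x)) (path x x q))"
proof (rule inh_sumE[OF has_G[OF x x] has_cumul[OF has_no_steps[OF arr_path[OF q]] le0] has_rw[OF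
  arr_path[OF dn_nil[OF x]] arr_path[OF q]]
      down_cases[OF q]])
  fix \<Delta> assume d: "ext \<Gamma> \<Delta>"
  note x' = obj_mono[OF x d] and q' = dn_mono[OF q d]
  {
    assume "inh \<Delta> (G \<cdot> x \<cdot> x)"
    then have "inh \<Delta> (uniq x)"
      by (intro uniq_below(3)[OF x' _ _ inh_mono[OF c d] x'])
    then show "inh \<Delta> (rw x x (path x x (dnil x)) (path x x q))"
      by (rule eqvD(3)[OF uniqD[OF _ dn_nil[OF x'] q']])
  }
  {
    assume "inh \<Delta> (no_steps x x (path x x q))"
    then show "inh \<Delta> (rw x x (path x x (dnil x)) (path x x q))"
      by (rule eqvD(3)[OF eqv_trans[OF eqv_path_nil[OF x'] eqv_sym[OF eqv_no_steps[OF arr_path[OF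
        q']]]]])
  }
qed

lemma uniq_cons:
  assumes p: "dn \<Gamma> x z p" and q: "dn \<Gamma> x z q" and c: "inh \<Gamma> (below uniq x)" and g: "inh \<Gamma> (G \<cdot> x \<cdot> z)"
  shows "inh \<Gamma> (rw x z (path x z p) (path x z q))"
proof (rule joinE[OF confD[OF confluent[OF dnD(1)[OF p]] p q] arr_path[OF p] arr_path[OF q]
  has_rw[OF arr_path[OF p] arr_path[OF q]]])
  fix \<Delta> d l r assume dd: "ext \<Gamma> \<Delta>" and l: "dn \<Delta> z d l" and r: "dn \<Delta> z d r"
    and e: "eqv \<Delta> x d (cmp x z d (path x z p) (path z d l)) (cmp x z d (path x z q) (path z d r))"
  note p' = dn_mono[OF p dd] and q' = dn_mono[OF q dd]
  have "inh \<Delta> (uniq z)"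
    by (rule uniq_below(3)[OF dnD(1)[OF p'] _ _ inh_mono[OF c dd] dnD(2)[OF p'] inh_mono[OF g dd]])
  then have rl: "eqv \<Delta> z d (path z d r) (path z d l)" by (rule uniqD[OF _ r l])
  show "inh \<Delta> (rw x z (path x z p) (path x z q))"
    by (rule eqvD(3)[OF eqv_cancel_right[OF arr_path[OF p'] arr_path[OF q'] arr_path[OF l]
          eqv_trans[OF e eqv_cmp_right[OF arr_path[OF q'] rl]]]])
qed

text \<open>Distinguishing cases on \<open>p\<close> alone is enough: a nonempty \<open>p\<close>
  gives \<open>G \<cdot> x \<cdot> z\<close> whatever \<open>q\<close> is, and an empty
  \<open>p\<close> makes \<open>q\<close> a closed path.\<close>

lemma uniq_step:
  assumes p: "dn \<Gamma> x z p" and q: "dn \<Gamma> x z q" and c: "inh \<Gamma> (below uniq x)"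
  shows "inh \<Gamma> (rw x z (path x z p) (path x z q))"
proof -
  let ?M = "\<lambda>x z p. \<Pi> q:down x z. below uniq x \<rightarrow> rw x z (path x z p) (path x z q)"
  note x = dnD(1)[OF p]
  note e = objD(1)[OF x]
  have M: "inh \<Gamma> (?M x z p)"
  proof (rule down_induct[where M = ?M, OF _ _ _ _ p])
    show "family3 (length \<Gamma>) (\<lambda>z x p. ?M x z p)"
      using e by - (assumption | rule formation path_uniformity related_below related_uniq | erule
        path_climb)+
    fix \<Delta> x assume d: "ext \<Gamma> \<Delta>"
    note facts = d ext_trans[OF e d]
    show "has \<Delta> (?M x z p) (U i)" if p: "dn \<Delta> x z p" for z p
      using facts p dnD[OF p] objD(2)[OF dnD(1)[OF p]] objD(2)[OF dnD(2)[OF p]]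
      by - (assumption | rule has_arrow uniq_below(1) formation path_uniformity related_below
        related_uniq
        | erule path_climb)+
    assume x: "obj \<Delta> x"
    show "inh \<Delta> (?M x x (dnil x))"
      using facts x objD(2)[OF x] dn_nil[OF x]
      by - (assumption | rule inh_pi_obj inh_pi_down inh_arrow uniq_below(1) uniq_nil formation
        path_uniformity related_below related_uniq | erule path_climb)+
    fix w z s p assume s: "has \<Delta> s (R \<cdot> x \<cdot> w)" and p: "dn \<Delta> w z p"
    have g: "inh \<Delta> (G \<cdot> x \<cdot> z)" by (rule gt_down[OF x p step_gt[OF x dnD(1)[OF p] s]])
    show "inh \<Delta> (?M x z (dcons x w z s p))"
      using facts x objD(2)[OF x] s p dnD(2,3)[OF p] objD(2)[OF dnD(1)[OF p]] objD(2)[OF dnD(2)[OF p]] g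
      by - (assumption | rule inh_pi_down inh_arrow uniq_below(1) uniq_cons dn_cons inh_mono[OF g]
        formation path_uniformity related_below related_uniq | erule path_climb)+
  qed
  note a = inh_mp[OF inh_app[OF M dnD(3)[OF q]] c]
  show ?thesis
    by (rule a)
      (insert x p q e objD(2)[OF x] dnD(3)[OF p] dnD(3)[OF q] objD(2)[OF dnD(2)[OF q]], (assumption
        | rule formation path_uniformity related_below related_uniq | erule path_climb)+)
qed

lemma unique:
  assumes x: "obj \<Gamma> x"
  shows "inh \<Gamma> (uniq x)"
proof (rule noetherian_induct[where M = uniq, OF has_uniq family_uniq[OF objD(1)[OF x]] _ x])
  fix \<Delta> a assume d: "ext \<Gamma> \<Delta>" and a: "obj \<Delta> a"
    and ih: "\<And>\<Theta> x. ext \<Delta> \<Theta> \<Longrightarrow> obj \<Theta> x \<Longrightarrow> inh \<Theta> (G \<cdot> a \<cdot> x) \<Longrightarrow> inh \<Theta> (uniq x)"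
  have b: "inh \<Delta> (below uniq a)" by (rule uniq_below(2)[OF a]) (assumption | rule ih)+
  show "inh \<Delta> (uniq a)" by (rule uniqI[OF a uniq_step[OF _ _ inh_mono[OF b]]])
qed

section \<open>The homotopy basis\<close>

text \<open>Confluence now holds at every object, so a valley can be extended along any step without
  a condition on the objects of \<open>w\<close>.\<close>

lemma valley:
  assumes w: "arr \<Gamma> a b w"
  shows "inh \<Gamma> (valley a b w)"
proof (rule zig_induct[where M = valley, OF _ _ _ _ w])
  show "family3 (length \<Gamma>) valley"
    using objD(1)[OF arrD(1)[OF w]] by - (assumption | rule formation path_uniformity related_join |
      erule path_climb)+
  show "has \<Delta> (valley a b w) (U i)" if "arr \<Delta> a b w" for \<Delta> a b w
    by (intro has_join arr_eps that arrD(1)[OF that])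
qed (rule valley_nil valley_step[OF _ _ confluent[OF arrD(2)]], assumption+)+

lemma parallel_zigzags:
  assumes u: "arr \<Gamma> x y u" and v: "arr \<Gamma> x y v"
  shows "inh \<Gamma> (rw x y u v)"
proof -
  note x = arrD(1)[OF u] and y = arrD(2)[OF u]
  note T = has_rw[OF u v]
  show ?thesis
  proof (rule joinE[OF valley[OF u] u arr_eps[OF x] T])
    fix \<Delta>1 d l r assume d1: "ext \<Gamma> \<Delta>1" and l: "dn \<Delta>1 y d l" and r: "dn \<Delta>1 x d r"
      and e1: "eqv \<Delta>1 x d (cmp x y d u (path y d l)) (cmp x x d (eps x) (path x d r))"
    show "inh \<Delta>1 (rw x y u v)"
    proof (rule joinE[OF inh_mono[OF valley[OF v] d1] arr_mono[OF v d1] arr_eps[OF obj_mono[OF x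
      d1]] has_mono[OF T d1]])
      fix \<Delta>2 d' l' r' assume d2: "ext \<Delta>1 \<Delta>2" and l': "dn \<Delta>2 y d' l'" and r': "dn \<Delta>2 x d' r'"
        and e2: "eqv \<Delta>2 x d' (cmp x y d' v (path y d' l')) (cmp x x d' (eps x) (path x d' r'))"
      note d12 = ext_trans[OF d1 d2]
      note l2 = dn_mono[OF l d2]
      show "inh \<Delta>2 (rw x y u v)"
      proof (rule joinE[OF confD[OF confluent[OF obj_mono[OF y d12]] l2 l'] arr_path[OF l2]
        arr_path[OF l'] has_mono[OF T d12]])
        fix \<Delta>3 e m m' assume d3: "ext \<Delta>2 \<Delta>3" and m: "dn \<Delta>3 d e m" and m': "dn \<Delta>3 d' e m'"
          and e3: "eqv \<Delta>3 y e (cmp y d e (path y d l) (path d e m)) (cmp y d' e (path y d' l') (path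
            d' e m'))"
        note d13 = ext_trans[OF d12 d3] and d23 = ext_trans[OF d2 d3]
        show "inh \<Delta>3 (rw x y u v)"
        proof (rule down_concat[OF dn_mono[OF r d23] m has_mono[OF T d13]])
          fix \<Delta>4 n assume d4: "ext \<Delta>3 \<Delta>4" and n: "dn \<Delta>4 x e n"
            and en: "eqv \<Delta>4 x e (path x e n) (cmp x d e (path x d r) (path d e m))"
          note d14 = ext_trans[OF d13 d4]
          show "inh \<Delta>4 (rw x y u v)"
          proof (rule down_concat[OF dn_mono[OF r' ext_trans[OF d3 d4]] dn_mono[OF m' d4]
            has_mono[OF T d14]])
            fix \<Delta> n' assume d5: "ext \<Delta>4 \<Delta>" and n': "dn \<Delta> x e n'"
              and en': "eqv \<Delta> x e (path x e n') (cmp x d' e (path x d' r') (path d' e m'))"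
            note d45 = ext_trans[OF d4 d5] and d15 = ext_trans[OF d14 d5]
            note d35 = ext_trans[OF d3 d45] note d25 = ext_trans[OF d2 d35]
            note arrs = arr_mono[OF u d15] arr_mono[OF v d15] arr_eps[OF obj_mono[OF x d15]]
              dn_mono[OF l d25, THEN arr_path] dn_mono[OF r d25, THEN arr_path] dn_mono[OF l' d35,
                THEN arr_path]
              dn_mono[OF r' d35, THEN arr_path] dn_mono[OF m d45, THEN arr_path] dn_mono[OF m' d45,
                THEN arr_path]
            \<comment> \<open>One common tail for both zig-zags: by the join at \<open>y\<close>,
              the leg of the second valley continued by \<open>m'\<close> is equal to it.\<close>
            let ?w = "cmp y d e (path y d l) (path d e m)"
            have w: "arr \<Delta> y e ?w" by (intro arr_cmp arrs)
            \<comment> \<open>Stated once for both zig-zags: followed by its own half of the join,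
              each becomes the descending path from \<open>x\<close> that prolongs the other leg of
              its valley. The two resulting paths are parallel.\<close>
            have leg: "eqv \<Delta> x e (cmp x y e t (cmp y d e k j)) (path x e n)"
              if t: "arr \<Delta> x y t" and k: "arr \<Delta> y d k" and j: "arr \<Delta> d e j" and r: "arr \<Delta> x d r"
                and a: "eqv \<Delta> x d (cmp x y d t k) (cmp x x d (eps x) r)"
                and b: "eqv \<Delta> x e (path x e n) (cmp x d e r j)" for t d k j r n
            proof -
              have "eqv \<Delta> x e (cmp x y e t (cmp y d e k j)) (cmp x d e (cmp x y d t k) j)"
                by (intro eqv_sym[OF eqv_assoc] t k j)
              also have "eqv \<Delta> x e \<dots> (cmp x d e r j)"
                by (intro eqv_cmp eqv_refl j eqv_trans[OF a eqv_eps_cmp[OF r]])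
              also have "eqv \<Delta> x e \<dots> (path x e n)" by (rule eqv_sym[OF b])
              finally show ?thesis .
            qed
            have "eqv \<Delta> x e (cmp x y e u ?w) (path x e n)"
              by (rule leg[OF arrs(1,4,8,5) eqv_mono[OF e1 d25] eqv_mono[OF en d5]])
            also have "eqv \<Delta> x e \<dots> (path x e n')"
              by (rule uniqD[OF unique[OF obj_mono[OF x d15]] dn_mono[OF n d5] n'])
            also have "eqv \<Delta> x e \<dots> (cmp x y e v (cmp y d' e (path y d' l') (path d' e m')))"
              by (rule eqv_sym[OF leg[OF arrs(2,6,9,7) eqv_mono[OF e2 d35] en']])
            also have "eqv \<Delta> x e \<dots> (cmp x y e v ?w)"
              by (intro eqv_cmp_right arrs eqv_sym[OF eqv_mono[OF e3 d45]])
            finally show "inh \<Delta> (rw x y u v)"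
              by (rule eqvD(3)[OF eqv_cancel_right[OF arrs(1,2) w]])
          qed
        qed
      qed
    qed
  qed
qed

lemma inh_homotopy_basis: "inh \<Gamma>0 (homotopy_basis i A R D)"
proof -
  have "ext \<Gamma>0 \<Gamma>0" by (rule has_ext[OF A])
  then show ?thesis
    unfolding homotopy_basis_def
    by - (assumption | rule inh_pi_obj inh_pi_arr parallel_zigzags formation path_uniformity | erule
        path_climb)+
qed

end

section \<open>Well-formedness of the hypotheses and the closed theorem\<close>

lemma has_rewrite_ty:
  assumes "has \<Gamma> A (U i)" "has \<Gamma> R (A \<rightarrow> A \<rightarrow> U i)"
  shows "has \<Gamma> (rewrite_ty i A R) (U (Suc i))"
  unfolding rewrite_ty_def using assms has_cumul[OF assms(1) le_SucI[OF le_refl]] has_U'[OF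
    assms(1), of i]
  by - (assumption | rule has_pi has_arrow has_zig[THEN has_cumul] le_SucI le_refl uniformity
        related_zig_intros | erule climb)+

lemma has_rewrite_rel:
  assumes "has \<Gamma> A (U i)" "has \<Gamma> R (A \<rightarrow> A \<rightarrow> U i)" "has \<Gamma> D (rewrite_ty i A R)" "has \<Gamma> x A" "has \<Gamma> y A"
  shows "has \<Gamma> (D \<cdot> x \<cdot> y) (zig i A R x y \<rightarrow> zig i A R x y \<rightarrow> U i)"
  by (rule has_app[OF has_app[OF assms(3)[unfolded rewrite_ty_def] assms(4)] assms(5)])
    (insert assms, (assumption | rule uniformity related_zig_intros | erule climb)+)

lemma has_rewrite_zig:
  assumes "has \<Gamma> A (U i)" "has \<Gamma> R (A \<rightarrow> A \<rightarrow> U i)" "has \<Gamma> D (rewrite_ty i A R)" "has \<Gamma> x A" "has \<Gamma> y A"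
    "has \<Gamma> u (zig i A R x y)" "has \<Gamma> v (zig i A R x y)"
  shows "has \<Gamma> (rewrite_zig i A R D x y u v) (U i)" "has \<Gamma> (rewrite_seq i A R D x y u v) (U i)"
  unfolding rewrite_zig_def rewrite_seq_def
  by (rule has_zig[OF has_zig[OF assms(1,2,4,5)] has_rewrite_rel[OF assms(1-5)] assms(6,7)])
    (rule has_clos_ty[OF has_zig[OF assms(1,2,4,5)] has_rewrite_rel[OF assms(1-5)] assms(6,7)])

lemma related_rewrite_seq:
  assumes t: "traversal \<phi> p q n" and "related \<phi> p q b A A'" "related \<phi> p q b R R'"
    "related \<phi> p q b D D'"
    "related \<phi> p q b x x'" "related \<phi> p q b y y'" "related \<phi> p q b u u'" "related \<phi> p q b v v'"
  shows "related \<phi> p q b (rewrite_seq i A R D x y u v) (rewrite_seq i A' R' D' x' y' u' v')"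
  unfolding rewrite_seq_def using assms
  by - (assumption | rule related_intros related_zig_intros)+

lemma related_polygraph:
  assumes t: "traversal \<phi> p q n" and "related \<phi> p q b A A'"
  shows "related \<phi> p q b (rel_ty i A) (rel_ty i A')"
    "related \<phi> p q b R R' \<Longrightarrow> related \<phi> p q b (rewrite_ty i A R) (rewrite_ty i A' R')"
    "related \<phi> p q b G G' \<Longrightarrow> related \<phi> p q b (transitive A G) (transitive A' G')"
    "related \<phi> p q b G G' \<Longrightarrow> related \<phi> p q b (noetherian i A G) (noetherian i A' G')"
    "related \<phi> p q b R R' \<Longrightarrow> related \<phi> p q b G G' \<Longrightarrow> related \<phi> p q b (steps_decrease A R G)
      (steps_decrease A' R' G')"
    "related \<phi> p q b R R' \<Longrightarrow> related \<phi> p q b D D' \<Longrightarrow>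
      related \<phi> p q b (closed_under_congruence i A R D) (closed_under_congruence i A' R' D')"
    "related \<phi> p q b R R' \<Longrightarrow> related \<phi> p q b D D' \<Longrightarrow>
      related \<phi> p q b (cancels_inverses i A R D) (cancels_inverses i A' R' D')"
    "related \<phi> p q b R R' \<Longrightarrow> related \<phi> p q b D D' \<Longrightarrow> related \<phi> p q b G G' \<Longrightarrow>
      related \<phi> p q b (winkler_buchberger i A R D G) (winkler_buchberger i A' R' D' G')"
    "related \<phi> p q b R R' \<Longrightarrow> related \<phi> p q b D D' \<Longrightarrow>
      related \<phi> p q b (cancels_empty_closed i A R D) (cancels_empty_closed i A' R' D')"
    "related \<phi> p q b R R' \<Longrightarrow> related \<phi> p q b D D' \<Longrightarrow>
      related \<phi> p q b (homotopy_basis i A R D) (homotopy_basis i A' R' D')"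
  unfolding rewrite_ty_def rel_ty_def transitive_def noetherian_def wellfounded_def steps_decrease_def
    closed_under_congruence_def cancels_inverses_def winkler_buchberger_def cancels_empty_closed_def
    homotopy_basis_def rewrite_seq_def
  using assms
  by - (assumption | rule related_intros related_zig_intros related_rewrite_zig | erule related_weaken)+

lemma has_zig_length:
  assumes "has \<Gamma> A (U i)" "has \<Gamma> R (A \<rightarrow> A \<rightarrow> U i)" "has \<Gamma> x A" "has \<Gamma> y A" "has \<Gamma> u (zig i A R x y)"
  shows "has \<Gamma> (clos_length i A (sym_closure i A R) x y u) nat_ty"
  using has_clos_length[OF assms(1) has_sym_closure[OF assms(1,2)] assms(3,4)] assms(5) by (simp
    add: zig_def)

lemma has_zig_inner:
  assumes "has \<Gamma> A (U i)" "has \<Gamma> R (A \<rightarrow> A \<rightarrow> U i)" "has \<Gamma> G (A \<rightarrow> A \<rightarrow> U i)" "has \<Gamma> a A"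
    "has \<Gamma> x A" "has \<Gamma> y A" "has \<Gamma> u (zig i A R x y)"
  shows "has \<Gamma> (all_inner i A (sym_closure i A R) (\<lambda>z. G \<cdot> a \<cdot> z) x y u) (U i)"
  by (rule has_all_inner[OF assms(1) has_sym_closure[OF assms(1,2)] _ _ assms(5,6) assms(7)[unfolded
    zig_def]])
    (insert assms, (assumption | rule has_rel uniformity | erule climb)+)

text \<open>A premise can be introduced into the context only once it is known to be a type in a
  universe; these are the facts that the introduction rule for arrows asks for.\<close>

lemma has_hypotheses:
  assumes A: "has \<Gamma> A (U i)"
  shows "has \<Gamma> G (A \<rightarrow> A \<rightarrow> U i) \<Longrightarrow> has \<Gamma> (transitive A G) (U i)"
    and "has \<Gamma> G (A \<rightarrow> A \<rightarrow> U i) \<Longrightarrow> has \<Gamma> (noetherian i A G) (U i)"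
    and "has \<Gamma> R (A \<rightarrow> A \<rightarrow> U i) \<Longrightarrow> has \<Gamma> G (A \<rightarrow> A \<rightarrow> U i) \<Longrightarrow> has \<Gamma> (steps_decrease A R G) (U i)"
    and "has \<Gamma> R (A \<rightarrow> A \<rightarrow> U i) \<Longrightarrow> has \<Gamma> D (rewrite_ty i A R) \<Longrightarrow> has \<Gamma> (closed_under_congruence i A R
      D) (U i)"
    and "has \<Gamma> R (A \<rightarrow> A \<rightarrow> U i) \<Longrightarrow> has \<Gamma> D (rewrite_ty i A R) \<Longrightarrow> has \<Gamma> (cancels_inverses i A R D) (U i)"
    and "has \<Gamma> R (A \<rightarrow> A \<rightarrow> U i) \<Longrightarrow> has \<Gamma> D (rewrite_ty i A R) \<Longrightarrow> has \<Gamma> G (A \<rightarrow> A \<rightarrow> U i) \<Longrightarrow>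
      has \<Gamma> (winkler_buchberger i A R D G) (U i)"
    and "has \<Gamma> R (A \<rightarrow> A \<rightarrow> U i) \<Longrightarrow> has \<Gamma> D (rewrite_ty i A R) \<Longrightarrow> has \<Gamma> (cancels_empty_closed i A R D)
      (U i)"
  unfolding transitive_def noetherian_def wellfounded_def steps_decrease_def closed_under_congruence_def
    cancels_inverses_def winkler_buchberger_def cancels_empty_closed_def
  using A has_nat(1,2)[OF A]
  by - (assumption | rule has_pi has_arrow has_sigma_ty has_rel[where R = G] has_rel[where R = R]
        has_binary_relation has_acc_ty has_zig has_zconcat has_zinv has_empty_zig has_forward
        has_rewrite_zig has_zig_inner has_id_ty[THEN has_cumul] has_zig_length le0 uniformity
        related_zig_intros related_rewrite_zig related_rewrite_seq | erule climb)+

theorem theorem30: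
  fixes i :: nat
  shows "\<exists>\<alpha>. [] \<turnstile> \<alpha> : close
    (\<Pi> A:U i. \<Pi> R:rel_ty i A. \<Pi> D:rewrite_ty i A R. \<Pi> G:rel_ty i A.
      transitive A G \<rightarrow> noetherian i A G \<rightarrow> steps_decrease A R G \<rightarrow>
      closed_under_congruence i A R D \<rightarrow>
      cancels_inverses i A R D \<rightarrow>
      winkler_buchberger i A R D G \<rightarrow>
      cancels_empty_closed i A R D \<rightarrow>
      homotopy_basis i A R D)"
proof -
  \<comment> \<open>Products and arrows are introduced one after the other, each extending the
    context. At the end the context reached plays the role of \<open>\<Gamma>0\<close>, and the
    accumulated variables and inhabited premises form an instance of
    \<open>polygraph\<close>.\<close>
  have "inh [] (\<Pi> A:U i. \<Pi> R:rel_ty i A. \<Pi> D:rewrite_ty i A R. \<Pi> G:rel_ty i A.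
      transitive A G \<rightarrow> noetherian i A G \<rightarrow> steps_decrease A R G \<rightarrow>
      closed_under_congruence i A R D \<rightarrow>
      cancels_inverses i A R D \<rightarrow>
      winkler_buchberger i A R D G \<rightarrow>
      cancels_empty_closed i A R D \<rightarrow>
      homotopy_basis i A R D)"
    using has_U[OF ctx_Nil, of i]
    by - (assumption | rule inh_pi inh_arrow has_rel_ty[folded rel_ty_def] has_rewrite_ty[folded
      rel_ty_def] has_hypotheses[folded rel_ty_def]
      polygraph.inh_homotopy_basis[OF polygraph.intro, folded rel_ty_def]
      | rule uniformity related_polygraph | (rule inh_mono[rotated], assumption) | erule climb)+
  then show ?thesis
    by (simp add: inh_def close_def)
qed

end
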